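(* Let $\mathcal M(\mathfrak s)$ be an $\mathfrak m$-critical closed RW spacetime of Class I, with cosmological constant $\Lambda$, angular parameter $\vartheta\in(-\pi/3,0)$, and positive internal parameter $\mathcal H$. Let $(\widetilde{\mathcal M}_{\mathcal H,\vartheta},\ell_{\mathcal H,\vartheta})$ denote its conformal model. Put $$\widehat f_1(\vartheta,\mathcal H)=\frac1{3\mathcal H^2}\left(1-\cos\vartheta+\sqrt3\sin\vartheta\right)^2,$$ $$\widehat f_2(\vartheta,\mathcal H)=\frac2{9\mathcal H^2}\sin^2\!\left(\frac\vartheta2\right)\left(7+\cos\vartheta-2\cos2\vartheta+5\sqrt3\sin\vartheta\right),$$ $$\widehat f_3(\vartheta,\mathcal H)=\frac1{6\mathcal H^2}\left(1-2\cos\vartheta-\cos2\vartheta+2\cos3\vartheta+2\sqrt3\sin\vartheta-\sqrt3\sin2\vartheta\right).$$ Then $$\Lambda\le\widehat f_1(\vartheta,\mathcal H),\qquad \widetilde{\mathcal M}_{\mathcal H,\vartheta}=\mathbb R\times\mathbb S^3,$$ and $\ell_{\mathcal H,\vartheta}$ is the cyclic quadratic form $$\ell_{\mathcal H,\vartheta}=\frac{9\mathcal H^2}{(12\widehat\wp_\vartheta-1)^2}\,(-d\tau^2+g).$$ The form $\ell_{\mathcal H,\vartheta}$ vanishes along the totally umbilical spacelike hypersurfaces $$\mathbb S^3_h=\{(\tau,p)\in\widetilde{\mathcal M}_{\mathcal H,\vartheta}\mid\tau=2h\omega_\vartheta\},\qquad h\in\mathbb Z,$$ and is nondegenerate and of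 Lorentz type on the complement of $\bigcup_{h\in\mathbb Z}\mathbb S^3_h$. The weak energy condition is automatically satisfied. The dominant energy condition is satisfied if and only if $\Lambda\le\widehat f_2(\vartheta,\mathcal H)$. The strong energy condition is satisfied if and only if $\widehat f_3(\vartheta,\mathcal H)\le\Lambda\le\widehat f_2(\vartheta,\mathcal H)$.
   Context: RW spacetimes. Let $g$ be the standard Riemannian metric of the unit sphere $\mathbb S^3\subset\mathbb R^4$. A closed RW spacetime is $\mathcal M(\mathfrak s)=\mathrm I_{\mathfrak s}\times\mathbb S^3$, with $\mathrm I_{\mathfrak s}\subset\mathbb R$ an open interval, $\mathfrak s$ a nonnegative scale function (smooth where positive), the (possibly degenerate) Lorentz metric $\ell_{\mathfrak s}=-dt^2+\mathfrak s^2(t)g$, a cosmological constant $\Lambda\in\mathbb R$ and perfect fluid stress-energy tensor $\mathrm T=\mathfrak m\,dt^2+\mathfrak p\,\mathfrak s^2g$, satisfying the Einstein equation, equivalent to $$\mathfrak m=\frac{3}{8\pi}\left(\frac{\dot{\mathfrak s}^2}{\mathfrak s^2}+\frac1{\mathfrak s^2}-\frac{\Lambda}{3}\right),\qquad \mathfrak p=-\frac1{4\pi\mathfrak s}\left(\ddot{\mathfrak s}+\frac1{2\mathfrak s}(\dot{\mathfrak s}^2+1)-\frac\Lambda2\mathfrak s\right)$$ (dot $=d/dt$; equations are understood where $\mathfrak s>0$). Part of the definition is that the energy density is nonnegative: $\mathfrak m$ takes values in $[0,+\infty)\cup\{+\infty\}$, while the pressure $\mathfrak p$ takes values in $\mathbb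 R\cup\{\pm\infty\}$. Conformal model. $\mathfrak s$ may vanish at some points, but the conformal time $\tau_{\mathfrak s}(t)=\int_{t_0}^t du/\mathfrak s(u)$ is assumed continuous and strictly increasing, with differentiable inverse on the open interval $\mathrm J_{\mathfrak s}=\tau_{\mathfrak s}(\mathrm I_{\mathfrak s})$. The conformal scale function is $\mathrm S=\mathfrak s\circ\tau_{\mathfrak s}^{-1}:\mathrm J_{\mathfrak s}\to\mathbb R$, a nonnegative differentiable function. Domains are maximal: $\mathrm J_{\mathfrak s}$ is the maximal domain of definition of $\mathrm S$ as a nonnegative differentiable function. The conformal model is $\widetilde{\mathcal M}=\mathrm J_{\mathfrak s}\times\mathbb S^3$ with the quadratic form $\mathrm S^2(-d\tau^2+g)$; it is cyclic if $\mathrm J_{\mathfrak s}=\mathbb R$ and $\mathrm S$ is periodic. The origin of $\tau$ is arbitrary, and the additive constant of integration in $\tau$ is normalized to zero (formulas are up to a translation of $\tau$). At poles of $\widehat\wp_\vartheta$ the conformal factor is read as $0$. The terms "totally umbilical" and "spacelike" for hypersurfaces on which the form vanishes refer to the background Lorentz metric $-d\tau^2+g$. Critical spacetimes. $\mathcal M(\mathfrak s)$ is $\mathfrak m$-critical if $\mathfrak s$ is a critical point of $\int_{[t_0,t_1]\times\mathbb S^3}\mathfrak m\,dV_{\ell_{\mathfrak s}}$ with respect to variations preserving the volume (keeping $\int_{t_0}^{t_1}\mathfrak s^3dt$ constant). It is assumed throughout that $\mathfrak s$ is nonconstant; criticality is then expressed by $\mathfrak s\left(\dot{\mathfrak s}^2+\frac{\mathfrak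 a}{3}\mathfrak s^2-1\right)=\mathcal H$ with constants $\mathfrak a,\mathcal H$ (the internal parameters), or in conformal time by $\mathrm S'^2+\frac{\mathfrak a}{3}\mathrm S^4-\mathrm S^2-\mathcal H\mathrm S=0$; it is also assumed that $\mathcal H\ne0$. Energy conditions (required at all points where $\mathfrak m,\mathfrak p$ are finite): weak: $-\mathfrak m\le\mathfrak p$; dominant: $-\mathfrak m\le\mathfrak p\le\mathfrak m$; strong: $-\mathfrak m/3\le\mathfrak p\le\mathfrak m$. Class I. Put $g_2=\frac1{12}$, $g_3=\frac1{48}(\mathfrak a\mathcal H^2-\frac29)$ and $\Delta=16(g_2^3-27g_3^2)=\frac1{48}\mathfrak a\mathcal H^2(4-9\mathfrak a\mathcal H^2)$. The spacetime is of Class I if $\Delta>0$. In that case the roots $e_1>e_2>e_3$ of $4x^3-g_2x-g_3$ are written $e_1=\frac1{4\sqrt3}\left(\frac1{\sqrt3}\cos\vartheta-\sin\vartheta\right)$, $e_2=\frac1{4\sqrt3}\left(\frac1{\sqrt3}\cos\vartheta+\sin\vartheta\right)$, $e_3=-(e_1+e_2)$ with $\vartheta\in(-\pi/3,0)$, the angular parameter; then $g_3=-\frac{\cos3\vartheta}{216}$ and $\mathfrak a=\frac2{9\mathcal H^2}(1-\cos3\vartheta)$. Let $\wp_\vartheta$ be the Weierstrass $\wp$-function with invariants $g_2=\frac1{12}$ and $g_3=-\frac{\cos3\vartheta}{216}$, let $\omega_\vartheta>0$ be its real primitive half-period, and put $\widehat\wp_\vartheta(\tau)=\wp_\vartheta(\tau)$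 for $\tau\in\mathbb R$. *)

theory Defs
  imports "HOL-Analysis.Analysis"
begin

section \<open>Smooth functions\<close>

primrec higher_differentiable_on ::
  "nat \<Rightarrow> ('a::real_normed_vector \<Rightarrow> 'b::real_normed_vector) \<Rightarrow> 'a set \<Rightarrow> bool" where
  "higher_differentiable_on 0 f U \<longleftrightarrow> continuous_on U f"
| "higher_differentiable_on (Suc n) f U \<longleftrightarrow>
     (\<forall>x\<in>U. f differentiable (at x)) \<and>
     (\<forall>v. higher_differentiable_on n (\<lambda>x. frechet_derivative f (at x) v) U)"

text \<open>Since differentiability is required at the points of \<open>U\<close> in the whole space, this is the usual
  notion of class \<open>C\<^sup>\<infinity>\<close> on the open sets \<open>U\<close> of a Euclidean space for which it is used.\<close>

definition smooth_on :: "('a::real_normed_vector \<Rightarrow> 'b::real_normed_vector) \<Rightarrow> 'a set \<Rightarrow> bool" where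
  "smooth_on f U \<longleftrightarrow> (\<forall>n. higher_differentiable_on n f U)"


section \<open>Closed RW spacetimes\<close>

text \<open>The two functions below have their intended meaning only at points where the scale function
  \<open>s\<close> is positive; where \<open>s\<close> vanishes both quantities are infinite. All conditions on them are
  accordingly imposed on the set \<open>{t \<in> I. 0 < s t}\<close>.\<close>

definition energy_density :: "real \<Rightarrow> (real \<Rightarrow> real) \<Rightarrow> real \<Rightarrow> real" where
  "energy_density \<Lambda> s t =
     3 / (8 * pi) * ((deriv s t)\<^sup>2 / (s t)\<^sup>2 + 1 / (s t)\<^sup>2 - \<Lambda> / 3)"

definition pressure :: "real \<Rightarrow> (real \<Rightarrow> real) \<Rightarrow> real \<Rightarrow> real" where
  "pressure \<Lambda> s t =
     - (1 / (4 * pi * s t)) *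
       (deriv (deriv s) t + 1 / (2 * s t) * ((deriv s t)\<^sup>2 + 1) - \<Lambda> / 2 * s t)"

text \<open>The base point \<open>b\<close> fixes the origin of conformal time.\<close>

definition conformal_time :: "(real \<Rightarrow> real) \<Rightarrow> real \<Rightarrow> real \<Rightarrow> real" where
  "conformal_time s b t = (LBINT u=b..t. 1 / s u)"

definition conformal_domain :: "real set \<Rightarrow> (real \<Rightarrow> real) \<Rightarrow> real \<Rightarrow> real set" where
  "conformal_domain I s b = conformal_time s b ` I"

definition inverse_conformal_time :: "real set \<Rightarrow> (real \<Rightarrow> real) \<Rightarrow> real \<Rightarrow> real \<Rightarrow> real" where
  "inverse_conformal_time I s b = the_inv_into I (conformal_time s b)"

definition conformal_scale :: "real set \<Rightarrow> (real \<Rightarrow> real) \<Rightarrow> real \<Rightarrow> real \<Rightarrow> real" where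
  "conformal_scale I s b \<tau> = s (inverse_conformal_time I s b \<tau>)"

text \<open>Because \<open>1 / 0 = 0\<close> in HOL, the convergence of the integral of \<open>1 / s\<close>, where \<open>1 / s\<close> is
  mathematically \<open>+\<infinity>\<close> at the zeros of \<open>s\<close>, is expressed by integrability together with the
  requirement that the zero set of \<open>s\<close> is a null set.\<close>

definition closed_RW_spacetime :: "real set \<Rightarrow> (real \<Rightarrow> real) \<Rightarrow> real \<Rightarrow> real \<Rightarrow> bool" where
  "closed_RW_spacetime I s b \<Lambda> \<longleftrightarrow>
     open I \<and> is_interval I \<and> b \<in> I \<and>
     (\<forall>t\<in>I. 0 \<le> s t) \<and>
     smooth_on s {t \<in> I. 0 < s t} \<and>
     {t \<in> I. s t = 0} \<in> null_sets lebesgue \<and>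
     (\<forall>t\<in>I. interval_lebesgue_integrable lborel (ereal b) (ereal t) (\<lambda>u. 1 / s u)) \<and>
     continuous_on I (conformal_time s b) \<and>
     strict_mono_on I (conformal_time s b) \<and>
     open (conformal_domain I s b) \<and> is_interval (conformal_domain I s b) \<and>
     (\<forall>\<tau>\<in>conformal_domain I s b.
        inverse_conformal_time I s b differentiable (at \<tau>) \<and>
        conformal_scale I s b differentiable (at \<tau>)) \<and>
     (\<forall>t\<in>I. 0 < s t \<longrightarrow> 0 \<le> energy_density \<Lambda> s t)"

definition weak_energy_condition :: "real set \<Rightarrow> (real \<Rightarrow> real) \<Rightarrow> real \<Rightarrow> bool" where
  "weak_energy_condition I s \<Lambda> \<longleftrightarrow>
     (\<forall>t\<in>I. 0 < s t \<longrightarrow> - energy_density \<Lambda> s t \<le> pressure \<Lambda> s t)"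

definition dominant_energy_condition :: "real set \<Rightarrow> (real \<Rightarrow> real) \<Rightarrow> real \<Rightarrow> bool" where
  "dominant_energy_condition I s \<Lambda> \<longleftrightarrow>
     (\<forall>t\<in>I. 0 < s t \<longrightarrow>
        - energy_density \<Lambda> s t \<le> pressure \<Lambda> s t \<and> pressure \<Lambda> s t \<le> energy_density \<Lambda> s t)"

definition strong_energy_condition :: "real set \<Rightarrow> (real \<Rightarrow> real) \<Rightarrow> real \<Rightarrow> bool" where
  "strong_energy_condition I s \<Lambda> \<longleftrightarrow>
     (\<forall>t\<in>I. 0 < s t \<longrightarrow>
        - energy_density \<Lambda> s t / 3 \<le> pressure \<Lambda> s t \<and> pressure \<Lambda> s t \<le> energy_density \<Lambda> s t)"


section \<open>Critical spacetimes\<close>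

text \<open>Integral of the energy density over \<open>[t0,t1] \<times> S\<^sup>3\<close>: the volume element is \<open>s\<^sup>3 dt\<close> times that of
  the unit sphere \<open>S\<^sup>3\<close>, whose volume is \<open>2 \<pi>\<^sup>2\<close>.\<close>

definition total_energy :: "real \<Rightarrow> real \<Rightarrow> real \<Rightarrow> (real \<Rightarrow> real) \<Rightarrow> real" where
  "total_energy \<Lambda> t0 t1 s =
     2 * pi\<^sup>2 * integral {t0..t1} (\<lambda>t. energy_density \<Lambda> s t * s t ^ 3)"

text \<open>Smooth one-parameter variations through positive functions, fixed near the ends of the interval.\<close>

definition volume_preserving_variation ::
  "(real \<Rightarrow> real) \<Rightarrow> real \<Rightarrow> real \<Rightarrow> (real \<Rightarrow> real \<Rightarrow> real) \<Rightarrow> bool" where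
  "volume_preserving_variation s t0 t1 V \<longleftrightarrow>
     (\<exists>\<delta>>0.
        smooth_on (\<lambda>(\<epsilon>, t). V \<epsilon> t) ({-\<delta><..<\<delta>} \<times> {t0<..<t1}) \<and>
        (\<forall>t\<in>{t0..t1}. V 0 t = s t) \<and>
        (\<exists>k0 k1. t0 < k0 \<and> k0 < k1 \<and> k1 < t1 \<and>
           (\<forall>\<epsilon>\<in>{-\<delta><..<\<delta>}. \<forall>t\<in>{t0..t1} - {k0..k1}. V \<epsilon> t = s t)) \<and>
        (\<forall>\<epsilon>\<in>{-\<delta><..<\<delta>}. \<forall>t\<in>{t0..t1}. 0 < V \<epsilon> t) \<and>
        (\<forall>\<epsilon>\<in>{-\<delta><..<\<delta>}.
           integral {t0..t1} (\<lambda>t. V \<epsilon> t ^ 3) = integral {t0..t1} (\<lambda>t. s t ^ 3)))"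

definition m_critical :: "real set \<Rightarrow> (real \<Rightarrow> real) \<Rightarrow> real \<Rightarrow> bool" where
  "m_critical I s \<Lambda> \<longleftrightarrow>
     (\<forall>t0 t1 V. t0 < t1 \<and> {t0..t1} \<subseteq> I \<and> (\<forall>t\<in>{t0..t1}. 0 < s t) \<and>
        volume_preserving_variation s t0 t1 V \<longrightarrow>
        ((\<lambda>\<epsilon>. total_energy \<Lambda> t0 t1 (V \<epsilon>)) has_real_derivative 0) (at 0))"

text \<open>First integral of the Euler-Lagrange equation, with \<open>a / 3\<close> a Lagrange multiplier; \<open>a\<close> and \<open>H\<close>
  are the same on all components of \<open>{t \<in> I. 0 < s t}\<close>.\<close>

definition internal_parameters :: "real set \<Rightarrow> (real \<Rightarrow> real) \<Rightarrow> real \<Rightarrow> real \<Rightarrow> bool" where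
  "internal_parameters I s a H \<longleftrightarrow>
     (\<forall>t\<in>I. 0 < s t \<longrightarrow> s t * ((deriv s t)\<^sup>2 + a / 3 * (s t)\<^sup>2 - 1) = H)"

text \<open>The equation of \<open>internal_parameters\<close> rewritten with \<open>S = s \<circ> \<tau>\<^sup>-\<^sup>1\<close> and \<open>dt = S d\<tau>\<close>; it also makes
  sense where \<open>S\<close> vanishes.\<close>

definition conformal_critical_on :: "real set \<Rightarrow> (real \<Rightarrow> real) \<Rightarrow> real \<Rightarrow> real \<Rightarrow> bool" where
  "conformal_critical_on J S a H \<longleftrightarrow>
     (\<forall>\<tau>\<in>J. (deriv S \<tau>)\<^sup>2 + a / 3 * S \<tau> ^ 4 - (S \<tau>)\<^sup>2 - H * S \<tau> = 0)"

text \<open>Maximality concerns the conformal scale function only: the sign of the energy density plays no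
  role in it.\<close>

definition maximal_conformal_domain :: "real set \<Rightarrow> (real \<Rightarrow> real) \<Rightarrow> real \<Rightarrow> real \<Rightarrow> bool" where
  "maximal_conformal_domain J S a H \<longleftrightarrow>
     (\<forall>J' S'. open J' \<and> is_interval J' \<and> J \<subseteq> J' \<and> (\<forall>\<tau>\<in>J. S' \<tau> = S \<tau>) \<and>
        (\<forall>\<tau>\<in>J'. 0 \<le> S' \<tau> \<and> S' differentiable (at \<tau>)) \<and> conformal_critical_on J' S' a H
        \<longrightarrow> J' = J)"

definition m_critical_closed_RW_spacetime ::
  "real set \<Rightarrow> (real \<Rightarrow> real) \<Rightarrow> real \<Rightarrow> real \<Rightarrow> real \<Rightarrow> real \<Rightarrow> bool" where
  "m_critical_closed_RW_spacetime I s b \<Lambda> a H \<longleftrightarrow>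
     closed_RW_spacetime I s b \<Lambda> \<and>
     \<not> s constant_on I \<and>
     m_critical I s \<Lambda> \<and>
     internal_parameters I s a H \<and> H \<noteq> 0 \<and>
     maximal_conformal_domain (conformal_domain I s b) (conformal_scale I s b) a H"


section \<open>Class I\<close>

definition class_g2 :: real where
  "class_g2 = 1 / 12"

definition class_g3 :: "real \<Rightarrow> real \<Rightarrow> real" where
  "class_g3 a H = 1 / 48 * (a * H\<^sup>2 - 2 / 9)"

definition class_discriminant :: "real \<Rightarrow> real \<Rightarrow> real" where
  "class_discriminant a H = 16 * (class_g2 ^ 3 - 27 * (class_g3 a H)\<^sup>2)"

definition class_I :: "real \<Rightarrow> real \<Rightarrow> bool" where
  "class_I a H \<longleftrightarrow> 0 < class_discriminant a H"

definition angular_parameter :: "real \<Rightarrow> real \<Rightarrow> real \<Rightarrow> bool" where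
  "angular_parameter a H \<theta> \<longleftrightarrow>
     \<theta> \<in> {- pi / 3<..<0} \<and>
     (let e1 = 1 / (4 * sqrt 3) * (1 / sqrt 3 * cos \<theta> - sin \<theta>);
          e2 = 1 / (4 * sqrt 3) * (1 / sqrt 3 * cos \<theta> + sin \<theta>);
          e3 = - (e1 + e2)
      in e1 > e2 \<and> e2 > e3 \<and>
         {x::real. 4 * x ^ 3 - class_g2 * x - class_g3 a H = 0} = {e1, e2, e3})"


section \<open>The Weierstrass elliptic function\<close>

definition is_complex_lattice :: "complex set \<Rightarrow> bool" where
  "is_complex_lattice L \<longleftrightarrow>
     (\<exists>w1 w2. w1 \<noteq> 0 \<and> Im (w2 / w1) \<noteq> 0 \<and>
        L = {of_int m * w1 + of_int n * w2 | m n. True})"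

definition lattice_g2 :: "complex set \<Rightarrow> complex" where
  "lattice_g2 L = 60 * (\<Sum>\<^sub>\<infinity>w\<in>L - {0}. 1 / w ^ 4)"

definition lattice_g3 :: "complex set \<Rightarrow> complex" where
  "lattice_g3 L = 140 * (\<Sum>\<^sub>\<infinity>w\<in>L - {0}. 1 / w ^ 6)"

text \<open>Defined for \<open>z \<notin> L\<close>; the values at lattice points carry no meaning.\<close>

definition lattice_wp :: "complex set \<Rightarrow> complex \<Rightarrow> complex" where
  "lattice_wp L z = 1 / z\<^sup>2 + (\<Sum>\<^sub>\<infinity>w\<in>L - {0}. 1 / (z - w)\<^sup>2 - 1 / w\<^sup>2)"

text \<open>If \<open>g2 ^ 3 \<noteq> 27 * g3\<^sup>2\<close>, there is exactly one lattice with invariants \<open>g2\<close> and \<open>g3\<close>.\<close>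

definition lattice_of_invariants :: "complex \<Rightarrow> complex \<Rightarrow> complex set" where
  "lattice_of_invariants g2 g3 =
     (THE L. is_complex_lattice L \<and> lattice_g2 L = g2 \<and> lattice_g3 L = g3)"

definition theta_lattice :: "real \<Rightarrow> complex set" where
  "theta_lattice \<theta> =
     lattice_of_invariants (complex_of_real (1 / 12)) (complex_of_real (- cos (3 * \<theta>) / 216))"

text \<open>Real invariants make the elliptic function real on the real axis.\<close>

definition theta_wp :: "real \<Rightarrow> real \<Rightarrow> real" where
  "theta_wp \<theta> \<tau> = Re (lattice_wp (theta_lattice \<theta>) (complex_of_real \<tau>))"

definition theta_half_period :: "real \<Rightarrow> real" where
  "theta_half_period \<theta> = Inf {w. 0 < w \<and> complex_of_real (2 * w) \<in> theta_lattice \<theta>}"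

text \<open>At the poles of \<open>theta_wp \<theta>\<close> the conformal factor is read as \<open>0\<close>.\<close>

definition theta_conformal_factor :: "real \<Rightarrow> real \<Rightarrow> real \<Rightarrow> real" where
  "theta_conformal_factor H \<theta> \<tau> =
     (if complex_of_real \<tau> \<in> theta_lattice \<theta> then 0
      else 9 * H\<^sup>2 / (12 * theta_wp \<theta> \<tau> - 1)\<^sup>2)"


section \<open>The conformal model\<close>

type_synonym event = "real \<times> (real ^ 4)"

definition conformal_model :: "real set \<Rightarrow> event set" where
  "conformal_model J = (J \<times> sphere 0 1)"

text \<open>The tangent space of \<open>J \<times> S\<^sup>3\<close> at \<open>(\<tau>, p)\<close>, as a subspace of the ambient space.\<close>

definition tangent_space :: "event \<Rightarrow> event set" where
  "tangent_space x = {X. snd X \<bullet> snd x = 0}"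

text \<open>The Lorentz metric \<open>- d\<tau>\<^sup>2 + g\<close>; it is the restriction of the flat metric of the ambient space.\<close>

definition background_metric :: "event \<Rightarrow> event \<Rightarrow> real" where
  "background_metric X Y = - (fst X * fst Y) + snd X \<bullet> snd Y"

definition conformal_form :: "(real \<Rightarrow> real) \<Rightarrow> event \<Rightarrow> event \<Rightarrow> event \<Rightarrow> real" where
  "conformal_form S x X Y = (S (fst x))\<^sup>2 * background_metric X Y"

definition cyclic_model :: "real set \<Rightarrow> (real \<Rightarrow> real) \<Rightarrow> bool" where
  "cyclic_model J S \<longleftrightarrow> J = UNIV \<and> (\<exists>P>0. \<forall>\<tau>. S (\<tau> + P) = S \<tau>)"

definition nondegenerate_on :: "event set \<Rightarrow> (event \<Rightarrow> event \<Rightarrow> real) \<Rightarrow> bool" where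
  "nondegenerate_on T B \<longleftrightarrow> (\<forall>X\<in>T. (\<forall>Y\<in>T. B X Y = 0) \<longrightarrow> X = 0)"

text \<open>Signature \<open>(-,+,+,+)\<close>: a negative vector whose orthogonal complement is positive definite.\<close>

definition lorentz_type_on :: "event set \<Rightarrow> (event \<Rightarrow> event \<Rightarrow> real) \<Rightarrow> bool" where
  "lorentz_type_on T B \<longleftrightarrow>
     (\<exists>U\<in>T. B U U < 0 \<and> (\<forall>X\<in>T. B U X = 0 \<and> X \<noteq> 0 \<longrightarrow> 0 < B X X))"


section \<open>Hypersurfaces of the conformal model\<close>

definition embedded_hypersurface :: "event set \<Rightarrow> event set \<Rightarrow> bool" where
  "embedded_hypersurface M \<Sigma> \<longleftrightarrow> \<Sigma> \<noteq> {} \<and> \<Sigma> \<subseteq> M \<and>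
     (\<forall>x\<in>\<Sigma>. \<exists>U (F :: event \<Rightarrow> real). open U \<and> x \<in> U \<and> smooth_on F U \<and>
        \<Sigma> \<inter> U = {y \<in> M \<inter> U. F y = 0} \<and>
        (\<forall>y\<in>\<Sigma> \<inter> U. \<exists>X\<in>tangent_space y. frechet_derivative F (at y) X \<noteq> 0))"

definition tangent_vectors :: "event set \<Rightarrow> event \<Rightarrow> event set" where
  "tangent_vectors \<Sigma> x =
     {X. \<exists>\<gamma>. \<gamma> 0 = x \<and> (\<forall>\<^sub>F r in at 0. \<gamma> r \<in> \<Sigma>) \<and> (\<gamma> has_vector_derivative X) (at (0::real))}"

definition spacelike_hypersurface :: "event set \<Rightarrow> event set \<Rightarrow> bool" where
  "spacelike_hypersurface M \<Sigma> \<longleftrightarrow> embedded_hypersurface M \<Sigma> \<and>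
     (\<forall>x\<in>\<Sigma>. \<forall>X\<in>tangent_vectors \<Sigma> x. X \<noteq> 0 \<longrightarrow> 0 < background_metric X X)"

text \<open>Projection of the ambient space onto the tangent space, orthogonal with respect to the ambient
  flat metric. By the Gauss formula, projecting the ambient derivative of a vector field gives the
  Levi-Civita connection of \<open>- d\<tau>\<^sup>2 + g\<close>.\<close>

definition tangent_projection :: "event \<Rightarrow> event \<Rightarrow> event" where
  "tangent_projection x X = (fst X, snd X - (snd X \<bullet> snd x) *\<^sub>R snd x)"

definition covariant_derivative :: "(event \<Rightarrow> event) \<Rightarrow> event \<Rightarrow> event \<Rightarrow> event" where
  "covariant_derivative N x X = tangent_projection x (frechet_derivative N (at x) X)"

text \<open>A spacelike hypersurface is totally umbilical if, for local unit normal fields \<open>N\<close>, the second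
  fundamental form is at each point a multiple of the first. The normal is timelike, hence
  \<open>background_metric (N y) (N y) = - 1\<close>.\<close>

definition totally_umbilical_spacelike_hypersurface :: "event set \<Rightarrow> event set \<Rightarrow> bool" where
  "totally_umbilical_spacelike_hypersurface M \<Sigma> \<longleftrightarrow> spacelike_hypersurface M \<Sigma> \<and>
     (\<forall>x\<in>\<Sigma>. \<exists>U N. open U \<and> x \<in> U \<and> smooth_on N U \<and>
        (\<forall>y\<in>\<Sigma> \<inter> U. N y \<in> tangent_space y \<and> background_metric (N y) (N y) = - 1 \<and>
           (\<forall>X\<in>tangent_vectors \<Sigma> y. background_metric (N y) X = 0) \<and>
           (\<exists>k. \<forall>X\<in>tangent_vectors \<Sigma> y. \<forall>Y\<in>tangent_vectors \<Sigma> y.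
              - background_metric (covariant_derivative N y X) Y = k * background_metric X Y)))"


section \<open>The bounds for the cosmological constant\<close>

definition f1_hat :: "real \<Rightarrow> real \<Rightarrow> real" where
  "f1_hat \<theta> H = 1 / (3 * H\<^sup>2) * (1 - cos \<theta> + sqrt 3 * sin \<theta>)\<^sup>2"

definition f2_hat :: "real \<Rightarrow> real \<Rightarrow> real" where
  "f2_hat \<theta> H = 2 / (9 * H\<^sup>2) * (sin (\<theta> / 2))\<^sup>2 *
     (7 + cos \<theta> - 2 * cos (2 * \<theta>) + 5 * sqrt 3 * sin \<theta>)"

definition f3_hat :: "real \<Rightarrow> real \<Rightarrow> real" where
  "f3_hat \<theta> H = 1 / (6 * H\<^sup>2) *
     (1 - 2 * cos \<theta> - cos (2 * \<theta>) + 2 * cos (3 * \<theta>)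
      + 2 * sqrt 3 * sin \<theta> - sqrt 3 * sin (2 * \<theta>))"

end

theory Submission
  imports Defs "HOL-Complex_Analysis.Complex_Analysis"
begin

text \<open>
  In conformal time the critical equation reads \<open>S'\<^sup>2 = P S\<close> with \<open>P y = H y + y\<^sup>2 - a y\<^sup>4 / 3\<close>, and the
  substitution \<open>S = 3 H / (12 \<wp> - 1)\<close> turns it into Weierstrass' equation. The first order equation
  alone does not determine \<open>S\<close>, which could rest at \<open>0\<close> or at the maximal value \<open>M\<close>. Rest at \<open>M\<close> is
  excluded by smoothness of \<open>s\<close> where it is positive, rest at \<open>0\<close> by the zero set of \<open>s\<close> being null.
  Hence \<open>S'' = P' S / 2\<close> everywhere, uniqueness for this equation identifies \<open>S\<close> with a translate of the
  global periodic solution, and maximality gives \<open>J = UNIV\<close>. Density and pressure are polynomials in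
  \<open>1 / s\<close> and \<open>s\<close> takes the value \<open>M\<close>, so each energy condition reduces to an inequality at \<open>s = M\<close>.

  A lattice is determined by its invariants because the difference \<open>f\<close> of two Weierstrass functions with
  the same invariants is holomorphic at \<open>0\<close> and satisfies \<open>f'' = 6 f (\<wp>\<^sub>1 + \<wp>\<^sub>2)\<close>. Comparing coefficients
  of \<open>z\<^sup>n\<close> forces them to vanish successively unless \<open>n (n - 1) = 12\<close>, and the coefficient of \<open>z\<^sup>4\<close>
  is fixed by \<open>g\<^sub>3\<close>. Existence for real invariants of positive discriminant follows by scaling and the
  intermediate value theorem from the rectangular lattices with periods \<open>1\<close> and \<open>\<i> t\<close>: the discriminant degenerates as \<open>t \<rightarrow> \<infinity>\<close>, and \<open>t \<mapsto> 1 / t\<close> changes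
  the sign of \<open>g\<^sub>3\<close>.
\<close>

section \<open>Complex lattices\<close>

text \<open>\<open>theta_lattice\<close> is a definite description, so \<open>theta_wp\<close> says
  nothing until a lattice with invariants 1/12 and - cos (3 \<theta>) / 216 is known to exist and to
  be unique; hence the theory of elliptic functions built from lattice sums. The intermediate value
  argument only sees the ratio of \<open>g3\<close> to the 3/2-power of the modulus of
  \<open>g2\<close>; that \<open>g2\<close> is nonnegative and that the invariants do not vanish
  together need arguments of their own. That the discriminant vanishes in the limit is an identity
  between zeta values, obtained from the Riccati equation of the cotangent.

  One number governs all constants: x = 12 e1 - 1 = cos \<theta> - sqrt 3 sin \<theta> - 1 > 0. It
  satisfies 9 a H^2 = x^3 + 3 x^2, it is the least value of 12 wp - 1 on the real axis, and M = 3 H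
  / x. In terms of x the bounds are x^2 / (3 H^2), x^2 (2 - x) / (18 H^2) and - x^2 (2 + x) / (6
  H^2), the values at s = M of the expressions that bound \<Lambda>.\<close>

lemma summable_on_one_plus_abs_int_powr:
  fixes p :: real
  assumes "p > 1"
  shows "(\<lambda>m::int. (1 + \<bar>of_int m\<bar>) powr - p) summable_on UNIV"
proof -
  have "summable (\<lambda>n. real n powr - p)"
    using assms by (simp add: summable_real_powr_iff)
  then have "summable (\<lambda>n. real (Suc n) powr - p)"
    by (subst summable_Suc_iff)
  then have "summable (\<lambda>n. norm ((1 + real n) powr - p))"
    by (simp add: add.commute)
  then have nat: "(\<lambda>n. (1 + real n) powr - p) summable_on UNIV"
    by (rule norm_summable_imp_summable_on)
  have "(\<lambda>m::int. (1 + \<bar>of_int m\<bar>) powr - p) summable_on range int"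
    by (subst summable_on_reindex) (use nat in \<open>auto simp: o_def inj_on_def\<close>)
  moreover have "(\<lambda>m::int. (1 + \<bar>of_int m\<bar>) powr - p) summable_on range (\<lambda>n. - int n)"
    by (subst summable_on_reindex) (use nat in \<open>auto simp: o_def inj_on_def\<close>)
  ultimately have "(\<lambda>m::int. (1 + \<bar>of_int m\<bar>) powr - p)
      summable_on range int \<union> range (\<lambda>n. - int n)"
    by (rule summable_on_union)
  moreover have "range int \<union> range (\<lambda>n. - int n) = UNIV"
    by (auto simp: image_iff) (metis int_cases2)
  ultimately show ?thesis by simp
qed

lemma int_pair_abs_ge_1:
  fixes m n :: int
  assumes "(m, n) \<noteq> (0, 0)"
  shows "\<bar>of_int m\<bar> + \<bar>of_int n\<bar> \<ge> (1 :: real)"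
proof -
  have "\<bar>m\<bar> + \<bar>n\<bar> \<ge> 1" using assms by auto
  then show ?thesis by linarith
qed

text \<open>With s = |m| + |n| >= 1 both 1 + |m| and 1 + |n| are at most 2 s. The exponent 3
  therefore splits as 3/2 + 3/2, and the double sum is dominated by a product of two convergent
  one-variable series.\<close>

lemma summable_on_int_pairs:
  "(\<lambda>(m::int, n::int). 1 / (\<bar>of_int m\<bar> + \<bar>of_int n\<bar> :: real) ^ 3) summable_on UNIV - {(0, 0)}"
proof -
  let ?f = "\<lambda>m::int. (1 + \<bar>of_int m\<bar> :: real) powr - (3/2)"
  have f: "?f summable_on UNIV"
    by (rule summable_on_one_plus_abs_int_powr) simp
  have "(\<lambda>x. norm (case x of (m, n) \<Rightarrow> ?f m * ?f n)) summable_on UNIV \<times> UNIV"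
    using summable_on_cmult_left[OF f] summable_on_cmult_right[OF f]
    by (subst Infinite_Sum.abs_summable_on_Sigma_iff)
      (auto simp: infsum_cmult_right' abs_mult split_def)
  then have "(\<lambda>x. norm (case x of (m, n) \<Rightarrow> ?f m * ?f n)) summable_on UNIV - {(0, 0)}"
    by (rule summable_on_subset_banach) auto
  then have "(\<lambda>x. 8 * norm (case x of (m, n) \<Rightarrow> ?f m * ?f n)) summable_on UNIV - {(0, 0)}"
    by (rule summable_on_cmult_right)
  then show ?thesis
  proof (rule summable_on_comparison_test)
    fix x :: "int \<times> int" assume x: "x \<in> UNIV - {(0, 0)}"
    obtain m n where mn: "x = (m, n)" by force
    let ?s = "\<bar>of_int m\<bar> + \<bar>of_int n\<bar> :: real"
    have s: "?s \<ge> 1" using x mn by (intro int_pair_abs_ge_1) simp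
    have "(1 + \<bar>of_int m\<bar>) powr (3/2) * (1 + \<bar>of_int n\<bar>) powr (3/2)
        \<le> (2 * ?s) powr (3/2) * (2 * ?s) powr (3/2)"
      using s by (intro mult_mono powr_mono2) auto
    also have "\<dots> = (2 * ?s) powr 3"
      by (simp flip: powr_add)
    also have "\<dots> = (2 * ?s) ^ 3"
      using s powr_realpow[of "2 * ?s" 3] by simp
    also have "\<dots> = 8 * ?s ^ 3" unfolding power_mult_distrib by simp
    finally have *: "(1 + \<bar>of_int m\<bar>) powr (3/2) * (1 + \<bar>of_int n\<bar>) powr (3/2) \<le> 8 * ?s ^ 3" .
    have "1 / ?s ^ 3 = 8 / (8 * ?s ^ 3)" by simp
    also have "\<dots> \<le> 8 / ((1 + \<bar>of_int m\<bar>) powr (3/2) * (1 + \<bar>of_int n\<bar>) powr (3/2))"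
      using * s by (intro divide_left_mono) (auto intro!: mult_pos_pos)
    also have "\<dots> = 8 * norm (?f m * ?f n)"
      by (simp add: powr_minus abs_mult divide_simps)
    finally show "(case x of (m, n) \<Rightarrow> 1 / (\<bar>of_int m\<bar> + \<bar>of_int n\<bar> :: real) ^ 3)
        \<le> 8 * norm (case x of (m, n) \<Rightarrow> ?f m * ?f n)"
      by (simp add: mn)
  qed (auto split: prod.splits)
qed

text \<open>After division by \<open>w1\<close> the imaginary part of m + n r controls n, and the
  triangle inequality then controls m. This comparison carries summability, injectivity of the
  parametrization and local finiteness over from integer pairs to the lattice.\<close>

lemma lattice_norm_lower_bound:
  assumes "w1 \<noteq> 0" and "Im (w2 / w1) \<noteq> 0"
  obtains c where "c > 0"
    and "\<And>m n :: real. c * (\<bar>m\<bar> + \<bar>n\<bar>) \<le> cmod (of_real m * w1 + of_real n * w2)"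
proof -
  define r where "r = w2 / w1"
  define K where "K = 1 + (1 + cmod r) / \<bar>Im r\<bar>"
  have Im: "\<bar>Im r\<bar> > 0" using assms by (simp add: r_def)
  have K: "K > 0" unfolding K_def using Im by (simp add: add_pos_nonneg)
  have "\<bar>m\<bar> + \<bar>n\<bar> \<le> K * cmod (of_real m + of_real n * r)" for m n :: real
  proof -
    let ?z = "of_real m + of_real n * r"
    have "\<bar>n\<bar> * \<bar>Im r\<bar> \<le> cmod ?z"
      using abs_Im_le_cmod[of ?z] by (simp add: abs_mult)
    then have n: "\<bar>n\<bar> \<le> cmod ?z / \<bar>Im r\<bar>"
      using Im by (simp add: pos_le_divide_eq)
    have "of_real m = ?z - of_real n * r" by simp
    then have "cmod (of_real m) \<le> cmod ?z + cmod (of_real n * r)"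
      by (metis norm_triangle_ineq4)
    then have "\<bar>m\<bar> \<le> cmod ?z + \<bar>n\<bar> * cmod r" by (simp add: norm_mult)
    then have "\<bar>m\<bar> + \<bar>n\<bar> \<le> cmod ?z + \<bar>n\<bar> * (1 + cmod r)" by (simp add: algebra_simps)
    also have "\<dots> \<le> cmod ?z + cmod ?z / \<bar>Im r\<bar> * (1 + cmod r)"
      using n by (intro add_left_mono mult_right_mono) auto
    also have "\<dots> = K * cmod ?z" by (simp add: K_def algebra_simps)
    finally show ?thesis .
  qed
  then have "cmod w1 / K * (\<bar>m\<bar> + \<bar>n\<bar>) \<le> cmod w1 * cmod (of_real m + of_real n * r)" for m n :: real
    using K mult_left_mono[of "\<bar>m\<bar> + \<bar>n\<bar>" "K * cmod (of_real m + of_real n * r)" "cmod w1"]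
    by (simp add: divide_simps) (simp add: algebra_simps)
  moreover have "cmod w1 * cmod (of_real m + of_real n * r)
      = cmod (of_real m * w1 + of_real n * w2)" for m n :: real
  proof -
    have "w1 * (of_real m + of_real n * r) = of_real m * w1 + of_real n * w2"
      using assms(1) by (simp add: r_def field_simps)
    then show ?thesis by (metis norm_mult)
  qed
  ultimately show ?thesis
    using that[of "cmod w1 / K"] assms(1) K by simp
qed

lemma lattice_parametrization:
  assumes "w1 \<noteq> 0" and "Im (w2 / w1) \<noteq> 0"
  shows "bij_betw (\<lambda>(m, n). of_int m * w1 + of_int n * w2) (UNIV - {(0, 0)})
    ({of_int m * w1 + of_int n * w2 | m n. True} - {0})"
proof -
  obtain c where c: "c > 0"
    "\<And>m n :: real. c * (\<bar>m\<bar> + \<bar>n\<bar>) \<le> cmod (of_real m * w1 + of_real n * w2)"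
    using lattice_norm_lower_bound[OF assms] by blast
  have zero: "m = 0 \<and> n = 0" if "of_int m * w1 + of_int n * w2 = 0" for m n :: int
  proof -
    have "c * (\<bar>of_int m\<bar> + \<bar>of_int n\<bar>) \<le> 0"
      using c(2)[of "of_int m" "of_int n"] that by simp
    then have "\<bar>of_int m\<bar> + \<bar>of_int n\<bar> \<le> (0::real)"
      using c(1) by (simp add: mult_le_0_iff)
    then show ?thesis by linarith
  qed
  have inj: "inj (\<lambda>(m::int, n::int). of_int m * w1 + of_int n * w2)"
  proof (rule injI, clarify)
    fix m n m' n' :: int
    assume "of_int m * w1 + of_int n * w2 = of_int m' * w1 + of_int n' * w2"
    then have "of_int (m - m') * w1 + of_int (n - n') * w2 = 0" by (simp add: algebra_simps)
    from zero[OF this] show "m = m' \<and> n = n'" by simp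
  qed
  show ?thesis
    unfolding bij_betw_def
  proof
    show "inj_on (\<lambda>(m, n). of_int m * w1 + of_int n * w2) (UNIV - {(0, 0)})"
      using inj by (rule inj_on_subset) auto
    show "(\<lambda>(m, n). of_int m * w1 + of_int n * w2) ` (UNIV - {(0, 0)})
        = {of_int m * w1 + of_int n * w2 | m n. True} - {0}"
      using zero by (auto simp: image_iff)
  qed
qed

section \<open>Group structure, discreteness and cocompactness of a lattice\<close>

locale complex_lattice =
  fixes L :: "complex set"
  assumes lattice: "is_complex_lattice L"
begin

lemma basis:
  obtains w1 w2 where "w1 \<noteq> 0" "Im (w2 / w1) \<noteq> 0"
    "L = {of_int m * w1 + of_int n * w2 | m n. True}"
  using lattice unfolding is_complex_lattice_def by blast

lemma zero_mem: "0 \<in> L"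
  using lattice unfolding is_complex_lattice_def
  by (force intro: exI[of _ "0::int"])

lemma add_mem: "v \<in> L \<Longrightarrow> w \<in> L \<Longrightarrow> v + w \<in> L"
proof -
  assume vw: "v \<in> L" "w \<in> L"
  obtain w1 w2 where L: "L = {of_int m * w1 + of_int n * w2 | m n. True}" by (rule basis)
  obtain m n m' n' :: int where "v = of_int m * w1 + of_int n * w2" "w = of_int m' * w1 + of_int n' * w2"
    using vw unfolding L by blast
  then have "v + w = of_int (m + m') * w1 + of_int (n + n') * w2" by (simp add: algebra_simps)
  then show ?thesis unfolding L by blast
qed

lemma uminus_mem: "v \<in> L \<Longrightarrow> - v \<in> L"
proof -
  assume v: "v \<in> L"
  obtain w1 w2 where L: "L = {of_int m * w1 + of_int n * w2 | m n. True}" by (rule basis)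
  obtain m n :: int where "v = of_int m * w1 + of_int n * w2"
    using v unfolding L by blast
  then have "- v = of_int (- m) * w1 + of_int (- n) * w2" by (simp add: algebra_simps)
  then show ?thesis unfolding L by blast
qed

lemma uminus_mem_iff: "- v \<in> L \<longleftrightarrow> v \<in> L"
  using uminus_mem[of v] uminus_mem[of "- v"] by auto

lemma diff_mem: "v \<in> L \<Longrightarrow> w \<in> L \<Longrightarrow> v - w \<in> L"
  using add_mem[of v "- w"] uminus_mem by simp

lemma add_mem_iff: "v \<in> L \<Longrightarrow> z + v \<in> L \<longleftrightarrow> z \<in> L"
  using add_mem[of z v] diff_mem[of "z + v" v] by auto

lemma bij_betw_uminus: "bij_betw uminus (L - {0}) (L - {0})"
  by (rule bij_betwI[of _ _ _ uminus]) (auto simp: uminus_mem)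

lemma summable_inverse_cube: "(\<lambda>w. 1 / cmod w ^ 3) summable_on L - {0}"
proof -
  obtain w1 w2 where w: "w1 \<noteq> 0" "Im (w2 / w1) \<noteq> 0"
    and L: "L = {of_int m * w1 + of_int n * w2 | m n. True}"
    by (rule basis)
  obtain c where c: "c > 0"
    "\<And>m n :: real. c * (\<bar>m\<bar> + \<bar>n\<bar>) \<le> cmod (of_real m * w1 + of_real n * w2)"
    using lattice_norm_lower_bound[OF w] by blast
  have "(\<lambda>x. (1 / c ^ 3) * (case x of (m::int, n::int) \<Rightarrow> 1 / (\<bar>of_int m\<bar> + \<bar>of_int n\<bar>) ^ 3))
      summable_on UNIV - {(0, 0)}"
    by (rule summable_on_cmult_right[OF summable_on_int_pairs])
  then have "(\<lambda>x. 1 / cmod (case x of (m::int, n::int) \<Rightarrow> of_int m * w1 + of_int n * w2) ^ 3)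
      summable_on UNIV - {(0, 0)}"
  proof (rule summable_on_comparison_test)
    fix x :: "int \<times> int" assume x: "x \<in> UNIV - {(0, 0)}"
    obtain m n where mn: "x = (m, n)" by force
    let ?s = "\<bar>of_int m\<bar> + \<bar>of_int n\<bar> :: real"
    have "?s > 0" using x mn by auto
    then have cs: "c * ?s > 0" using c(1) by simp
    have "c * ?s \<le> cmod (of_int m * w1 + of_int n * w2)"
      using c(2)[of "of_int m" "of_int n"] by simp
    then have "(c * ?s) ^ 3 \<le> cmod (of_int m * w1 + of_int n * w2) ^ 3"
      using cs by (intro power_mono) auto
    then have "1 / cmod (of_int m * w1 + of_int n * w2) ^ 3 \<le> 1 / (c * ?s) ^ 3"
      using cs by (intro frac_le) auto
    then show "1 / cmod (case x of (m, n) \<Rightarrow> of_int m * w1 + of_int n * w2) ^ 3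
        \<le> (1 / c ^ 3) * (case x of (m, n) \<Rightarrow> 1 / (\<bar>of_int m\<bar> + \<bar>of_int n\<bar>) ^ 3)"
      by (simp add: mn power_mult_distrib)
  qed auto
  then show ?thesis
    unfolding L
    by (subst summable_on_reindex_bij_betw[OF lattice_parametrization[OF w], symmetric])
qed

lemma finite_Int_cball: "finite (L \<inter> cball 0 R)"
proof -
  obtain w1 w2 where w: "w1 \<noteq> 0" "Im (w2 / w1) \<noteq> 0"
    and L: "L = {of_int m * w1 + of_int n * w2 | m n. True}"
    by (rule basis)
  obtain c where c: "c > 0"
    "\<And>m n :: real. c * (\<bar>m\<bar> + \<bar>n\<bar>) \<le> cmod (of_real m * w1 + of_real n * w2)"
    using lattice_norm_lower_bound[OF w] by blast
  define k where "k = \<lceil>R / c\<rceil>"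
  have "L \<inter> cball 0 R \<subseteq> (\<lambda>(m, n). of_int m * w1 + of_int n * w2) ` ({-k..k} \<times> {-k..k})"
  proof
    fix z assume z: "z \<in> L \<inter> cball 0 R"
    then obtain m n :: int where mn: "z = of_int m * w1 + of_int n * w2" unfolding L by blast
    have "c * (\<bar>of_int m\<bar> + \<bar>of_int n\<bar>) \<le> R"
      using c(2)[of "of_int m" "of_int n"] z by (simp add: mn)
    then have "\<bar>of_int m\<bar> + \<bar>of_int n\<bar> \<le> R / c"
      using c(1) by (simp add: pos_le_divide_eq mult.commute)
    then have "real_of_int \<bar>m\<bar> \<le> of_int k" "real_of_int \<bar>n\<bar> \<le> of_int k"
      unfolding k_def using le_of_int_ceiling[of "R / c"] by linarith+
    then have "m \<in> {-k..k}" "n \<in> {-k..k}" by auto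
    then show "z \<in> (\<lambda>(m, n). of_int m * w1 + of_int n * w2) ` ({-k..k} \<times> {-k..k})"
      using mn by force
  qed
  then show ?thesis by (rule finite_subset) auto
qed

text \<open>An accumulation point would already be one of a bounded, hence finite, piece of
  \<open>L\<close>. Arbitrary subsets are allowed because the complements of \<open>L - {0}\<close>
  and \<open>L - {v}\<close> serve as neighbourhoods isolating a single pole.\<close>

lemma closed_subset: "A \<subseteq> L \<Longrightarrow> closed A"
proof -
  assume A: "A \<subseteq> L"
  have "\<not> z islimpt A" for z
  proof
    assume "z islimpt A"
    then have "z islimpt (A \<inter> ball z 1)"
      by (intro islimpt_Int_eventually) (auto simp: eventually_at dist_commute intro: exI[of _ 1])
    moreover have "A \<inter> ball z 1 \<subseteq> L \<inter> cball 0 (cmod z + 1)"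
      using A by (auto simp: dist_norm) (smt (verit) norm_triangle_sub norm_minus_commute)
    ultimately show False
      using finite_Int_cball finite_subset islimpt_finite by blast
  qed
  then show ?thesis by (auto simp: closed_limpt)
qed

lemma closed: "closed L"
  by (rule closed_subset) simp

lemma open_Compl: "open (- L)"
  using closed by (simp add: open_Compl)

lemma open_Compl_nonzero: "open (- (L - {0}))"
  by (metis Diff_subset closed_subset open_closed double_compl)

lemma countable: "countable L"
proof -
  have "L = (\<Union>n::nat. L \<inter> cball 0 (real n))"
    using real_arch_simple by auto
  moreover have "countable \<dots>"
    using finite_Int_cball by (intro countable_UN) (auto intro: countable_finite)
  ultimately show ?thesis by metis
qed

lemma connected_Compl: "connected (- L)"
  by (intro path_connected_imp_connected path_connected_complement_countable countable) auto

text \<open>Subtracting the integer parts of the two real coordinates leaves a point of a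
  fundamental parallelogram. In the Liouville argument this makes the range of a periodic function
  the image of a compact ball.\<close>

lemma bounded_representative:
  obtains B where "\<And>z. \<exists>w\<in>L. cmod (z - w) \<le> B"
proof -
  obtain w1 w2 where w: "w1 \<noteq> 0" "Im (w2 / w1) \<noteq> 0"
    and L: "L = {of_int m * w1 + of_int n * w2 | m n. True}"
    by (rule basis)
  have "\<exists>v\<in>L. cmod (z - v) \<le> cmod w1 + cmod w2" for z
  proof -
    define u r where "u = z / w1" and "r = w2 / w1"
    define y where "y = Im u / Im r"
    define x where "x = Re u - y * Re r"
    have "Im r \<noteq> 0" using w(2) by (simp add: r_def)
    then have u: "u = of_real x + of_real y * r"
      by (simp add: x_def y_def complex_eq_iff)
    have "z = u * w1" "w2 = r * w1"
      using w(1) by (simp_all add: u_def r_def)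
    then have z: "z = of_real x * w1 + of_real y * w2"
      by (simp only: u distrib_right mult.assoc)
    let ?v = "of_int \<lfloor>x\<rfloor> * w1 + of_int \<lfloor>y\<rfloor> * w2"
    have "z - ?v = of_real (frac x) * w1 + of_real (frac y) * w2"
      by (simp add: z frac_def algebra_simps)
    also have "cmod \<dots> \<le> \<bar>frac x\<bar> * cmod w1 + \<bar>frac y\<bar> * cmod w2"
      by (rule order.trans[OF norm_triangle_ineq]) (simp add: norm_mult)
    also have "\<dots> \<le> 1 * cmod w1 + 1 * cmod w2"
      by (intro add_mono mult_right_mono) (auto simp: abs_le_iff less_imp_le[OF frac_lt_1])
    finally have "cmod (z - ?v) \<le> cmod w1 + cmod w2" by simp
    moreover have "?v \<in> L" unfolding L by blast
    ultimately show ?thesis by blast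
  qed
  then show ?thesis using that by blast
qed

end

section \<open>The Weierstrass function of a lattice\<close>

text \<open>Writing the remainder as z^n times a holomorphic function turns the Laurent computations
  at the pole into polynomial algebra, with no estimates.\<close>

lemma holomorphic_taylor_remainder:
  fixes f :: "complex \<Rightarrow> complex"
  assumes "f holomorphic_on ball 0 r"
  obtains g where "g holomorphic_on ball 0 r"
    and "\<And>z. z \<in> ball 0 r \<Longrightarrow> f z = (\<Sum>i<n. (deriv ^^ i) f 0 / fact i * z ^ i) + z ^ n * g z"
proof -
  define a where "a i = (deriv ^^ i) f 0 / fact i" for i
  define g where "g z = (\<Sum>i. a (i + n) * z ^ i)" for z
  have f: "(\<lambda>i. a i * z ^ i) sums f z" if "z \<in> ball 0 r" for z
    using holomorphic_power_series[OF assms that] by (simp add: a_def)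
  have tail: "(\<lambda>i. a (i + n) * z ^ (i + n)) sums (f z - (\<Sum>i<n. a i * z ^ i))" if "z \<in> ball 0 r" for z
    using sums_split_initial_segment[OF f[OF that]] .
  have g: "(\<lambda>i. a (i + n) * z ^ i) sums g z" if "z \<in> ball 0 r" for z
  proof (cases "z = 0")
    case True
    then show ?thesis using sums_mult[OF powser_sums_zero[of "\<lambda>i. a (i + n)"], of 1]
      by (simp add: g_def powser_sums_zero_iff sums_unique[symmetric])
  next
    case False
    have "(\<lambda>i. a (i + n) * z ^ (i + n) / z ^ n) sums ((f z - (\<Sum>i<n. a i * z ^ i)) / z ^ n)"
      by (rule sums_divide[OF tail[OF that]])
    then have "summable (\<lambda>i. a (i + n) * z ^ i)"
      using False by (simp add: power_add summable_def) blast
    then show ?thesis unfolding g_def by (rule summable_sums)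
  qed
  have "g holomorphic_on ball 0 r"
    by (rule power_series_holomorphic[where a = "\<lambda>i. a (i + n)"]) (use g in simp)
  moreover have "f z = (\<Sum>i<n. a i * z ^ i) + z ^ n * g z" if "z \<in> ball 0 r" for z
  proof -
    have "(\<lambda>i. z ^ n * (a (i + n) * z ^ i)) sums (z ^ n * g z)"
      by (rule sums_mult[OF g[OF that]])
    then have "(\<lambda>i. a (i + n) * z ^ (i + n)) sums (z ^ n * g z)"
      by (simp add: power_add mult_ac)
    from sums_unique2[OF this tail[OF that]] show ?thesis by simp
  qed
  ultimately show ?thesis using that unfolding a_def by blast
qed

lemma higher_deriv_inverse_square:
  fixes w z c :: complex
  assumes "z \<noteq> w"
  shows "(deriv ^^ m) (\<lambda>z. 1 / (z - w)\<^sup>2 - c) z =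
    (- 1) ^ m * fact (Suc m) / (z - w) ^ (m + 2) - (if m = 0 then c else 0)"
  using assms
proof (induction m arbitrary: z)
  case 0
  then show ?case by (simp add: power2_eq_square)
next
  case (Suc m)
  let ?g = "\<lambda>z. (- 1) ^ m * fact (Suc m) / (z - w) ^ (m + 2) - (if m = 0 then c else 0)"
  have "\<forall>\<^sub>F x in nhds z. x \<in> - {w}"
    using Suc.prems by (intro eventually_nhds_in_open) auto
  then have "\<forall>\<^sub>F x in nhds z. (deriv ^^ m) (\<lambda>z. 1 / (z - w)\<^sup>2 - c) x = ?g x"
    by eventually_elim (use Suc.IH in auto)
  then have "(deriv ^^ Suc m) (\<lambda>z. 1 / (z - w)\<^sup>2 - c) z = deriv ?g z"
    by (simp add: deriv_cong_ev)
  also have "((\<lambda>z. c / (z - w) ^ Suc n - d) has_field_derivative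
      - (c * of_nat (Suc n)) / (z - w) ^ Suc (Suc n)) (at z)" for c d n
  proof -
    define u where "u = z - w"
    have "u \<noteq> 0" using Suc.prems by (simp add: u_def)
    then show ?thesis
      by (auto intro!: derivative_eq_intros simp flip: u_def) (cases n; simp add: field_simps)
  qed
  from this[of "(- 1) ^ m * fact (Suc m)" "Suc m" "if m = 0 then c else 0"]
  have "(?g has_field_derivative (- 1) ^ Suc m * fact (Suc (Suc m)) / (z - w) ^ (Suc m + 2)) (at z)"
    by (simp add: algebra_simps)
  then have "deriv ?g z = (- 1) ^ Suc m * fact (Suc (Suc m)) / (z - w) ^ (Suc m + 2)"
    by (rule DERIV_imp_deriv)
  finally show ?case by simp
qed

lemma higher_deriv_sum:
  assumes "finite X" and "\<And>w. w \<in> X \<Longrightarrow> f w analytic_on {z}"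
  shows "(deriv ^^ m) (\<lambda>z. \<Sum>w\<in>X. f w z) z = (\<Sum>w\<in>X. (deriv ^^ m) (f w) z)"
  using assms
proof (induction X rule: finite_induct)
  case (insert x X)
  have "(deriv ^^ m) (\<lambda>z. f x z + (\<Sum>w\<in>X. f w z)) z
      = (deriv ^^ m) (f x) z + (deriv ^^ m) (\<lambda>z. \<Sum>w\<in>X. f w z) z"
    using insert by (intro higher_deriv_add_at analytic_intros) auto
  then show ?case using insert by simp
qed simp

lemma infsum_odd_eq_0:
  fixes f :: "complex \<Rightarrow> complex"
  assumes "bij_betw uminus A A" and "\<And>w. f (- w) = - f w"
  shows "(\<Sum>\<^sub>\<infinity>w\<in>A. f w) = 0"
proof -
  have "(\<Sum>\<^sub>\<infinity>w\<in>A. f w) = (\<Sum>\<^sub>\<infinity>w\<in>A. f (- w))"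
    by (rule infsum_reindex_bij_betw[OF assms(1), symmetric])
  also have "\<dots> = - (\<Sum>\<^sub>\<infinity>w\<in>A. f w)"
    by (simp add: assms(2) infsum_uminus)
  finally show ?thesis by simp
qed

section \<open>Convergence, Taylor coefficients and periods of the Weierstrass function\<close>

context complex_lattice
begin

abbreviation wp :: "complex \<Rightarrow> complex" where
  "wp \<equiv> lattice_wp L"

text \<open>The Weierstrass function without its pole at 0. It is holomorphic near 0, so all
  expansions at the origin are made with it.\<close>

definition wp_regular :: "complex \<Rightarrow> complex" where
  "wp_regular z = (\<Sum>\<^sub>\<infinity>w\<in>L - {0}. 1 / (z - w)\<^sup>2 - 1 / w\<^sup>2)"

abbreviation wp_sum :: "complex set \<Rightarrow> complex \<Rightarrow> complex" where
  "wp_sum \<equiv> \<lambda>X z. \<Sum>w\<in>X. 1 / (z - w)\<^sup>2 - 1 / w\<^sup>2"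

abbreviation finite_parts :: "complex set filter" where
  "finite_parts \<equiv> finite_subsets_at_top (L - {0})"

lemma wp_eq: "wp z = 1 / z\<^sup>2 + wp_regular z"
  by (simp add: lattice_wp_def wp_regular_def)

text \<open>Since |w| <= |z - w| + R <= (1 + R / r) |z - w|, which is where \<open>K\<close> comes
  from, |z - w| is comparable to |w|. The difference equals z (2 w - z) / ((z - w)^2 w^2) and so
  decays like the inverse cube of |w|, which is summable over the lattice.\<close>

lemma wp_term_bound:
  assumes "w \<noteq> 0" "cmod z \<le> R" "r \<le> cmod (z - w)" "0 < r"
  defines "K \<equiv> 1 + R / r"
  shows "cmod (1 / (z - w)\<^sup>2 - 1 / w\<^sup>2) \<le> R * (K\<^sup>2 + K) * (1 / cmod w ^ 3)"
proof -
  define d where "d = cmod (z - w)"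
  have R: "R \<ge> 0" using assms(2) norm_ge_zero order_trans by blast
  have d: "d > 0" "d \<ge> r" using assms(3,4) unfolding d_def by linarith+
  have K: "K > 0" using R assms(4) unfolding K_def by (simp add: add_pos_nonneg)
  have "cmod w \<le> d + cmod z"
    unfolding d_def by (metis add.commute norm_minus_commute norm_triangle_sub)
  also have "\<dots> \<le> d + R * (d / r)"
    using d assms(2,4) R mult_left_mono[of 1 "d / r" R] by simp
  also have "\<dots> = K * d" by (simp add: K_def algebra_simps)
  finally have wd: "cmod w \<le> K * d" .
  have w: "cmod w > 0" using assms(1) by simp
  have inv: "1 / d \<le> K / cmod w"
    using wd w d by (simp add: divide_simps mult.commute)
  have zw: "z \<noteq> w" using d(1) by (auto simp: d_def)
  have "1 / (z - w)\<^sup>2 - 1 / w\<^sup>2 = z * (w + (w - z)) / ((z - w)\<^sup>2 * w\<^sup>2)"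
    using zw assms(1) by (simp add: divide_simps) (simp add: power2_eq_square algebra_simps)
  also have "cmod \<dots> = cmod z * cmod (w + (w - z)) / (d\<^sup>2 * (cmod w)\<^sup>2)"
    by (simp add: norm_mult norm_divide norm_power d_def)
  also have "\<dots> \<le> R * (cmod w + d) / (d\<^sup>2 * (cmod w)\<^sup>2)"
    using assms(2) R norm_triangle_ineq[of w "w - z"]
    by (intro divide_right_mono mult_mono) (auto simp: d_def norm_minus_commute)
  also have "\<dots> = R * ((1 / d)\<^sup>2 * (1 / cmod w) + (1 / d) * (1 / cmod w)\<^sup>2)"
    using w d by (simp add: field_simps power2_eq_square)
  also have "\<dots> \<le> R * ((K / cmod w)\<^sup>2 * (1 / cmod w) + (K / cmod w) * (1 / cmod w)\<^sup>2)"
    using inv d R by (intro mult_left_mono add_mono mult_right_mono power_mono) auto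
  also have "\<dots> = R * (K\<^sup>2 + K) * (1 / cmod w ^ 3)"
    using w by (simp add: field_simps power2_eq_square power3_eq_cube)
  finally show ?thesis .
qed

lemma wp_regular_uniform_limit:
  assumes "z0 \<notin> L - {0}"
  obtains r where "r > 0" "cball z0 r \<subseteq> - (L - {0})"
    "uniform_limit (cball z0 r) wp_sum wp_regular
      finite_parts"
proof -
  obtain e where e: "e > 0" "cball z0 e \<subseteq> - (L - {0})"
    using open_Compl_nonzero assms open_contains_cball by (metis ComplI)
  \<comment> \<open>With half the radius, every point of \<open>cball z0 r\<close> keeps distance at
    least \<open>r\<close> from the nonzero lattice points, as the term bound requires.\<close>
  define r where "r = e / 2"
  have r: "r > 0" using e by (simp add: r_def)
  moreover have "cball z0 r \<subseteq> cball z0 e"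
    using e(1) by (intro subset_cball) (simp add: r_def)
  ultimately have r: "r > 0" "cball z0 r \<subseteq> - (L - {0})" using e by blast+
  define K where "K = 1 + (cmod z0 + r) / r"
  have "uniform_limit (cball z0 r) wp_sum
      (\<lambda>z. \<Sum>\<^sub>\<infinity>w\<in>L - {0}. 1 / (z - w)\<^sup>2 - 1 / w\<^sup>2) finite_parts"
  proof (rule Weierstrass_m_test_general)
    show "(\<lambda>w. (cmod z0 + r) * (K\<^sup>2 + K) * (1 / cmod w ^ 3)) summable_on L - {0}"
      by (rule summable_on_cmult_right[OF summable_inverse_cube])
    fix w z assume w: "w \<in> L - {0}" and z: "z \<in> cball z0 r"
    have "cmod z \<le> cmod z0 + r"
      using z norm_triangle_sub[of z z0] by (simp add: dist_norm norm_minus_commute)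
    moreover have "\<not> dist z0 w \<le> e" using w e by auto
    then have "r \<le> cmod (z - w)"
      using z dist_triangle[of z0 w z] by (simp add: r_def dist_norm)
    ultimately show "cmod (1 / (z - w)\<^sup>2 - 1 / w\<^sup>2) \<le> (cmod z0 + r) * (K\<^sup>2 + K) * (1 / cmod w ^ 3)"
      unfolding K_def using w r(1) by (intro wp_term_bound) auto
  qed
  then show ?thesis using that r unfolding wp_regular_def[abs_def] by blast
qed

lemma wp_term_holomorphic:
  assumes "cball z0 r \<subseteq> - (L - {0})"
  shows "\<forall>\<^sub>F X in finite_parts.
    (wp_sum X) holomorphic_on cball z0 r"
  using assms by (intro eventually_finite_subsets_at_top_weakI) (force intro!: holomorphic_intros)

lemma holomorphic_wp_regular: "wp_regular holomorphic_on - (L - {0})"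
proof -
  have "wp_regular field_differentiable (at z0)" if z0: "z0 \<notin> L - {0}" for z0
  proof -
    obtain r where r: "r > 0" "cball z0 r \<subseteq> - (L - {0})"
      "uniform_limit (cball z0 r) wp_sum wp_regular
        finite_parts"
      using wp_regular_uniform_limit[OF z0] by blast
    have "wp_regular holomorphic_on ball z0 r"
    proof (rule holomorphic_uniform_limit[OF _ r(3)])
      show "\<forall>\<^sub>F X in finite_parts.
          continuous_on (cball z0 r) (wp_sum X) \<and>
          (wp_sum X) holomorphic_on ball z0 r"
        using wp_term_holomorphic[OF r(2)]
        by eventually_elim (auto intro: holomorphic_on_imp_continuous_on holomorphic_on_subset)
    qed auto
    then show ?thesis using r(1) by (auto intro: holomorphic_on_imp_differentiable_at)
  qed
  then show ?thesis
    using open_Compl_nonzero by (auto simp: holomorphic_on_def intro: field_differentiable_at_within)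
qed

text \<open>Locally uniform limits of holomorphic functions may be differentiated term by term. The
  limit runs along the filter of finite subsets, so the outcome is an unconditional sum, which may
  be reindexed freely.\<close>

lemma has_sum_higher_deriv_wp_regular:
  assumes "z \<notin> L - {0}"
  shows "((\<lambda>w. (- 1) ^ m * fact (Suc m) / (z - w) ^ (m + 2) - (if m = 0 then 1 / w\<^sup>2 else 0))
    has_sum (deriv ^^ m) wp_regular z) (L - {0})"
proof -
  obtain r where r: "r > 0" "cball z r \<subseteq> - (L - {0})"
    "uniform_limit (cball z r) wp_sum wp_regular
      finite_parts"
    using wp_regular_uniform_limit[OF assms] by blast
  have "((\<lambda>X. (deriv ^^ m) (wp_sum X) z) \<longlongrightarrow> (deriv ^^ m) wp_regular z)
      finite_parts"
  proof (rule higher_deriv_complex_uniform_limit)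
    show "uniform_limit (ball z r) wp_sum wp_regular
        finite_parts"
      by (rule uniform_limit_on_subset[OF r(3)]) auto
    show "\<forall>\<^sub>F X in finite_parts.
        (wp_sum X) holomorphic_on ball z r"
      using wp_term_holomorphic[OF r(2)] by eventually_elim (auto intro: holomorphic_on_subset)
  qed (use r(1) in auto)
  moreover have "\<forall>\<^sub>F X in finite_parts.
      (deriv ^^ m) (wp_sum X) z =
      (\<Sum>w\<in>X. (- 1) ^ m * fact (Suc m) / (z - w) ^ (m + 2) - (if m = 0 then 1 / w\<^sup>2 else 0))"
  proof (rule eventually_finite_subsets_at_top_weakI)
    fix X assume X: "finite X" "X \<subseteq> L - {0}"
    have "(deriv ^^ m) (wp_sum X) z =
        (\<Sum>w\<in>X. (deriv ^^ m) (\<lambda>z. 1 / (z - w)\<^sup>2 - 1 / w\<^sup>2) z)"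
    proof (rule higher_deriv_sum)
      fix w assume "w \<in> X"
      then show "(\<lambda>z. 1 / (z - w)\<^sup>2 - 1 / w\<^sup>2) analytic_on {z}"
        using X assms by (force intro!: analytic_intros)
    qed (use X in simp)
    also have "\<dots> = (\<Sum>w\<in>X. (- 1) ^ m * fact (Suc m) / (z - w) ^ (m + 2) - (if m = 0 then 1 / w\<^sup>2 else 0))"
      using X assms by (intro sum.cong refl higher_deriv_inverse_square) auto
    finally show "(deriv ^^ m) (wp_sum X) z =
      (\<Sum>w\<in>X. (- 1) ^ m * fact (Suc m) / (z - w) ^ (m + 2) - (if m = 0 then 1 / w\<^sup>2 else 0))" .
  qed
  ultimately show ?thesis
    unfolding has_sum_def by (rule Lim_transform_eventually)
qed

lemma higher_deriv_wp_regular_0: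
  assumes "m > 0"
  shows "(deriv ^^ m) wp_regular 0 = fact (Suc m) * (\<Sum>\<^sub>\<infinity>w\<in>L - {0}. 1 / w ^ (m + 2))"
proof -
  have "(deriv ^^ m) wp_regular 0 = (\<Sum>\<^sub>\<infinity>w\<in>L - {0}. (- 1) ^ m * fact (Suc m) / (0 - w) ^ (m + 2))"
    using infsumI[OF has_sum_higher_deriv_wp_regular[of 0 m]] assms by simp
  also have "\<dots> = (\<Sum>\<^sub>\<infinity>w\<in>L - {0}. fact (Suc m) * (1 / w ^ (m + 2)))"
  proof (rule infsum_cong)
    fix w :: complex
    have "(- w :: complex) ^ (m + 2) = (- 1) ^ m * w ^ (m + 2)"
      by (subst power_minus) (simp add: power_add)
    then show "(- 1) ^ m * fact (Suc m) / (0 - w) ^ (m + 2) = fact (Suc m) * (1 / w ^ (m + 2))"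
      by (cases "even m") auto
  qed
  finally show ?thesis by (simp only: infsum_cmult_right')
qed

lemma wp_regular_0: "wp_regular 0 = 0"
  by (simp add: wp_regular_def)

text \<open>Odd derivatives vanish by the symmetry w -> - w. The coefficients of z^2 and z^4 are 3
  and 5 times the lattice sums of exponents 4 and 6, and 3/60 = 1/20, 5/140 = 1/28.\<close>

lemma taylor_wp_regular:
  obtains r k where "r > 0" "ball 0 r \<subseteq> - (L - {0})" "k holomorphic_on ball 0 r"
    "\<And>z. z \<in> ball 0 r \<Longrightarrow>
      wp_regular z = lattice_g2 L / 20 * z\<^sup>2 + lattice_g3 L / 28 * z ^ 4 + z ^ 6 * k z"
proof -
  obtain r where r: "r > 0" "ball 0 r \<subseteq> - (L - {0})"
    using open_Compl_nonzero open_contains_ball by (metis ComplI DiffD2 singletonI)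
  have hol: "wp_regular holomorphic_on ball 0 r"
    using holomorphic_wp_regular r(2) by (rule holomorphic_on_subset)
  obtain k where k: "k holomorphic_on ball 0 r"
    "\<And>z. z \<in> ball 0 r \<Longrightarrow>
      wp_regular z = (\<Sum>i<6. (deriv ^^ i) wp_regular 0 / fact i * z ^ i) + z ^ 6 * k z"
    using holomorphic_taylor_remainder[OF hol] by blast
  have odd: "(deriv ^^ m) wp_regular 0 = 0" if "odd m" for m
  proof -
    have "(\<Sum>\<^sub>\<infinity>w\<in>L - {0}. 1 / w ^ (m + 2)) = 0"
      using that by (intro infsum_odd_eq_0 bij_betw_uminus) (simp add: power_minus_odd)
    then show ?thesis
      using higher_deriv_wp_regular_0[of m] that by (cases "m = 0") auto
  qed
  have 2: "(deriv ^^ 2) wp_regular 0 = lattice_g2 L / 10"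
    using higher_deriv_wp_regular_0[of 2] by (simp add: lattice_g2_def numeral_3_eq_3[symmetric] fact_numeral)
  have 4: "(deriv ^^ 4) wp_regular 0 = 6 / 7 * lattice_g3 L"
    using higher_deriv_wp_regular_0[of 4] by (simp add: lattice_g3_def fact_numeral)
  have "wp_regular z = lattice_g2 L / 20 * z\<^sup>2 + lattice_g3 L / 28 * z ^ 4 + z ^ 6 * k z"
    if "z \<in> ball 0 r" for z
  proof -
    have "(\<Sum>i<6. (deriv ^^ i) wp_regular 0 / fact i * z ^ i)
        = (\<Sum>i\<in>{0, 1, 2, 3, 4, 5}. (deriv ^^ i) wp_regular 0 / fact i * z ^ i)"
      by (intro sum.cong) auto
    also have "\<dots> = (deriv ^^ 2) wp_regular 0 / fact 2 * z ^ 2 + (deriv ^^ 4) wp_regular 0 / fact 4 * z ^ 4"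
      using odd[of 1] odd[of 3] odd[of 5] by (simp add: wp_regular_0)
    also have "\<dots> = lattice_g2 L / 20 * z\<^sup>2 + lattice_g3 L / 28 * z ^ 4"
      unfolding 2 4 by (simp add: fact_numeral)
    finally show ?thesis using k(2)[OF that] by simp
  qed
  then show ?thesis using that r k(1) by blast
qed

lemma holomorphic_wp: "wp holomorphic_on - L"
proof -
  have "wp_regular holomorphic_on - L"
    using holomorphic_wp_regular by (rule holomorphic_on_subset) auto
  then show ?thesis
    unfolding wp_eq[abs_def] using zero_mem by (intro holomorphic_intros) auto
qed

lemma wp_regular_has_field_derivative:
  "z \<notin> L - {0} \<Longrightarrow> (wp_regular has_field_derivative deriv wp_regular z) (at z)"
  using holomorphic_derivI[OF holomorphic_wp_regular open_Compl_nonzero] by blast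

lemma wp_has_field_derivative: "z \<notin> L \<Longrightarrow> (wp has_field_derivative deriv wp z) (at z)"
  using holomorphic_derivI[OF holomorphic_wp open_Compl] by blast

lemma holomorphic_deriv_wp: "deriv wp holomorphic_on - L"
  using holomorphic_wp open_Compl by (rule holomorphic_deriv)

lemma deriv_wp_has_field_derivative:
  "z \<notin> L \<Longrightarrow> (deriv wp has_field_derivative deriv (deriv wp) z) (at z)"
  using holomorphic_derivI[OF holomorphic_deriv_wp open_Compl] by blast

lemma deriv_wp_eq:
  assumes "z \<notin> L - {0}" "z \<noteq> 0"
  shows "deriv wp z = - 2 / z ^ 3 + deriv wp_regular z"
proof -
  have "((\<lambda>z. 1 / z\<^sup>2 + wp_regular z) has_field_derivative - 2 / z ^ 3 + deriv wp_regular z) (at z)"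
    using assms
    by (auto intro!: derivative_eq_intros wp_regular_has_field_derivative)
      (simp add: divide_simps power2_eq_square power3_eq_cube power4_eq_xxxx)
  then show ?thesis unfolding wp_eq[abs_def] by (rule DERIV_imp_deriv)
qed

lemma has_sum_deriv_wp:
  assumes "z \<notin> L"
  shows "((\<lambda>w. - 2 / (z - w) ^ 3) has_sum deriv wp z) L"
proof -
  have z: "z \<notin> L - {0}" "z \<noteq> 0" using assms zero_mem by auto
  have "((\<lambda>w. - 2 / (z - w) ^ 3) has_sum (- 2 / (z - 0) ^ 3 + deriv wp_regular z)) (insert 0 (L - {0}))"
    using has_sum_higher_deriv_wp_regular[OF z(1), of 1]
    by (intro has_sum_insert) (auto simp: numeral_3_eq_3)
  moreover have "insert 0 (L - {0}) = L" using zero_mem by auto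
  ultimately show ?thesis by (simp add: deriv_wp_eq[OF z])
qed

text \<open>The derivative is a sum over all of \<open>L\<close> without compensating terms, so a
  shift of the summation index suffices; for \<open>wp\<close> itself the terms 1 / w^2 prevent
  this.\<close>

lemma deriv_wp_add:
  assumes "v \<in> L" "z \<notin> L"
  shows "deriv wp (z + v) = deriv wp z"
proof -
  have "bij_betw (\<lambda>w. w + v) L L"
    by (rule bij_betwI[of _ _ _ "\<lambda>w. w - v"]) (use assms in \<open>auto simp: add_mem diff_mem\<close>)
  moreover have "((\<lambda>w. - 2 / (z + v - w) ^ 3) has_sum deriv wp (z + v)) L"
    using has_sum_deriv_wp[of "z + v"] assms by (simp add: add_mem_iff)
  ultimately have "((\<lambda>w. - 2 / (z + v - (w + v)) ^ 3) has_sum deriv wp (z + v)) L"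
    by (subst has_sum_reindex_bij_betw)
  then have "((\<lambda>w. - 2 / (z - w) ^ 3) has_sum deriv wp (z + v)) L" by simp
  then show ?thesis using has_sum_deriv_wp[OF assms(2)] has_sum_unique by blast
qed

lemma wp_regular_minus: "wp_regular (- z) = wp_regular z"
proof -
  have "wp_regular (- z) = (\<Sum>\<^sub>\<infinity>w\<in>L - {0}. 1 / (- z - (- w))\<^sup>2 - 1 / (- w)\<^sup>2)"
    unfolding wp_regular_def by (rule infsum_reindex_bij_betw[OF bij_betw_uminus, symmetric])
  also have "\<dots> = wp_regular z"
    unfolding wp_regular_def by (intro infsum_cong) (simp add: power2_commute)
  finally show ?thesis .
qed

lemma wp_minus: "wp (- z) = wp z"
  by (simp add: wp_eq wp_regular_minus)

text \<open>By periodicity of the derivative, wp (z + v) - wp z is a constant c. Evaluated at - z -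
  v, evenness shows c = - c. The usual choice of the point - v / 2 is avoided because it may itself
  lie in \<open>L\<close>.\<close>

lemma wp_add:
  assumes "v \<in> L" "z \<notin> L"
  shows "wp (z + v) = wp z"
proof -
  have const: "\<exists>c. \<forall>z\<in>- L. wp (z + v) - wp z = c" if v: "v \<in> L" for v
  proof -
    have "((\<lambda>z. wp (z + v) - wp z) has_field_derivative 0) (at z)" if "z \<in> - L" for z
    proof -
      have "z + v \<notin> L" using that v by (simp add: add_mem_iff)
      from wp_has_field_derivative[OF this]
      have "((\<lambda>z. wp (z + v)) has_field_derivative deriv wp (z + v)) (at z)"
        by (simp add: DERIV_shift)
      then have "((\<lambda>z. wp (z + v) - wp z) has_field_derivative deriv wp (z + v) - deriv wp z) (at z)"
        using that by (intro DERIV_diff wp_has_field_derivative) auto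
      then show ?thesis using deriv_wp_add[OF v, of z] that by simp
    qed
    then have "(\<lambda>z. wp (z + v) - wp z) constant_on - L"
      by (intro has_field_derivative_0_imp_constant_on connected_Compl open_Compl)
    then show ?thesis by (auto simp: constant_on_def)
  qed
  obtain c where c: "\<And>z. z \<notin> L \<Longrightarrow> wp (z + v) - wp z = c" using const[OF assms(1)] by auto
  have "wp (- z - v + v) - wp (- z - v) = c"
    using assms c[of "- z - v"] uminus_mem_iff[of "z + v"] by (simp add: add_mem_iff)
  then have "wp (- z) - wp (- (z + v)) = c" by simp
  then have "wp z - wp (z + v) = wp (z + v) - wp z"
    using c[OF assms(2)] unfolding wp_minus by simp
  then have "2 * wp (z + v) = 2 * wp z" by (simp add: algebra_simps)
  then show ?thesis by simp
qed

lemma deriv_wp_minus: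
  assumes "z \<notin> L"
  shows "deriv wp (- z) = - deriv wp z"
proof -
  have "(wp has_field_derivative deriv wp (- z)) (at (- z))"
    using assms by (intro wp_has_field_derivative) (simp add: uminus_mem_iff)
  then have "((\<lambda>z. wp (- z)) has_field_derivative - deriv wp (- z)) (at z)"
    using DERIV_chain2[OF _ DERIV_minus[OF DERIV_ident], of wp] by fastforce
  then have "(wp has_field_derivative - deriv wp (- z)) (at z)"
    by (simp add: wp_minus)
  then show ?thesis using wp_has_field_derivative[OF assms] DERIV_unique by fastforce
qed

lemma deriv_wp_half_period:
  assumes "v \<notin> L" "2 * v \<in> L"
  shows "deriv wp v = 0"
proof -
  have "deriv wp v = deriv wp (- v + 2 * v)" by simp
  also have "\<dots> = deriv wp (- v)"
    using assms by (intro deriv_wp_add) (auto simp: uminus_mem_iff)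
  also have "\<dots> = - deriv wp v" using assms by (intro deriv_wp_minus) auto
  finally show ?thesis by simp
qed

end

section \<open>Elliptic functions and the differential equation\<close>

context complex_lattice
begin

text \<open>Periodicity spreads the limit at 0 to all lattice points. The function extended by
  \<open>l\<close> is continuous, hence entire by removability of the singularities, and bounded
  because bounded representatives exist; Liouville's theorem applies.\<close>

lemma elliptic_constant:
  assumes hol: "f holomorphic_on - L"
    and per: "\<And>v z. v \<in> L \<Longrightarrow> z \<notin> L \<Longrightarrow> f (z + v) = f z"
    and lim: "(f \<longlongrightarrow> l) (at 0)"
    and z: "z \<notin> L"
  shows "f z = l"
proof -
  define F where "F z = (if z \<in> L then l else f z)" for z
  have per_F: "F (z + v) = F z" if "v \<in> L" for z v
    using that per by (auto simp: F_def add_mem_iff)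
  have ev: "\<forall>\<^sub>F z in at 0. z \<notin> L"
    using open_Compl_nonzero
    by (auto simp: eventually_at_topological intro!: exI[of _ "- (L - {0})"])
  have "(F \<longlongrightarrow> l) (at 0)"
    using lim by (rule Lim_transform_eventually) (use ev in eventually_elim, simp add: F_def)
  then have cont0: "isCont F 0"
    using zero_mem by (simp add: isCont_def F_def)
  have "isCont F z" for z
  proof (cases "z \<in> L")
    case True
    have "isCont (\<lambda>x. F (x - z)) z"
      using isCont_o2[of z "\<lambda>x. x - z" F] cont0 by simp
    moreover have "F (x - z) = F x" for x
      using per_F[of "- z" x] True uminus_mem by simp
    ultimately show ?thesis by simp
  next
    case False
    have "isCont f z"
      using hol open_Compl False
      by (meson ComplI continuous_on_eq_continuous_at holomorphic_on_imp_continuous_on)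
    moreover have "\<forall>\<^sub>F x in nhds z. x \<in> - L"
      using False by (intro eventually_nhds_in_open open_Compl) auto
    then have "\<forall>\<^sub>F x in nhds z. f x = F x"
      by eventually_elim (simp add: F_def)
    ultimately show ?thesis using isCont_cong by blast
  qed
  then have cont: "continuous_on A F" for A
    by (simp add: continuous_at_imp_continuous_on)
  \<comment> \<open>The removable singularity theorem takes a finite exceptional set, hence the
    restriction to balls.\<close>
  have "F holomorphic_on ball 0 R" for R
  proof (rule no_isolated_singularity)
    show "finite (L \<inter> cball 0 R)" by (rule finite_Int_cball)
    have "f holomorphic_on ball 0 R - L \<inter> cball 0 R"
      using hol by (rule holomorphic_on_subset) auto
    then show "F holomorphic_on ball 0 R - L \<inter> cball 0 R"
      by (rule holomorphic_transform) (auto simp: F_def)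
  qed (auto simp: cont)
  then have "F field_differentiable at z" for z
    using holomorphic_on_imp_differentiable_at[of F "ball 0 (cmod z + 1)" z] by simp
  then have "F holomorphic_on UNIV"
    by (simp add: holomorphic_on_def)
  moreover have "bounded (range F)"
  proof -
    obtain B where B: "\<And>z. \<exists>w\<in>L. cmod (z - w) \<le> B" using bounded_representative by blast
    have "range F \<subseteq> F ` cball 0 B"
    proof clarify
      fix z
      obtain w where w: "w \<in> L" "cmod (z - w) \<le> B" using B by blast
      have "F z = F (z - w)" using per_F[of "- w" z] w(1) uminus_mem by simp
      then show "F z \<in> F ` cball 0 B" using w(2) by auto
    qed
    moreover have "bounded (F ` cball 0 B)"
      using cont by (intro compact_imp_bounded compact_continuous_image) auto
    ultimately show ?thesis using bounded_subset by blast
  qed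
  ultimately have "F constant_on UNIV" by (rule Liouville_theorem)
  then have "F z = F 0" by (auto simp: constant_on_def)
  then show ?thesis using z zero_mem by (simp add: F_def)
qed

lemma eventually_at_0_punctured:
  assumes "r > 0" "ball 0 r \<subseteq> - (L - {0})"
  shows "\<forall>\<^sub>F z in at 0. z \<notin> L \<and> z \<noteq> 0 \<and> z \<in> ball 0 r"
  using assms by (auto simp: eventually_at intro!: exI[of _ r])

lemma deriv_deriv_wp_eq:
  assumes z: "z \<notin> L"
  shows "deriv (deriv wp) z = 6 / z ^ 4 + deriv (deriv wp_regular) z"
proof -
  have z0: "z \<noteq> 0" "z \<notin> L - {0}" using z zero_mem by auto
  have dr: "deriv wp_regular holomorphic_on - (L - {0})"
    using holomorphic_wp_regular open_Compl_nonzero by (rule holomorphic_deriv)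
  have "\<forall>\<^sub>F x in nhds z. x \<in> - L" using z by (intro eventually_nhds_in_open open_Compl) auto
  then have "\<forall>\<^sub>F x in nhds z. deriv wp x = - 2 / x ^ 3 + deriv wp_regular x"
    by eventually_elim (use zero_mem in \<open>subst deriv_wp_eq; auto\<close>)
  then have "deriv (deriv wp) z = deriv (\<lambda>x. - 2 / x ^ 3 + deriv wp_regular x) z"
    by (simp add: deriv_cong_ev)
  also have "((\<lambda>x. - 2 / x ^ 3 + deriv wp_regular x) has_field_derivative
      6 / z ^ 4 + deriv (deriv wp_regular) z) (at z)"
    using z0 open_Compl_nonzero
    by (auto intro!: derivative_eq_intros holomorphic_derivI[OF dr])
      (simp add: divide_simps eval_nat_numeral)
  then have "deriv (\<lambda>x. - 2 / x ^ 3 + deriv wp_regular x) z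
      = 6 / z ^ 4 + deriv (deriv wp_regular) z"
    by (rule DERIV_imp_deriv)
  finally show ?thesis .
qed

text \<open>The combination \<open>f\<close> is elliptic and all negative powers of its Laurent
  expansion at 0 cancel, so it is constant; its value is the limit at 0, which is - g3.\<close>

theorem wp_first_order:
  assumes "z \<notin> L"
  shows "(deriv wp z)\<^sup>2 = 4 * wp z ^ 3 - lattice_g2 L * wp z - lattice_g3 L"
proof -
  define f where "f z = (deriv wp z)\<^sup>2 - 4 * wp z ^ 3 + lattice_g2 L * wp z" for z
  define A B where "A = lattice_g2 L / 20" and "B = lattice_g3 L / 28"
  obtain r k where r: "r > 0" "ball 0 r \<subseteq> - (L - {0})" and k: "k holomorphic_on ball 0 r"
    and wr: "\<And>z. z \<in> ball 0 r \<Longrightarrow>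
      wp_regular z = lattice_g2 L / 20 * z\<^sup>2 + lattice_g3 L / 28 * z ^ 4 + z ^ 6 * k z"
    using taylor_wp_regular by blast
  have wr': "wp_regular z = A * z\<^sup>2 + B * z ^ 4 + z ^ 6 * k z" if "z \<in> ball 0 r" for z
    using wr[OF that] by (simp add: A_def B_def)
  have der: "deriv wp_regular z = 2 * A * z + 4 * B * z ^ 3 + z ^ 5 * (6 * k z + z * deriv k z)"
    if z: "z \<in> ball 0 r" for z
  proof -
    have "((\<lambda>z. A * z\<^sup>2 + B * z ^ 4 + z ^ 6 * k z) has_field_derivative
        2 * A * z + 4 * B * z ^ 3 + z ^ 5 * (6 * k z + z * deriv k z)) (at z)"
      using z by (auto intro!: derivative_eq_intros holomorphic_derivI[OF k])
        (simp add: algebra_simps eval_nat_numeral)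
    then have "(wp_regular has_field_derivative
        2 * A * z + 4 * B * z ^ 3 + z ^ 5 * (6 * k z + z * deriv k z)) (at z)"
      by (rule has_field_derivative_transform_within_open[OF _ open_ball z]) (simp add: wr')
    then show ?thesis by (rule DERIV_imp_deriv)
  qed
  have dk: "deriv k holomorphic_on ball 0 r" using k by (intro holomorphic_deriv) auto
  \<comment> \<open>\<open>F\<close> is \<open>f\<close> after the cancellation: the terms in 1 /
    z^6 are 4 - 4, those in A / z^2 are - 8 - 12 + 20, and the constant terms in B are - 16 - 12 = -
    28.\<close>
  define F where "F z = - 28 * B + (deriv wp_regular z)\<^sup>2 - 4 * z\<^sup>2 * (6 * k z + z * deriv k z)
     - 12 * z\<^sup>2 * k z - 12 * (A * z + B * z ^ 3 + z ^ 5 * k z)\<^sup>2 - 4 * wp_regular z ^ 3 + 20 * A * wp_regular z" for z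
  have f_eq: "f z = F z" if z: "z \<in> ball 0 r" "z \<noteq> 0" "z \<notin> L" for z
  proof -
    let ?h = "wp_regular z" and ?h' = "deriv wp_regular z"
    have "f z = (- 2 / z ^ 3 + ?h')\<^sup>2 - 4 * (1 / z\<^sup>2 + ?h) ^ 3 + 20 * A * (1 / z\<^sup>2 + ?h)"
      using z deriv_wp_eq[of z] by (simp add: f_def wp_eq A_def)
    also have "\<dots> = ?h'\<^sup>2 - 4 * (?h' / z ^ 3) - 12 * (?h / z ^ 4) - 12 * (?h / z)\<^sup>2 - 4 * ?h ^ 3
        + 20 * A / z\<^sup>2 + 20 * A * ?h"
      using z(2) by (simp add: field_simps eval_nat_numeral)
    also have "?h' / z ^ 3 = 2 * A / z\<^sup>2 + 4 * B + z\<^sup>2 * (6 * k z + z * deriv k z)"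
      using z(2) unfolding der[OF z(1)] by (simp add: field_simps eval_nat_numeral)
    also have "?h / z ^ 4 = A / z\<^sup>2 + B + z\<^sup>2 * k z"
      using z(2) unfolding wr'[OF z(1)] by (simp add: field_simps eval_nat_numeral)
    also have "?h / z = A * z + B * z ^ 3 + z ^ 5 * k z"
      using z(2) unfolding wr'[OF z(1)] by (simp add: field_simps eval_nat_numeral)
    finally show ?thesis unfolding F_def by (simp add: algebra_simps)
  qed
  have "isCont F 0"
  proof (rule continuous_on_interior)
    have "wp_regular holomorphic_on ball 0 r"
      using holomorphic_wp_regular r(2) by (rule holomorphic_on_subset)
    then show "continuous_on (ball 0 r) F"
      unfolding F_def using k dk
      by (intro holomorphic_on_imp_continuous_on holomorphic_intros) auto
  qed (use r in auto)
  moreover have "F 0 = - 28 * B"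
    using der[of 0] r(1) by (simp add: F_def wp_regular_0)
  ultimately have "(F \<longlongrightarrow> - 28 * B) (at 0)"
    by (simp add: isCont_def)
  then have lim: "(f \<longlongrightarrow> - 28 * B) (at 0)"
    by (rule Lim_transform_eventually)
      (use eventually_at_0_punctured[OF r] in eventually_elim, simp add: f_eq)
  have hol: "f holomorphic_on - L"
    unfolding f_def using holomorphic_wp holomorphic_deriv_wp open_Compl by (intro holomorphic_intros)
  have per: "f (z + v) = f z" if "v \<in> L" "z \<notin> L" for v z
    using that by (simp add: f_def wp_add deriv_wp_add)
  have "f z = - 28 * B" using elliptic_constant[OF hol per lim assms] .
  then show ?thesis by (simp add: f_def B_def algebra_simps)
qed

lemma wp_at_0: "filterlim wp at_infinity (at 0)"
proof -
  have "isCont wp_regular 0"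
    using holomorphic_wp_regular open_Compl_nonzero
    by (intro field_differentiable_imp_continuous_at holomorphic_on_imp_differentiable_at) auto
  then have "(wp_regular \<longlongrightarrow> 0) (at 0)" by (simp add: isCont_def wp_regular_0)
  moreover have "filterlim (\<lambda>z::complex. 1 / z\<^sup>2) at_infinity (at 0)"
    by (intro filterlim_divide_at_infinity[OF tendsto_const]) (auto intro!: tendsto_eq_intros simp: filterlim_at eventually_at_filter)
  ultimately show ?thesis
    unfolding wp_eq[abs_def] by (subst add.commute) (rule tendsto_add_filterlim_at_infinity)
qed

text \<open>Differentiating the first order equation yields this one only after multiplication by
  \<open>deriv wp\<close>. If the other factor were nonzero somewhere, \<open>deriv wp\<close> would
  vanish on an open set, hence everywhere, and \<open>wp\<close> would be constant in spite of its
  pole.\<close>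

lemma wp_second_order:
  assumes "z \<notin> L"
  shows "deriv (deriv wp) z = 6 * (wp z)\<^sup>2 - lattice_g2 L / 2"
proof -
  define f where "f z = 2 * deriv (deriv wp) z - 12 * (wp z)\<^sup>2 + lattice_g2 L" for z
  have prod: "f z * deriv wp z = 0" if z: "z \<in> - L" for z
  proof -
    have "((\<lambda>z. (deriv wp z)\<^sup>2) has_field_derivative 2 * deriv wp z * deriv (deriv wp) z) (at z)"
      using z by (auto intro!: derivative_eq_intros deriv_wp_has_field_derivative)
    moreover have "((\<lambda>z. (deriv wp z)\<^sup>2) has_field_derivative
        12 * (wp z)\<^sup>2 * deriv wp z - lattice_g2 L * deriv wp z) (at z)"
    proof (rule has_field_derivative_transform_within_open[OF _ open_Compl z])
      show "((\<lambda>z. 4 * wp z ^ 3 - lattice_g2 L * wp z - lattice_g3 L) has_field_derivative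
          12 * (wp z)\<^sup>2 * deriv wp z - lattice_g2 L * deriv wp z) (at z)"
        using z by (auto intro!: derivative_eq_intros wp_has_field_derivative)
    qed (simp add: wp_first_order)
    ultimately have "2 * deriv wp z * deriv (deriv wp) z
        = 12 * (wp z)\<^sup>2 * deriv wp z - lattice_g2 L * deriv wp z" by (rule DERIV_unique)
    then show ?thesis by (simp add: f_def algebra_simps)
  qed
  have "f z = 0"
  proof (rule ccontr)
    assume nz: "f z \<noteq> 0"
    have "deriv (deriv wp) holomorphic_on - L"
      using holomorphic_deriv_wp open_Compl by (rule holomorphic_deriv)
    then have "f holomorphic_on - L"
      unfolding f_def using holomorphic_wp open_Compl by (intro holomorphic_intros)
    then have "continuous_on (- L) f" by (rule holomorphic_on_imp_continuous_on)
    then have N: "open (- L \<inter> f -` (- {0}))"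
      using continuous_open_preimage[OF _ open_Compl] by blast
    have "deriv wp w = 0" if "w \<in> - L" for w
    proof (rule analytic_continuation_open[OF N open_Compl _ connected_Compl _ holomorphic_deriv_wp, of "\<lambda>_. 0"])
      show "- L \<inter> f -` (- {0}) \<noteq> {}" using nz assms by blast
    qed (use that prod in auto)
    then have "wp constant_on - L"
      by (intro has_field_derivative_0_imp_constant_on connected_Compl open_Compl)
        (metis ComplD wp_has_field_derivative)
    then obtain c where c: "\<And>w. w \<notin> L \<Longrightarrow> wp w = c" by (auto simp: constant_on_def)
    have "\<forall>\<^sub>F w in at 0. wp w = c"
      using open_Compl_nonzero by (auto simp: eventually_at_topological intro!: exI[of _ "- (L - {0})"] c)
    then have "(wp \<longlongrightarrow> c) (at 0)" by (rule tendsto_eventually)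
    then show False using wp_at_0 not_tendsto_and_filterlim_at_infinity trivial_limit_at by blast
  qed
  then show ?thesis by (simp add: f_def algebra_simps) (simp add: field_simps)
qed

lemma wp_at_lattice: "v \<in> L \<Longrightarrow> filterlim wp at_infinity (at v)"
proof -
  assume v: "v \<in> L"
  have "filterlim (\<lambda>z. wp (z - v)) at_infinity (at v)"
    using wp_at_0 by (simp add: filterlim_at_to_0[of _ _ v])
  moreover have "\<forall>\<^sub>F z in at v. wp (z - v) = wp z"
  proof -
    have "open (- (L - {v}))" by (metis Diff_subset closed_subset open_closed double_compl)
    then have "\<forall>\<^sub>F z in at v. z \<in> - (L - {v}) \<and> z \<noteq> v"
      by (auto simp: eventually_at_topological)
    then show ?thesis
      by eventually_elim (use wp_add[of "- v"] v uminus_mem in auto)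
  qed
  ultimately show ?thesis using filterlim_cong by fast
qed

end

section \<open>Uniqueness of the lattice with given invariants\<close>

text \<open>Gronwall's argument for the energy N = D^2 + w^2: its derivative is bounded by c N, so N
  exp (- c y) decreases and N exp (c y) increases, which handles the points right and left of
  \<open>x0\<close>. Only the bound on \<open>z\<close> matters, so \<open>D\<close> may be a
  difference of two solutions of a nonlinear equation.\<close>

lemma second_order_ode_zero:
  fixes D w z :: "real \<Rightarrow> real"
  assumes D: "\<And>x. x \<in> {a..b} \<Longrightarrow> (D has_real_derivative w x) (at x)"
    and w: "\<And>x. x \<in> {a..b} \<Longrightarrow> (w has_real_derivative z x) (at x)"
    and z: "\<And>x. x \<in> {a..b} \<Longrightarrow> \<bar>z x\<bar> \<le> K * \<bar>D x\<bar>"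
    and x0: "x0 \<in> {a..b}" "D x0 = 0" "w x0 = 0"
    and x: "x \<in> {a..b}"
  shows "D x = 0"
proof -
  define c where "c = 1 + \<bar>K\<bar>"
  define N where "N y = (D y)\<^sup>2 + (w y)\<^sup>2" for y
  have N0: "N x0 = 0" by (simp add: N_def x0)
  have N_nonneg: "N y \<ge> 0" for y by (simp add: N_def)
  have dN: "(N has_real_derivative 2 * D y * w y + 2 * w y * z y) (at y)" if "y \<in> {a..b}" for y
    unfolding N_def by (auto intro!: derivative_eq_intros D w that)
  have bound: "\<bar>2 * D y * w y + 2 * w y * z y\<bar> \<le> c * N y" if "y \<in> {a..b}" for y
  proof -
    have "\<bar>z y\<bar> \<le> \<bar>K\<bar> * \<bar>D y\<bar>"
      using z[OF that] by (meson abs_ge_self abs_ge_zero mult_right_mono order_trans)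
    then have "\<bar>w y\<bar> * \<bar>z y\<bar> \<le> \<bar>w y\<bar> * (\<bar>K\<bar> * \<bar>D y\<bar>)" by (rule mult_left_mono) simp
    then have "2 * \<bar>D y\<bar> * \<bar>w y\<bar> + 2 * \<bar>w y\<bar> * \<bar>z y\<bar> \<le> c * (2 * \<bar>D y\<bar> * \<bar>w y\<bar>)"
      by (simp add: c_def algebra_simps)
    also have "2 * \<bar>D y\<bar> * \<bar>w y\<bar> \<le> N y"
      using sum_squares_bound[of "\<bar>D y\<bar>" "\<bar>w y\<bar>"] by (simp add: N_def)
    then have "c * (2 * \<bar>D y\<bar> * \<bar>w y\<bar>) \<le> c * N y"
      by (rule mult_left_mono) (simp add: c_def)
    finally have "2 * \<bar>D y\<bar> * \<bar>w y\<bar> + 2 * \<bar>w y\<bar> * \<bar>z y\<bar> \<le> c * N y" .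
    moreover have "\<bar>2 * D y * w y + 2 * w y * z y\<bar> \<le> 2 * \<bar>D y\<bar> * \<bar>w y\<bar> + 2 * \<bar>w y\<bar> * \<bar>z y\<bar>"
      by (rule order.trans[OF abs_triangle_ineq]) (simp add: abs_mult)
    ultimately show ?thesis by linarith
  qed
  have "N x \<le> 0"
  proof (cases "x0 \<le> x")
    case True
    have "N x * exp (- c * x) \<le> N x0 * exp (- c * x0)"
    proof (rule DERIV_nonpos_imp_nonincreasing[OF True])
      fix y assume y: "x0 \<le> y" "y \<le> x"
      then have yab: "y \<in> {a..b}" using x x0 by auto
      have "((\<lambda>y. N y * exp (- c * y)) has_real_derivative
          (2 * D y * w y + 2 * w y * z y - c * N y) * exp (- c * y)) (at y)"
        by (auto intro!: derivative_eq_intros dN yab simp: algebra_simps)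
      moreover have "(2 * D y * w y + 2 * w y * z y - c * N y) * exp (- c * y) \<le> 0"
        using bound[OF yab] by (intro mult_nonpos_nonneg) auto
      ultimately show "\<exists>d. ((\<lambda>y. N y * exp (- c * y)) has_real_derivative d) (at y) \<and> d \<le> 0" by blast
    qed
    then show ?thesis by (simp add: N0 mult_le_0_iff)
  next
    case False
    then have le: "x \<le> x0" by simp
    have "N x * exp (c * x) \<le> N x0 * exp (c * x0)"
    proof (rule DERIV_nonneg_imp_nondecreasing[OF le])
      fix y assume y: "x \<le> y" "y \<le> x0"
      then have yab: "y \<in> {a..b}" using x x0 by auto
      have "((\<lambda>y. N y * exp (c * y)) has_real_derivative
          (2 * D y * w y + 2 * w y * z y + c * N y) * exp (c * y)) (at y)"
        by (auto intro!: derivative_eq_intros dN yab simp: algebra_simps)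
      moreover have "(2 * D y * w y + 2 * w y * z y + c * N y) * exp (c * y) \<ge> 0"
        using bound[OF yab] by (intro mult_nonneg_nonneg) auto
      ultimately show "\<exists>d. ((\<lambda>y. N y * exp (c * y)) has_real_derivative d) (at y) \<and> d \<ge> 0" by blast
    qed
    then show ?thesis by (simp add: N0 mult_le_0_iff)
  qed
  then have "N x = 0" using N_nonneg[of x] by simp
  then show ?thesis by (simp add: N_def)
qed

lemma lattice_wp_eq_near_0:
  assumes "complex_lattice L1" "complex_lattice L2"
    and "lattice_g2 L1 = lattice_g2 L2" "lattice_g3 L1 = lattice_g3 L2"
  shows "\<forall>\<^sub>F z in nhds 0. lattice_wp L1 z = lattice_wp L2 z"
proof -
  interpret A: complex_lattice L1 by fact
  interpret B: complex_lattice L2 by fact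
  define f where "f z = A.wp_regular z - B.wp_regular z" for z
  define r where "r z = A.wp_regular z + B.wp_regular z" for z
  define N where "N = - (L1 - {0}) \<inter> - (L2 - {0})"
  have N: "open N" "0 \<in> N"
    unfolding N_def by (intro open_Int A.open_Compl_nonzero B.open_Compl_nonzero) simp
  have hA: "A.wp_regular holomorphic_on N" and hB: "B.wp_regular holomorphic_on N"
    unfolding N_def using A.holomorphic_wp_regular B.holomorphic_wp_regular
    by (auto intro: holomorphic_on_subset)
  \<comment> \<open>Equality of \<open>g2\<close> cancels the constant terms of the two second order
    equations, and the two double poles add up to 2 / z^2, which gives 12. Multiplication by z^2
    leaves an identity between functions holomorphic at 0.\<close>
  have ode: "z\<^sup>2 * deriv (deriv f) z = f z * (12 + 6 * (z\<^sup>2 * r z))" if z: "z \<in> N" for z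
  proof (cases "z = 0")
    case False
    then have zL: "z \<notin> L1" "z \<notin> L2" using z by (auto simp: N_def)
    have "(deriv ^^ 2) f z = (deriv ^^ 2) A.wp_regular z - (deriv ^^ 2) B.wp_regular z"
      unfolding f_def using hA hB N z by (intro higher_deriv_diff) auto
    then have "deriv (deriv f) z = deriv (deriv A.wp) z - deriv (deriv B.wp) z"
      using A.deriv_deriv_wp_eq[OF zL(1)] B.deriv_deriv_wp_eq[OF zL(2)] by (simp add: numeral_2_eq_2)
    also have "\<dots> = 6 * ((A.wp z)\<^sup>2 - (B.wp z)\<^sup>2)"
      unfolding A.wp_second_order[OF zL(1)] B.wp_second_order[OF zL(2)] assms by (simp add: algebra_simps)
    also have "\<dots> = 6 * (f z * (2 / z\<^sup>2 + r z))"
      by (simp add: A.wp_eq B.wp_eq f_def r_def power2_eq_square algebra_simps diff_divide_distrib)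
    finally show ?thesis using False by (simp add: field_simps)
  qed (simp add: f_def A.wp_regular_0 B.wp_regular_0)
  define F R where "F = fps_expansion f 0" and "R = fps_expansion r 0"
  have "f analytic_on {0}" "r analytic_on {0}"
    unfolding f_def r_def using hA hB N
    by (auto simp: analytic_at intro!: exI[of _ N] holomorphic_intros)
  then have f: "f has_fps_expansion F" and r: "r has_fps_expansion R"
    unfolding F_def R_def by (auto intro: analytic_at_imp_has_fps_expansion_0)
  have 1: "(\<lambda>z. z\<^sup>2 * deriv (deriv f) z) has_fps_expansion fps_X\<^sup>2 * fps_deriv (fps_deriv F)"
    by (intro fps_expansion_intros has_fps_expansion_deriv f)
  have 2: "(\<lambda>z. f z * (12 + 6 * (z\<^sup>2 * r z))) has_fps_expansion F * (12 + 6 * (fps_X\<^sup>2 * R))"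
    by (intro fps_expansion_intros f r)
  have ev: "\<forall>\<^sub>F z in nhds 0. z\<^sup>2 * deriv (deriv f) z = f z * (12 + 6 * (z\<^sup>2 * r z))"
    using eventually_nhds_in_open[OF N] by eventually_elim (rule ode)
  from 1 have "(\<lambda>z. f z * (12 + 6 * (z\<^sup>2 * r z))) has_fps_expansion fps_X\<^sup>2 * fps_deriv (fps_deriv F)"
    by (subst has_fps_expansion_cong[OF eventually_mono[OF ev] refl]) auto
  from fps_expansion_unique_complex[OF this 2]
  have eq: "fps_X\<^sup>2 * fps_deriv (fps_deriv F) = 12 * F + fps_X\<^sup>2 * (6 * (F * R))"
    by (simp add: algebra_simps)
  have F4: "fps_nth F 4 = 0"
  proof -
    have "(deriv ^^ 4) f 0 = (deriv ^^ 4) A.wp_regular 0 - (deriv ^^ 4) B.wp_regular 0"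
      unfolding f_def using hA hB N by (intro higher_deriv_diff) auto
    also have "\<dots> = 0"
      using assms(4) A.higher_deriv_wp_regular_0[of 4] B.higher_deriv_wp_regular_0[of 4]
      by (simp add: lattice_g3_def)
    finally show ?thesis by (simp add: F_def fps_expansion_def)
  qed
  have "fps_nth F n = 0" for n
  proof (induction n rule: less_induct)
    case (less n)
    have "fps_nth (fps_X\<^sup>2 * fps_deriv (fps_deriv F)) n = of_nat (n * (n - 1)) * fps_nth F n"
    proof (cases "n < 2")
      case True
      then show ?thesis by (auto simp: fps_X_power_mult_nth less_2_cases_iff)
    next
      case False
      then obtain m where "n = Suc (Suc m)" by (metis Suc_1 add_2_eq_Suc le_Suc_ex not_less)
      then show ?thesis by (simp add: fps_X_power_mult_nth) (simp add: algebra_simps)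
    qed
    moreover have "fps_nth (fps_X\<^sup>2 * (6 * (F * R))) n = 0"
    proof -
      \<comment> \<open>Only coefficients of \<open>F\<close> up to index n - 2 enter here, and they
        vanish by the induction hypothesis.\<close>
      have "fps_nth (F * R) (n - 2) = 0" if "n \<ge> 2"
        unfolding fps_mult_nth using less that by (intro sum.neutral) auto
      then show ?thesis by (simp add: fps_X_power_mult_nth fps_numeral_fps_const fps_mult_left_const_nth)
    qed
    ultimately have "of_nat (n * (n - 1)) * fps_nth F n = of_nat 12 * fps_nth F n"
      using arg_cong[OF eq, of "\<lambda>G. fps_nth G n"] by (simp add: fps_numeral_fps_const fps_mult_left_const_nth)
    then have "fps_nth F n = 0 \<or> n * (n - 1) = 12" by (simp only: mult_cancel_right of_nat_eq_iff)
    moreover have "n = 4" if "n * (n - 1) = 12"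
    proof -
      have "n < 5" using mult_le_mono[of 5 n 4 "n - 1"] that by linarith
      then have "n \<in> {0, 1, 2, 3, 4}" by auto
      then show ?thesis using that by auto
    qed
    ultimately show ?case using F4 by auto
  qed
  then have F0: "F = 0" by (simp add: fps_eq_iff)
  have "\<forall>\<^sub>F z in nhds 0. eval_fps F z = f z" using f by (simp add: has_fps_expansion_def)
  then show ?thesis by eventually_elim (simp add: F0 f_def A.wp_eq B.wp_eq)
qed

text \<open>A lattice is recovered as the set of poles of its function. The two functions agree near
  0 and hence on the connected complement of both lattices; at a point of \<open>L1\<close> outside
  \<open>L2\<close> one would tend to infinity and the other to a finite value.\<close>

lemma lattice_subset_of_invariants:
  assumes "complex_lattice L1" "complex_lattice L2"
    and "lattice_g2 L1 = lattice_g2 L2" "lattice_g3 L1 = lattice_g3 L2"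
  shows "L1 \<subseteq> L2"
proof
  interpret A: complex_lattice L1 by fact
  interpret B: complex_lattice L2 by fact
  fix v assume v: "v \<in> L1"
  have "\<forall>\<^sub>F z in nhds 0. z \<in> - (L1 - {0}) \<and> z \<in> - (L2 - {0}) \<and> lattice_wp L1 z = lattice_wp L2 z"
    by (intro eventually_conj eventually_nhds_in_open A.open_Compl_nonzero B.open_Compl_nonzero
      lattice_wp_eq_near_0 assms) auto
  then obtain r where r: "r > 0" and near: "\<forall>z\<in>ball 0 r. z \<in> - (L1 - {0}) \<and> z \<in> - (L2 - {0}) \<and>
      lattice_wp L1 z = lattice_wp L2 z"
    by (auto simp: eventually_nhds_metric dist_commute)
  let ?U = "- (L1 \<union> L2)"
  have U: "open ?U" using A.open_Compl B.open_Compl by (simp add: open_Int)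
  have conn: "connected ?U"
    using A.countable B.countable
    by (intro path_connected_imp_connected path_connected_complement_countable) auto
  have eq: "lattice_wp L1 z = lattice_wp L2 z" if "z \<in> ?U" for z
  proof (rule analytic_continuation_open[of "ball 0 r - {0}" ?U "lattice_wp L1" "lattice_wp L2"])
    show "ball 0 r - {0} \<noteq> ({} :: complex set)"
    proof -
      have "of_real (r / 2) \<in> ball 0 r - ({0} :: complex set)" using r by simp
      then show ?thesis by blast
    qed
    show "lattice_wp L1 holomorphic_on ?U" using A.holomorphic_wp by (rule holomorphic_on_subset) auto
    show "lattice_wp L2 holomorphic_on ?U" using B.holomorphic_wp by (rule holomorphic_on_subset) auto
  qed (use U conn that near in auto)
  show "v \<in> L2"
  proof (rule ccontr)
    assume nv: "v \<notin> L2"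
    have "open (- (L1 - {v}))" by (metis Diff_subset A.closed_subset open_closed double_compl)
    then have "\<forall>\<^sub>F z in at v. z \<in> - (L1 - {v}) \<and> z \<noteq> v" by (auto simp: eventually_at_topological)
    moreover have "\<forall>\<^sub>F z in at v. z \<in> - L2"
      using nv B.open_Compl by (intro eventually_at_in_open') auto
    ultimately have "\<forall>\<^sub>F z in at v. lattice_wp L1 z = lattice_wp L2 z"
      by eventually_elim (auto intro: eq)
    then have "filterlim (lattice_wp L2) at_infinity (at v)"
      using A.wp_at_lattice[OF v] filterlim_cong by fast
    moreover have "(lattice_wp L2 \<longlongrightarrow> lattice_wp L2 v) (at v)"
      using B.wp_has_field_derivative[OF nv] DERIV_isCont isCont_def by blast
    ultimately show False using not_tendsto_and_filterlim_at_infinity trivial_limit_at by blast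
  qed
qed

theorem lattice_determined_by_invariants:
  assumes "is_complex_lattice L1" "is_complex_lattice L2"
    and "lattice_g2 L1 = lattice_g2 L2" "lattice_g3 L1 = lattice_g3 L2"
  shows "L1 = L2"
  using assms by (intro equalityI lattice_subset_of_invariants) (simp_all add: complex_lattice.intro)

section \<open>The degenerate limit: sums over the integers\<close>

lemma higher_deriv_Digamma_diff:
  fixes z :: complex
  assumes "z \<in> ball 0 1"
  shows "(deriv ^^ n) (\<lambda>z. Digamma (1 + z) - Digamma (1 - z)) z =
    Polygamma n (1 + z) - (- 1) ^ n * Polygamma n (1 - z)"
proof -
  define T where "T = {z :: complex. Re z > 0}"
  have T: "open T" by (simp add: T_def open_halfspace_Re_gt)
  have TI: "T \<inter> \<int>\<^sub>\<le>\<^sub>0 = {}" by (auto simp: T_def elim!: nonpos_Ints_cases)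
  have plus: "1 * w + 1 \<in> T" and minus: "- 1 * w + 1 \<in> T" if "w \<in> ball 0 1" for w :: complex
    using that abs_Re_le_cmod[of w] by (auto simp: T_def)
  have notin: "1 + z \<notin> \<int>\<^sub>\<le>\<^sub>0" "1 - z \<notin> \<int>\<^sub>\<le>\<^sub>0"
    using plus[OF assms] minus[OF assms] TI by (auto simp: add.commute)
  have hol: "Digamma holomorphic_on T"
    using TI by (intro holomorphic_on_Polygamma)
  have 1: "(deriv ^^ n) (\<lambda>w. Digamma (1 * w + 1)) z = 1 ^ n * (deriv ^^ n) Digamma (1 * z + 1)"
    using plus assms by (intro higher_deriv_compose_linear'[where S = "ball 0 1", OF hol _ T]) auto
  have 2: "(deriv ^^ n) (\<lambda>w. Digamma (- 1 * w + 1)) z = (- 1) ^ n * (deriv ^^ n) Digamma (- 1 * z + 1)"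
    using minus assms by (intro higher_deriv_compose_linear'[where S = "ball 0 1", OF hol _ T]) auto
  have "(\<lambda>w. Digamma (1 * w + 1)) holomorphic_on ball 0 1" "(\<lambda>w. Digamma (- 1 * w + 1)) holomorphic_on ball 0 1"
    using plus minus
    by (auto intro!: holomorphic_on_compose_gen[OF _ hol, unfolded o_def] holomorphic_intros)
  then have "(deriv ^^ n) (\<lambda>w. Digamma (1 * w + 1) - Digamma (- 1 * w + 1)) z =
      (deriv ^^ n) (\<lambda>w. Digamma (1 * w + 1)) z - (deriv ^^ n) (\<lambda>w. Digamma (- 1 * w + 1)) z"
    using assms by (intro higher_deriv_diff) auto
  then show ?thesis
    unfolding 1 2 using notin by (simp add: higher_deriv_Polygamma add.commute)
qed

text \<open>The function is 1 / z - \<pi> cot (\<pi> z), and this is the Riccati equation of the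
  cotangent, multiplied by z so as to hold at 0. Instead of the quotient, g = \<pi> z / sin (\<pi>
  z) is used: g sin (\<pi> z) = \<pi> z comes from the reflection formula, g cos (\<pi> z) = 1 - z f
  z from differentiating it, and a second differentiation gives the claim.\<close>

lemma Digamma_diff_Riccati:
  fixes z :: complex
  assumes "z \<in> ball 0 1"
  defines "f \<equiv> \<lambda>z. Digamma (1 + z) - Digamma (1 - z)"
  shows "z * deriv f z = z * (f z)\<^sup>2 + of_real pi ^ 2 * z - 2 * f z"
proof -
  define g where "g z = Gamma (1 + z) * Gamma (1 - z)" for z :: complex
  define p where "p = complex_of_real pi"
  have notin: "1 + w \<notin> \<int>\<^sub>\<le>\<^sub>0" "1 - w \<notin> \<int>\<^sub>\<le>\<^sub>0" if "w \<in> ball 0 1" for w :: complex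
    using that abs_Re_le_cmod[of w] by (auto elim!: nonpos_Ints_cases simp: complex_eq_iff)
  have df: "(f has_field_derivative deriv f w) (at w)" if w: "w \<in> ball 0 1" for w
  proof -
    have "(f has_field_derivative Polygamma 1 (1 + w) + Polygamma 1 (1 - w)) (at w)"
      unfolding f_def using notin[OF w] by (auto intro!: derivative_eq_intros)
    then show ?thesis using DERIV_deriv_iff_field_differentiable field_differentiable_def by blast
  qed
  have dg: "(g has_field_derivative g w * f w) (at w)" if "w \<in> ball 0 1" for w
    unfolding g_def f_def using notin[OF that]
    by (auto intro!: derivative_eq_intros simp: algebra_simps)
  have gs: "g w * sin (p * w) = p * w" if w: "w \<in> ball 0 1" for w
  proof (cases "w = 0")
    case False
    have "w \<notin> \<int>"
    proof
      assume "w \<in> \<int>"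
      then obtain k where k: "w = of_int k" by (elim Ints_cases)
      then have "\<bar>real_of_int k\<bar> < 1" using w by simp
      then have "k = 0" by linarith
      then show False using False k by simp
    qed
    have "sin (p * w) \<noteq> 0"
    proof
      assume "sin (p * w) = 0"
      then obtain n :: int where "p * w = of_real (of_int n * pi)"
        by (auto simp: sin_eq_0)
      then have "p * w = p * of_int n" by (simp add: p_def mult.commute)
      then have "w = of_int n" by (simp add: p_def)
      then show False using \<open>w \<notin> \<int>\<close> by simp
    qed
    moreover have "Gamma (1 + w) = w * Gamma w"
      using Gamma_plus1[of w] \<open>w \<notin> \<int>\<close> by (metis add.commute nonpos_Ints_Int)
    moreover have "Gamma w * Gamma (1 - w) = p / sin (p * w)"
      unfolding p_def by (rule Gamma_reflection_complex)
    ultimately show ?thesis by (simp add: g_def field_simps)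
  qed simp
  have gc: "g w * cos (p * w) = 1 - w * f w" if w: "w \<in> ball 0 1" for w
  proof -
    have "((\<lambda>w. g w * sin (p * w)) has_field_derivative g w * f w * sin (p * w) + g w * (p * cos (p * w))) (at w)"
      by (auto intro!: derivative_eq_intros dg w simp: algebra_simps)
    moreover have "((\<lambda>w. g w * sin (p * w)) has_field_derivative p) (at w)"
      by (rule has_field_derivative_transform_within_open[of "\<lambda>w. p * w" _ _ "ball 0 1"])
        (use w gs in \<open>auto intro!: derivative_eq_intros\<close>)
    ultimately have "g w * f w * sin (p * w) + g w * (p * cos (p * w)) = p"
      by (rule DERIV_unique)
    then have "p * (w * f w + g w * cos (p * w)) = p * 1"
      using gs[OF w] by (simp add: algebra_simps)
    then have "w * f w + g w * cos (p * w) = 1" by (simp add: p_def)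
    then show ?thesis by (simp add: algebra_simps)
  qed
  have "((\<lambda>w. g w * cos (p * w)) has_field_derivative g z * f z * cos (p * z) - g z * (p * sin (p * z))) (at z)"
    by (auto intro!: derivative_eq_intros dg assms(1) simp: algebra_simps)
  moreover have "((\<lambda>w. g w * cos (p * w)) has_field_derivative - (f z + z * deriv f z)) (at z)"
    by (rule has_field_derivative_transform_within_open[of "\<lambda>w. 1 - w * f w" _ _ "ball 0 1"])
      (use assms(1) gc in \<open>auto intro!: derivative_eq_intros df\<close>)
  ultimately have "g z * f z * cos (p * z) - g z * (p * sin (p * z)) = - (f z + z * deriv f z)"
    by (rule DERIV_unique)
  moreover have "g z * f z * cos (p * z) = f z * (1 - z * f z)"
    using gc[OF assms(1)] by (metis mult.assoc mult.commute)
  moreover have "g z * (p * sin (p * z)) = p * (p * z)"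
    using gs[OF assms(1)] by (metis mult.left_commute)
  ultimately have "f z * (1 - z * f z) - p * (p * z) = - (f z + z * deriv f z)" by simp
  then show ?thesis unfolding p_def by (simp add: algebra_simps power2_eq_square)
qed

text \<open>For even k >= 2 this is twice the value of the Riemann zeta function at k. It is the
  contribution of the row n = 0 to the sum over a rectangular lattice.\<close>

definition int_zeta :: "nat \<Rightarrow> complex" where
  "int_zeta k = (\<Sum>\<^sub>\<infinity>m\<in>UNIV - {0::int}. 1 / of_int m ^ k)"

lemma has_sum_int_zeta:
  assumes "even k" "k \<ge> 2"
  shows "((\<lambda>m::int. 1 / of_int m ^ k) has_sum 2 * (\<Sum>j. inverse ((1 + of_nat j) ^ k) :: complex)) (UNIV - {0})"
proof -
  let ?s = "\<Sum>j. inverse ((1 + of_nat j) ^ k) :: complex"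
  have "summable (\<lambda>j. inverse ((1 + real j) ^ k))"
    using Polygamma_converges'[of "1::real" k] assms by simp
  moreover have "cmod (1 / of_int (int j + 1) ^ k) = inverse ((1 + real j) ^ k)" for j
    by (simp add: norm_divide norm_power inverse_eq_divide) (metis add.commute norm_of_nat of_nat_Suc)
  ultimately have "summable (\<lambda>j. cmod (1 / of_int (int j + 1) ^ k))" by simp
  moreover have "(\<lambda>j. 1 / of_int (int j + 1) ^ k) sums ?s"
    using summable_sums[OF Polygamma_converges'[of "1::complex" k]] assms by (simp add: inverse_eq_divide add.commute)
  ultimately have s: "((\<lambda>j. 1 / of_int (int j + 1) ^ k) has_sum ?s) UNIV"
    by (rule norm_summable_imp_has_sum)
  have "((\<lambda>m::int. 1 / of_int m ^ k) has_sum ?s) (range (\<lambda>j. int j + 1))"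
    by (subst has_sum_reindex) (use s in \<open>auto simp: o_def inj_on_def\<close>)
  moreover have "((\<lambda>m::int. 1 / of_int m ^ k) has_sum ?s) (range (\<lambda>j. - (int j + 1)))"
  proof -
    have "1 / of_int (- (int j + 1)) ^ k = (1 / of_int (int j + 1) ^ k :: complex)" for j
      using assms by (simp only: of_int_minus power_minus_even)
    then show ?thesis
      by (subst has_sum_reindex) (use s in \<open>simp_all only: o_def, auto simp: inj_on_def\<close>)
  qed
  ultimately have "((\<lambda>m::int. 1 / of_int m ^ k) has_sum (?s + ?s))
      (range (\<lambda>j. int j + 1) \<union> range (\<lambda>j. - (int j + 1)))"
    by (rule has_sum_Un_disjoint) auto
  moreover have "range (\<lambda>j. int j + 1) \<union> range (\<lambda>j. - (int j + 1)) = UNIV - {0}"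
  proof (intro equalityI subsetI)
    fix m :: int assume "m \<in> UNIV - {0}"
    then consider "m > 0" | "m < 0" by fastforce
    then show "m \<in> range (\<lambda>j. int j + 1) \<union> range (\<lambda>j. - (int j + 1))"
    proof cases
      case 1
      define j where "j = nat (m - 1)"
      have "m = int j + 1" using 1 by (simp add: j_def)
      then show ?thesis by blast
    next
      case 2
      define j where "j = nat (- m - 1)"
      have "m = - (int j + 1)" using 2 by (simp add: j_def)
      then show ?thesis by blast
    qed
  next
    fix m :: int assume "m \<in> range (\<lambda>j. int j + 1) \<union> range (\<lambda>j. - (int j + 1))"
    then show "m \<in> UNIV - {0}" by (elim UnE imageE) simp_all
  qed
  ultimately show ?thesis unfolding mult_2 by (rule subst[rotated])
qed

lemma int_zeta_eq:
  assumes "even k" "k \<ge> 2"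
  shows "int_zeta k = 2 * (\<Sum>j. inverse ((1 + of_nat j) ^ k))"
  unfolding int_zeta_def using has_sum_int_zeta[OF assms] by (rule infsumI)

lemma int_zeta_pos:
  assumes "even k" "k \<ge> 2"
  shows "int_zeta k = of_real (Re (int_zeta k))" "Re (int_zeta k) > 0"
proof -
  have sm: "summable (\<lambda>j. inverse ((1 + real j) ^ k))"
    using Polygamma_converges'[of "1::real" k] assms by simp
  have "int_zeta k = 2 * (\<Sum>j. of_real (inverse ((1 + real j) ^ k)))"
    using assms by (subst int_zeta_eq) simp_all
  also have "(\<Sum>j. of_real (inverse ((1 + real j) ^ k))) = (of_real (\<Sum>j. inverse ((1 + real j) ^ k)) :: complex)"
    by (rule suminf_of_real[OF sm, symmetric])
  also have "2 * (of_real (\<Sum>j. inverse ((1 + real j) ^ k)) :: complex)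
      = of_real (2 * (\<Sum>j. inverse ((1 + real j) ^ k)))" by simp
  finally have eq: "int_zeta k = of_real (2 * (\<Sum>j. inverse ((1 + real j) ^ k)))" .
  show "int_zeta k = of_real (Re (int_zeta k))" by (simp add: eq)
  have "0 < (\<Sum>j. inverse ((1 + real j) ^ k))"
    by (rule suminf_pos[OF sm]) (simp add: add_pos_nonneg)
  then show "Re (int_zeta k) > 0" by (simp add: eq)
qed

text \<open>The Taylor coefficient of odd index n of the function in the Riccati equation is
  \<open>int_zeta (n + 1)\<close>; comparing coefficients of z^3 and z^5 gives the two relations.
  Together they make the discriminant vanish for the limit of the rectangular lattices.\<close>

lemma int_zeta_relations:
  shows "5 * int_zeta 4 = (int_zeta 2)\<^sup>2" and "7 * int_zeta 6 = 2 * int_zeta 2 * int_zeta 4"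
proof -
  define f where "f = (\<lambda>z :: complex. Digamma (1 + z) - Digamma (1 - z))"
  define F where "F = fps_expansion f 0"
  have nth: "fps_nth F n = (1 - (- 1) ^ n) * Polygamma n 1 / fact n" for n
    using higher_deriv_Digamma_diff[of 0 n]
    by (simp add: F_def fps_expansion_def f_def left_diff_distrib)
  have odd: "fps_nth F n = int_zeta (Suc n)" if "odd n" for n
  proof -
    have "n > 0" using that by (rule odd_pos)
    then have "Polygamma n 1 = fact n * (\<Sum>k. inverse ((1 + of_nat k :: complex) ^ Suc n))"
      using that by (simp add: Polygamma_def)
    then show ?thesis using that \<open>n > 0\<close> int_zeta_eq[of "Suc n"] by (simp add: nth)
  qed
  have odd': "fps_nth F 1 = int_zeta 2" "fps_nth F 3 = int_zeta 4" "fps_nth F 5 = int_zeta 6"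
    using odd[of 1] by (simp add: numeral_2_eq_2) (use odd[of 3] odd[of 5] in simp_all)
  have even: "fps_nth F n = 0" if "even n" for n
    using that by (simp add: nth)
  have hol: "f analytic_on {0}"
    unfolding f_def by (intro analytic_intros) (auto intro!: analytic_intros)
  then have f: "f has_fps_expansion F"
    unfolding F_def by (rule analytic_at_imp_has_fps_expansion_0)
  have 1: "(\<lambda>z. z * deriv f z) has_fps_expansion fps_X * fps_deriv F"
    by (intro fps_expansion_intros has_fps_expansion_deriv f)
  have 2: "(\<lambda>z. z * (f z * f z) + of_real pi ^ 2 * z - 2 * f z) has_fps_expansion
      fps_X * (F * F) + fps_const (of_real pi ^ 2) * fps_X - fps_const 2 * F"
    by (intro fps_expansion_intros f)
  have ev: "\<forall>\<^sub>F z in nhds 0. z * deriv f z = z * (f z * f z) + of_real pi ^ 2 * z - 2 * f z"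
  proof -
    have "\<forall>\<^sub>F z in nhds 0. z \<in> ball (0 :: complex) 1" by (intro eventually_nhds_in_open) auto
    then show ?thesis
      by eventually_elim (use Digamma_diff_Riccati in \<open>simp add: f_def power2_eq_square\<close>)
  qed
  have "(\<lambda>z. z * deriv f z) has_fps_expansion
      fps_X * (F * F) + fps_const (of_real pi ^ 2) * fps_X - fps_const 2 * F"
    using 2 ev by (subst has_fps_expansion_cong[OF _ refl])
  with 1 have eq: "fps_X * fps_deriv F = fps_X * (F * F) + fps_const (of_real pi ^ 2) * fps_X - fps_const 2 * F"
    by (rule fps_expansion_unique_complex)
  have "fps_nth (fps_X * fps_deriv F) 3
      = fps_nth (fps_X * (F * F) + fps_const (of_real pi ^ 2) * fps_X - fps_const 2 * F) 3"
    by (simp only: eq)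
  then have "3 * fps_nth F 3 = fps_nth (F * F) 2 - 2 * fps_nth F 3"
    by (simp add: eval_nat_numeral)
  also have "fps_nth (F * F) 2 = (fps_nth F 1)\<^sup>2"
    by (simp add: fps_mult_nth eval_nat_numeral even)
  finally show "5 * int_zeta 4 = (int_zeta 2)\<^sup>2"
    unfolding odd' by (simp add: algebra_simps)
  have "fps_nth (fps_X * fps_deriv F) 5
      = fps_nth (fps_X * (F * F) + fps_const (of_real pi ^ 2) * fps_X - fps_const 2 * F) 5"
    by (simp only: eq)
  then have "5 * fps_nth F 5 = fps_nth (F * F) 4 - 2 * fps_nth F 5"
    by (simp add: eval_nat_numeral)
  also have "fps_nth (F * F) 4 = 2 * fps_nth F 1 * fps_nth F 3"
    by (simp add: fps_mult_nth eval_nat_numeral even)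
  finally show "7 * int_zeta 6 = 2 * int_zeta 2 * int_zeta 4"
    unfolding odd' by (simp add: algebra_simps)
qed

section \<open>Real lattices and existence of the lattice with given invariants\<close>

lemma has_real_derivative_Re_line:
  assumes "(f has_field_derivative f') (at (c + d * of_real t))"
  shows "((\<lambda>t. Re (f (c + d * of_real t))) has_real_derivative Re (d * f')) (at t)"
proof -
  have "((\<lambda>z. f (c + d * z)) has_field_derivative f' * d) (at (of_real t))"
    using assms by (intro DERIV_chain2[where g = "\<lambda>z. c + d * z"]) (auto intro!: derivative_eq_intros)
  then have "((\<lambda>t. f (c + d * of_real t)) has_vector_derivative f' * d) (at t)"
    by (rule has_vector_derivative_real_field)
  then have "((\<lambda>t. Re (f (c + d * of_real t))) has_vector_derivative Re (f' * d)) (at t)"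
    by (rule bounded_linear.has_vector_derivative[OF bounded_linear_Re])
  then show ?thesis
    by (simp add: has_real_derivative_iff_has_vector_derivative mult.commute)
qed

lemma infsum_cnj_image:
  "(\<Sum>\<^sub>\<infinity>w\<in>cnj ` L - {0}. 1 / w ^ k) = cnj (\<Sum>\<^sub>\<infinity>w\<in>L - {0}. 1 / w ^ k)"
proof -
  have "bij_betw cnj (L - {0}) (cnj ` L - {0})"
    by (auto simp: bij_betw_def inj_on_def image_iff)
  from infsum_reindex_bij_betw[OF this, of "\<lambda>w. 1 / w ^ k"]
  show ?thesis by (simp flip: infsum_cnj)
qed

section \<open>Lattices stable under complex conjugation\<close>

locale real_lattice = complex_lattice +
  assumes cnj_mem: "z \<in> L \<Longrightarrow> cnj z \<in> L"
begin

lemma cnj_mem_iff: "cnj z \<in> L \<longleftrightarrow> z \<in> L"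
  using cnj_mem[of z] cnj_mem[of "cnj z"] by auto

lemma bij_betw_cnj: "bij_betw cnj (L - {0}) (L - {0})"
  by (rule bij_betwI[of _ _ _ cnj]) (auto simp: cnj_mem)

lemma wp_cnj: "wp (cnj z) = cnj (wp z)"
proof -
  have "wp_regular (cnj z) = (\<Sum>\<^sub>\<infinity>w\<in>L - {0}. 1 / (cnj z - cnj w)\<^sup>2 - 1 / (cnj w)\<^sup>2)"
    unfolding wp_regular_def by (rule infsum_reindex_bij_betw[OF bij_betw_cnj, symmetric])
  also have "\<dots> = cnj (wp_regular z)"
    unfolding wp_regular_def by (simp flip: infsum_cnj)
  finally show ?thesis by (simp add: wp_eq)
qed

lemma deriv_wp_cnj:
  assumes "z \<notin> L"
  shows "deriv wp (cnj z) = cnj (deriv wp z)"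
proof -
  have bij: "bij_betw cnj L L"
    by (rule bij_betwI[of _ _ _ cnj]) (auto simp: cnj_mem)
  have "((\<lambda>w. - 2 / (cnj z - w) ^ 3) has_sum deriv wp (cnj z)) L"
    using assms by (intro has_sum_deriv_wp) (simp add: cnj_mem_iff)
  then have "((\<lambda>w. - 2 / (cnj z - cnj w) ^ 3) has_sum deriv wp (cnj z)) L"
    by (subst has_sum_reindex_bij_betw[OF bij])
  moreover have "((\<lambda>w. cnj (- 2 / (z - w) ^ 3)) has_sum cnj (deriv wp z)) L"
    unfolding has_sum_cnj_iff by (rule has_sum_deriv_wp[OF assms])
  then have "((\<lambda>w. - 2 / (cnj z - cnj w) ^ 3) has_sum cnj (deriv wp z)) L" by simp
  ultimately show ?thesis by (rule has_sum_unique)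
qed

lemma invariants_real:
  "lattice_g2 L = of_real (Re (lattice_g2 L))" "lattice_g3 L = of_real (Re (lattice_g3 L))"
proof -
  have "cnj ` L = L" using cnj_mem by (force simp: image_iff)
  then have "(\<Sum>\<^sub>\<infinity>w\<in>L - {0}. 1 / w ^ k) = cnj (\<Sum>\<^sub>\<infinity>w\<in>L - {0}. 1 / w ^ k)" for k
    using infsum_cnj_image[where L = L and k = k] by simp
  from this[of 4] this[of 6]
  show "lattice_g2 L = of_real (Re (lattice_g2 L))" "lattice_g3 L = of_real (Re (lattice_g3 L))"
    by (simp_all add: lattice_g2_def lattice_g3_def complex_eq_iff)
qed

lemma wp_real: "wp (of_real x) = of_real (Re (wp (of_real x)))"
  using wp_cnj[of "of_real x"] by (simp add: complex_eq_iff)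

lemma deriv_wp_real:
  "of_real x \<notin> L \<Longrightarrow> deriv wp (of_real x) = of_real (Re (deriv wp (of_real x)))"
  using deriv_wp_cnj[of "of_real x"] by (simp add: complex_eq_iff)

lemma real_wp_has_derivative:
  assumes "of_real x \<notin> L"
  shows "((\<lambda>x. Re (wp (of_real x))) has_real_derivative Re (deriv wp (of_real x))) (at x)"
  using has_real_derivative_Re_line[of wp "deriv wp (of_real x)" 0 1 x]
    wp_has_field_derivative[OF assms] by simp

lemma real_wp_second_derivative:
  assumes "of_real x \<notin> L"
  shows "((\<lambda>x. Re (deriv wp (of_real x))) has_real_derivative
    6 * (Re (wp (of_real x)))\<^sup>2 - Re (lattice_g2 L) / 2) (at x)"
proof -
  have "Re (deriv (deriv wp) (of_real x)) = 6 * (Re (wp (of_real x)))\<^sup>2 - Re (lattice_g2 L) / 2"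
    unfolding wp_second_order[OF assms] by (subst wp_real) (simp flip: of_real_power)
  then show ?thesis
    using has_real_derivative_Re_line[of "deriv wp" "deriv (deriv wp) (of_real x)" 0 1 x]
      deriv_wp_has_field_derivative[OF assms] by simp
qed

lemma real_wp_first_order:
  assumes "of_real x \<notin> L"
  shows "(Re (deriv wp (of_real x)))\<^sup>2 = 4 * Re (wp (of_real x)) ^ 3
    - Re (lattice_g2 L) * Re (wp (of_real x)) - Re (lattice_g3 L)"
proof -
  have "complex_of_real ((Re (deriv wp (of_real x)))\<^sup>2) = of_real (4 * Re (wp (of_real x)) ^ 3
    - Re (lattice_g2 L) * Re (wp (of_real x)) - Re (lattice_g3 L))"
    using wp_first_order[OF assms] invariants_real wp_real[of x] deriv_wp_real[OF assms]
    by (metis (no_types, lifting) of_real_diff of_real_mult of_real_numeral of_real_power)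
  then show ?thesis by (simp only: of_real_eq_iff)
qed

lemma real_wp_at_0: "filterlim (\<lambda>x. Re (wp (of_real x))) at_infinity (at 0)"
proof -
  have "filterlim (\<lambda>x::real. complex_of_real x) (at 0) (at 0)"
    by (auto simp: filterlim_at eventually_at_filter intro!: tendsto_eq_intros)
  then have "filterlim (\<lambda>x. wp (of_real x)) at_infinity (at 0)"
    by (rule filterlim_compose[OF wp_at_0])
  then have "filterlim (\<lambda>x. cmod (wp (of_real x))) at_top (at 0)"
    by (simp add: filterlim_at_infinity_conv_norm_at_top)
  moreover have "cmod (wp (of_real x)) = norm (Re (wp (of_real x)))" for x
    by (subst wp_real) simp
  ultimately show ?thesis
    by (simp add: filterlim_at_infinity_conv_norm_at_top)
qed

end

section \<open>Rectangular lattices: sign and non-vanishing of the invariants\<close>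

definition rect_lattice :: "real \<Rightarrow> complex set" where
  "rect_lattice t = {of_int m * 1 + of_int n * (\<i> * of_real t) | m n. True}"

lemma is_complex_lattice_rect: "t > 0 \<Longrightarrow> is_complex_lattice (rect_lattice t)"
  unfolding is_complex_lattice_def rect_lattice_def
  by (intro exI[of _ 1] exI[of _ "\<i> * of_real t"]) simp

lemma rect_lattice_memI: "of_int m + of_int n * (\<i> * of_real t) \<in> rect_lattice t"
  unfolding rect_lattice_def by auto

lemma Re_rect_lattice: "z \<in> rect_lattice t \<Longrightarrow> Re z \<in> \<int>"
  unfolding rect_lattice_def by auto

lemma half_notin_rect_lattice: "Re z = 1 / 2 \<Longrightarrow> z \<notin> rect_lattice t"
proof
  assume z: "Re z = 1 / 2" "z \<in> rect_lattice t"
  then obtain k :: int where "1 / 2 = real_of_int k" using Re_rect_lattice by (metis Ints_cases)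
  then have "real_of_int (2 * k) = of_int 1" by simp
  then have "2 * k = 1" by (simp only: of_int_eq_iff)
  then show False by presburger
qed

lemma real_lattice_rect: "t > 0 \<Longrightarrow> real_lattice (rect_lattice t)"
proof (intro real_lattice.intro complex_lattice.intro real_lattice_axioms.intro is_complex_lattice_rect)
  fix z assume "z \<in> rect_lattice t"
  then obtain m n :: int where "z = of_int m + of_int n * (\<i> * of_real t)"
    unfolding rect_lattice_def by auto
  then have "cnj z = of_int m + of_int (- n) * (\<i> * of_real t)" by simp
  then show "cnj z \<in> rect_lattice t" using rect_lattice_memI by metis
qed

text \<open>On the line Re z = 1/2 the function is real, and its derivative vanishes at the half
  periods 1/2 and 1/2 + i t / 2. Rolle's theorem gives a point in between where the second
  derivative 6 wp^2 - g2 / 2 is zero, so g2 = 12 wp^2 there.\<close>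

lemma rect_lattice_g2_nonneg:
  assumes t: "t > 0"
  shows "Re (lattice_g2 (rect_lattice t)) \<ge> 0"
proof -
  interpret real_lattice "rect_lattice t" by (rule real_lattice_rect[OF t])
  \<comment> \<open>The factor \<open>\<i>\<close> is the direction of the line: \<open>g\<close> is
    the derivative with respect to \<open>y\<close> of the real part of \<open>wp\<close>.\<close>
  define g where "g y = Re (\<i> * deriv wp (1 / 2 + \<i> * of_real y))" for y
  have notin: "1 / 2 + \<i> * of_real y \<notin> rect_lattice t" for y
    by (rule half_notin_rect_lattice) simp
  have dg: "(g has_real_derivative - Re (deriv (deriv wp) (1 / 2 + \<i> * of_real y))) (at y)" for y
  proof -
    have "((\<lambda>z. \<i> * deriv wp z) has_field_derivative \<i> * deriv (deriv wp) (1 / 2 + \<i> * of_real y))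
        (at (1 / 2 + \<i> * of_real y))"
      by (intro DERIV_cmult deriv_wp_has_field_derivative notin)
    from has_real_derivative_Re_line[OF this] show ?thesis unfolding g_def by simp
  qed
  have "deriv wp (1 / 2 + \<i> * of_real 0) = 0"
    using rect_lattice_memI[of 1 0 t] by (intro deriv_wp_half_period notin) simp
  then have g0: "g 0 = 0" unfolding g_def by simp
  have "deriv wp (1 / 2 + \<i> * of_real (t / 2)) = 0"
    using rect_lattice_memI[of 1 1 t] by (intro deriv_wp_half_period notin) simp
  then have gt: "g (t / 2) = 0" unfolding g_def by simp
  have "\<exists>y>0. y < t / 2 \<and> (\<lambda>v. - Re (deriv (deriv wp) (1 / 2 + \<i> * of_real y)) * v) = (\<lambda>v. 0)"
  proof (rule Rolle_deriv)
    show "continuous_on {0..t / 2} g"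
      using dg by (intro DERIV_continuous_on) (auto intro: has_field_derivative_at_within)
    show "(g has_derivative (\<lambda>v. - Re (deriv (deriv wp) (1 / 2 + \<i> * of_real y)) * v)) (at y)" for y
      using dg[of y] unfolding has_field_derivative_def .
  qed (use t g0 gt in auto)
  then obtain y where y: "Re (deriv (deriv wp) (1 / 2 + \<i> * of_real y)) = 0"
    by (metis mult.right_neutral neg_equal_0_iff_equal)
  let ?z = "1 / 2 + \<i> * of_real y"
  have "cnj (wp ?z) = wp (- cnj ?z)" by (simp only: wp_minus wp_cnj)
  also have "\<dots> = wp (- cnj ?z + 1)"
    using rect_lattice_memI[of 1 0 t] cnj_mem_iff[of ?z] uminus_mem_iff[of "cnj ?z"] notin
    by (intro wp_add[symmetric]) auto
  also have "- cnj ?z + 1 = ?z" by (simp add: complex_eq_iff)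
  finally have "wp ?z = of_real (Re (wp ?z))" by (simp add: complex_eq_iff)
  then have "Re (6 * (wp ?z)\<^sup>2) = 6 * (Re (wp ?z))\<^sup>2"
    by (metis Re_complex_of_real of_real_mult of_real_numeral of_real_power)
  then have "6 * (Re (wp ?z))\<^sup>2 - Re (lattice_g2 (rect_lattice t)) / 2 = 0"
    using y unfolding wp_second_order[OF notin] by simp
  moreover have "(Re (wp ?z))\<^sup>2 \<ge> 0" by simp
  ultimately show ?thesis by linarith
qed

text \<open>With both invariants zero, the first order equation forces wp = 0 at the half period
  1/2, where the derivative vanishes too. Uniqueness for u'' = 6 u^2 then gives u = 0 on (0, 1/2),
  against the pole at 0.\<close>

lemma rect_lattice_invariants_nonzero:
  assumes t: "t > 0" and g2: "lattice_g2 (rect_lattice t) = 0" and g3: "lattice_g3 (rect_lattice t) = 0"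
  shows False
proof -
  interpret real_lattice "rect_lattice t" by (rule real_lattice_rect[OF t])
  define u where "u x = Re (wp (of_real x))" for x
  define u' where "u' x = Re (deriv wp (of_real x))" for x
  have notin: "of_real x \<notin> rect_lattice t" if "0 < x" "x < 1" for x :: real
  proof
    assume "of_real x \<in> rect_lattice t"
    then obtain k :: int where "x = of_int k" using Re_rect_lattice[of "of_real x"] by (auto elim: Ints_cases)
    then show False using that by simp
  qed
  have half: "complex_of_real (1 / 2) \<notin> rect_lattice t" by (rule half_notin_rect_lattice) simp
  have "deriv wp (of_real (1 / 2)) = 0"
    using rect_lattice_memI[of 1 0 t] half by (intro deriv_wp_half_period) auto
  then have u'0: "u' (1 / 2) = 0" by (simp add: u'_def)
  then have "4 * u (1 / 2) ^ 3 = 0"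
    using real_wp_first_order[OF half] g2 g3 by (simp add: u_def u'_def)
  then have u0: "u (1 / 2) = 0" by simp
  have du: "(u has_real_derivative u' x) (at x)" and du': "(u' has_real_derivative 6 * (u x)\<^sup>2) (at x)"
    if "0 < x" "x < 1" for x
    using real_wp_has_derivative[OF notin[OF that]] real_wp_second_derivative[OF notin[OF that]] g2
    unfolding u_def u'_def by simp_all
  have zero: "u x = 0" if x: "0 < x" "x < 1 / 2" for x
  proof -
    have "continuous_on {x..1 / 2} u"
      using x du by (intro DERIV_continuous_on[of _ _ u']) (auto intro: has_field_derivative_at_within)
    then have "bounded (u ` {x..1 / 2})"
      by (intro compact_imp_bounded compact_continuous_image) auto
    then obtain B where "\<forall>v\<in>u ` {x..1 / 2}. norm v \<le> B"
      by (auto simp only: bounded_iff)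
    then have B: "\<bar>u y\<bar> \<le> B" if "y \<in> {x..1 / 2}" for y
      using that by simp
    show ?thesis
    proof (rule second_order_ode_zero[of x "1 / 2" u u' "\<lambda>y. 6 * (u y)\<^sup>2" "6 * B" "1 / 2"])
      fix y assume y: "y \<in> {x..1 / 2}"
      show "\<bar>6 * (u y)\<^sup>2\<bar> \<le> 6 * B * \<bar>u y\<bar>"
        using mult_right_mono[OF B[OF y], of "\<bar>u y\<bar>"] by (simp add: power2_eq_square abs_mult)
    qed (use x du du' u0 u'0 in auto)
  qed
  have "\<forall>\<^sub>F x in at_right 0. u x = 0"
    using zero by (intro eventually_at_rightI[of 0 "1 / 2"]) auto
  then have "(u \<longlongrightarrow> 0) (at_right 0)"
    by (rule tendsto_eventually)
  moreover have "filterlim u at_infinity (at_right 0)"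
    using real_wp_at_0 unfolding u_def by (rule filterlim_mono) (auto simp: at_le)
  ultimately show False
    using not_tendsto_and_filterlim_at_infinity[of "at_right (0::real)" u 0] by simp
qed

section \<open>Scaling, continuity and limits of the invariants; existence of the lattice\<close>

lemma scaled_lattice:
  assumes "is_complex_lattice L" and c: "c \<noteq> 0"
  shows "is_complex_lattice ((*) c ` L)"
    and "lattice_g2 ((*) c ` L) = lattice_g2 L / c ^ 4"
    and "lattice_g3 ((*) c ` L) = lattice_g3 L / c ^ 6"
proof -
  obtain w1 w2 where w: "w1 \<noteq> 0" "Im (w2 / w1) \<noteq> 0"
    and L: "L = {of_int m * w1 + of_int n * w2 | m n. True}"
    using assms(1) unfolding is_complex_lattice_def by blast
  have "(*) c ` L = {of_int m * (c * w1) + of_int n * (c * w2) | m n. True}"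
    unfolding L by (force simp: algebra_simps)
  then show "is_complex_lattice ((*) c ` L)"
    unfolding is_complex_lattice_def using w c
    by (intro exI[of _ "c * w1"] exI[of _ "c * w2"]) simp
  have bij: "bij_betw ((*) c) (L - {0}) ((*) c ` L - {0})"
    using c by (auto simp: bij_betw_def inj_on_def)
  have "(\<Sum>\<^sub>\<infinity>w\<in>(*) c ` L - {0}. 1 / w ^ k) = (\<Sum>\<^sub>\<infinity>w\<in>L - {0}. 1 / w ^ k) / c ^ k" for k
  proof -
    have "(\<Sum>\<^sub>\<infinity>w\<in>(*) c ` L - {0}. 1 / w ^ k) = (\<Sum>\<^sub>\<infinity>w\<in>L - {0}. 1 / (c * w) ^ k)"
      by (rule infsum_reindex_bij_betw[OF bij, symmetric])
    also have "\<dots> = (\<Sum>\<^sub>\<infinity>w\<in>L - {0}. 1 / c ^ k * (1 / w ^ k))"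
      by (simp add: power_mult_distrib)
    also have "\<dots> = 1 / c ^ k * (\<Sum>\<^sub>\<infinity>w\<in>L - {0}. 1 / w ^ k)"
      by (rule infsum_cmult_right')
    finally show ?thesis by simp
  qed
  then show "lattice_g2 ((*) c ` L) = lattice_g2 L / c ^ 4"
    and "lattice_g3 ((*) c ` L) = lattice_g3 L / c ^ 6"
    by (simp_all add: lattice_g2_def lattice_g3_def)
qed

text \<open>Summing over integer pairs makes the index set independent of \<open>t\<close>, so that
  continuity and the limit in \<open>t\<close> can be studied term by term.\<close>

definition rect_sum :: "nat \<Rightarrow> real \<Rightarrow> complex" where
  "rect_sum k t = (\<Sum>\<^sub>\<infinity>(m::int, n::int)\<in>UNIV - {(0, 0)}. 1 / (of_int m + of_int n * (\<i> * of_real t)) ^ k)"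

lemma rect_sum_eq:
  assumes "t > 0"
  shows "(\<Sum>\<^sub>\<infinity>w\<in>rect_lattice t - {0}. 1 / w ^ k) = rect_sum k t"
proof -
  have "bij_betw (\<lambda>(m, n). of_int m * 1 + of_int n * (\<i> * of_real t)) (UNIV - {(0, 0)}) (rect_lattice t - {0})"
    unfolding rect_lattice_def using assms by (intro lattice_parametrization) auto
  from infsum_reindex_bij_betw[OF this, of "\<lambda>w. 1 / w ^ k"]
  show ?thesis by (simp add: rect_sum_def split_def)
qed

abbreviation rect_term :: "nat \<Rightarrow> int \<times> int \<Rightarrow> real \<Rightarrow> complex" where
  "rect_term k x t \<equiv> 1 / (of_int (fst x) + of_int (snd x) * (\<i> * of_real t)) ^ k"

abbreviation nonzero_parts :: "(int \<times> int) set filter" where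
  "nonzero_parts \<equiv> finite_subsets_at_top (UNIV - {(0, 0)})"

lemma rect_sum_uniform_limit:
  assumes "t0 > 0" "k \<ge> 3"
  shows "uniform_limit {t0..}
    (\<lambda>X t. \<Sum>x\<in>X. rect_term k x t)
    (rect_sum k) nonzero_parts"
proof -
  \<comment> \<open>The modulus of m + i n t dominates both |m| and t0 |n|, hence their average;
    this gives the factor 1/2. The bound is uniform on the whole half-line, as the limit at infinity
    requires.\<close>
  define c where "c = min 1 t0 / 2"
  have c: "c > 0" using assms by (simp add: c_def)
  have "uniform_limit {t0..}
    (\<lambda>X t. \<Sum>x\<in>X. rect_term k x t)
    (\<lambda>t. \<Sum>\<^sub>\<infinity>x\<in>UNIV - {(0, 0)}. rect_term k x t)
    nonzero_parts"
  proof (rule Weierstrass_m_test_general)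
    show "(\<lambda>x. (1 / c ^ k) * (case x of (m::int, n::int) \<Rightarrow> 1 / (\<bar>of_int m\<bar> + \<bar>of_int n\<bar>) ^ 3))
        summable_on UNIV - {(0, 0)}"
      by (rule summable_on_cmult_right[OF summable_on_int_pairs])
    fix x :: "int \<times> int" and t assume x: "x \<in> UNIV - {(0, 0)}" and t: "t \<in> {t0..}"
    obtain m n where mn: "x = (m, n)" by force
    let ?s = "\<bar>of_int m\<bar> + \<bar>of_int n\<bar> :: real"
    let ?z = "of_int m + of_int n * (\<i> * of_real t)"
    have s: "?s \<ge> 1" using x mn by (intro int_pair_abs_ge_1) simp
    have "\<bar>of_int m\<bar> \<le> cmod ?z" using abs_Re_le_cmod[of ?z] by simp
    moreover have "\<bar>of_int n\<bar> * t0 \<le> cmod ?z"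
    proof -
      have "\<bar>of_int n\<bar> * t0 \<le> \<bar>of_int n\<bar> * t" using t by (intro mult_left_mono) auto
      also have "\<dots> = \<bar>Im ?z\<bar>" using t assms(1) by (simp add: abs_mult)
      finally show ?thesis using abs_Im_le_cmod[of ?z] by linarith
    qed
    moreover have "min 1 t0 * \<bar>of_int m\<bar> \<le> 1 * \<bar>of_int m\<bar>" "min 1 t0 * \<bar>of_int n\<bar> \<le> t0 * \<bar>of_int n\<bar>"
      by (rule mult_right_mono; simp)+
    ultimately have "c * ?s \<le> cmod ?z"
      unfolding c_def by (simp add: algebra_simps)
    then have "(c * ?s) ^ k \<le> cmod ?z ^ k"
      using c s by (intro power_mono) auto
    moreover have "c ^ k * ?s ^ 3 \<le> (c * ?s) ^ k"
      unfolding power_mult_distrib using c s assms(2) by (intro mult_left_mono power_increasing) auto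
    ultimately have "c ^ k * ?s ^ 3 \<le> cmod ?z ^ k" by linarith
    moreover have "c ^ k * ?s ^ 3 > 0" using c s by (intro mult_pos_pos zero_less_power) auto
    ultimately have "1 / cmod ?z ^ k \<le> 1 / (c ^ k * ?s ^ 3)"
      by (intro frac_le) auto
    then show "cmod (rect_term k x t)
        \<le> (1 / c ^ k) * (case x of (m::int, n::int) \<Rightarrow> 1 / (\<bar>of_int m\<bar> + \<bar>of_int n\<bar>) ^ 3)"
      by (simp add: mn norm_divide norm_power)
  qed
  then show ?thesis by (simp add: rect_sum_def[abs_def] split_def)
qed

lemma rect_term_nonzero:
  fixes m n :: int
  shows "t > 0 \<Longrightarrow> (m, n) \<noteq> (0, 0) \<Longrightarrow> of_int m + of_int n * (\<i> * of_real t) \<noteq> 0"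
  by (auto simp: complex_eq_iff)

lemma continuous_on_rect_sum:
  assumes "t0 > 0" "k \<ge> 3"
  shows "continuous_on {t0..} (rect_sum k)"
proof (rule uniform_limit_theorem[OF _ rect_sum_uniform_limit[OF assms]])
  show "\<forall>\<^sub>F X in nonzero_parts. continuous_on {t0..}
      (\<lambda>t. \<Sum>x\<in>X. rect_term k x t)"
  proof (rule eventually_finite_subsets_at_top_weakI)
    fix X :: "(int \<times> int) set" assume X: "X \<subseteq> UNIV - {(0, 0)}"
    show "continuous_on {t0..} (\<lambda>t. \<Sum>x\<in>X. rect_term k x t)"
    proof (intro continuous_intros ballI)
      fix x t assume "x \<in> X" "t \<in> {t0..}"
      then show "(of_int (fst x) + of_int (snd x) * (\<i> * complex_of_real t)) ^ k \<noteq> 0"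
        using rect_term_nonzero[of t "fst x" "snd x"] X assms(1) by (auto simp: subset_eq)
    qed
  qed
qed simp

text \<open>Uniform convergence on \<open>{1..}\<close> permits the interchange of limits. Every
  term with n \<noteq> 0 tends to 0, so only the row n = 0 survives.\<close>

lemma rect_sum_at_top:
  assumes "even k" "k \<ge> 3"
  shows "(rect_sum k \<longlongrightarrow> int_zeta k) at_top"
proof (rule swap_uniform_limit')
  let ?g = "\<lambda>x::int \<times> int. if snd x = 0 then 1 / of_int (fst x) ^ k else 0 :: complex"
  show "uniform_limit {1..}
    (\<lambda>X t. \<Sum>x\<in>X. rect_term k x t)
    (rect_sum k) nonzero_parts"
    by (rule rect_sum_uniform_limit) (use assms in auto)
  have "(?g has_sum int_zeta k) ((\<lambda>m. (m, 0)) ` (UNIV - {0}))"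
    using has_sum_int_zeta[OF assms(1)] int_zeta_eq[OF assms(1)] assms(2)
    by (subst has_sum_reindex) (auto simp: inj_on_def o_def)
  then have "(?g has_sum int_zeta k) (UNIV - {(0, 0)})"
    by (rule has_sum_cong_neutral[THEN iffD1, rotated -1]) (auto simp: image_iff)
  then show "((\<lambda>X. \<Sum>x\<in>X. ?g x) \<longlongrightarrow> int_zeta k) nonzero_parts"
    by (simp add: has_sum_def)
  show "\<forall>\<^sub>F X in nonzero_parts.
      ((\<lambda>t. \<Sum>x\<in>X. rect_term k x t) \<longlongrightarrow> (\<Sum>x\<in>X. ?g x)) at_top"
  proof (intro always_eventually allI tendsto_sum)
    fix x :: "int \<times> int"
    show "((\<lambda>t. rect_term k x t) \<longlongrightarrow> ?g x) at_top"
    proof (cases "snd x = 0")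
      case False
      have "filterlim (\<lambda>t. complex_of_real t) at_infinity at_top"
        by (simp add: filterlim_at_infinity_conv_norm_at_top filterlim_at_top_imp_at_infinity filterlim_abs_real)
      then have "filterlim (\<lambda>t. of_int (fst x) + of_int (snd x) * \<i> * complex_of_real t) at_infinity at_top"
        using False by (intro tendsto_add_filterlim_at_infinity[OF tendsto_const]
          tendsto_mult_filterlim_at_infinity[OF tendsto_const]) auto
      then have "filterlim (\<lambda>t. (of_int (fst x) + of_int (snd x) * \<i> * complex_of_real t) ^ k) at_infinity at_top"
        using assms(2) unfolding filterlim_at_infinity_conv_norm_at_top norm_power
        by (intro filterlim_pow_at_top) auto
      then have "((\<lambda>t. 1 / (of_int (fst x) + of_int (snd x) * \<i> * of_real t) ^ k) \<longlongrightarrow> 0) at_top"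
        by (rule tendsto_divide_0[OF tendsto_const])
      then show ?thesis using False by (simp add: mult.assoc)
    qed simp
  qed
qed (auto simp: eventually_ge_at_top)

text \<open>Multiplication by i / t exchanges the two generators up to sign. As the fourth power of
  this factor is positive and the sixth negative, \<open>g3\<close> changes sign and
  \<open>g2\<close> does not.\<close>

lemma rect_lattice_inverse:
  assumes "t > 0"
  shows "rect_lattice (1 / t) = (*) (\<i> / of_real t) ` rect_lattice t"
proof -
  have eq: "\<i> / of_real t * (of_int m + of_int n * (\<i> * of_real t)) = of_int (- n) + of_int m * (\<i> * of_real (1 / t))"
    for m n :: int
    using assms by (simp add: field_simps)
  show ?thesis
  proof (intro equalityI subsetI)
    fix z assume "z \<in> rect_lattice (1 / t)"
    then obtain m n :: int where "z = of_int m + of_int n * (\<i> * of_real (1 / t))"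
      unfolding rect_lattice_def by auto
    then have "z = \<i> / of_real t * (of_int n + of_int (- m) * (\<i> * of_real t))"
      unfolding eq by simp
    then show "z \<in> (*) (\<i> / of_real t) ` rect_lattice t" using rect_lattice_memI by blast
  next
    fix z assume "z \<in> (*) (\<i> / of_real t) ` rect_lattice t"
    then obtain m n :: int where "z = \<i> / of_real t * (of_int m + of_int n * (\<i> * of_real t))"
      unfolding rect_lattice_def by auto
    then show "z \<in> rect_lattice (1 / t)" unfolding eq using rect_lattice_memI by blast
  qed
qed

theorem lattice_with_real_invariants_exists:
  fixes p q :: real
  assumes p: "p > 0" and pq: "27 * q\<^sup>2 < p ^ 3"
  obtains L where "is_complex_lattice L" "lattice_g2 L = of_real p" "lattice_g3 L = of_real q"
proof -
  define g2 where "g2 t = Re (lattice_g2 (rect_lattice t))" for t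
  define g3 where "g3 t = Re (lattice_g3 (rect_lattice t))" for t
  have g2_sum: "g2 t = 60 * Re (rect_sum 4 t)" and g3_sum: "g3 t = 140 * Re (rect_sum 6 t)" if "t > 0" for t
    using rect_sum_eq[OF that] by (simp_all add: g2_def g3_def lattice_g2_def lattice_g3_def)
  \<comment> \<open>For g2 > 0 the equation \<open>E 1 t = 0\<close> says that g3 / g2^(3/2) equals
    q / p^(3/2), the quantity invariant under positive scaling. The modulus keeps \<open>E\<close>
    meaningful while the sign of \<open>g2\<close> is open; \<open>s = - 1\<close> stands for the
    problem with \<open>- q\<close>.\<close>
  define E where "E s t = g3 t * sqrt (p ^ 3) - s * q * sqrt (\<bar>g2 t\<bar> ^ 3)" for s t
  have cont: "continuous_on {t0..} (E s)" if "t0 > 0" for t0 s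
  proof -
    have "continuous_on {t0..} (\<lambda>t. 140 * Re (rect_sum 6 t) * sqrt (p ^ 3)
        - s * q * sqrt (\<bar>60 * Re (rect_sum 4 t)\<bar> ^ 3))"
      using that by (intro continuous_intros continuous_on_rect_sum) auto
    then show ?thesis
      by (rule continuous_on_eq) (use that in \<open>simp add: E_def g2_sum g3_sum\<close>)
  qed
  have lim: "\<forall>\<^sub>F t in at_top. E s t > 0" if s: "\<bar>s\<bar> = 1" for s
  proof -
    define Z4 Z6 where "Z4 = Re (int_zeta 4)" and "Z6 = Re (int_zeta 6)"
    \<comment> \<open>Eliminating \<open>int_zeta 2\<close> from the two relations shows 27 g3^2 =
      g2^3 for the limiting invariants 60 Z4 and 140 Z6. The strict inequality between
      \<open>27 * q\<^sup>2\<close> and \<open>p ^ 3\<close> then makes the limit of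
      \<open>E\<close> positive.\<close>
    have "49 * (int_zeta 6)\<^sup>2 = (7 * int_zeta 6)\<^sup>2" by (simp add: power_mult_distrib)
    also have "\<dots> = 4 * (int_zeta 2)\<^sup>2 * (int_zeta 4)\<^sup>2"
      by (simp add: int_zeta_relations(2) power_mult_distrib)
    also have "\<dots> = 20 * int_zeta 4 ^ 3"
      unfolding int_zeta_relations(1)[symmetric] by (simp add: power3_eq_cube power2_eq_square[of "int_zeta 4"])
    finally have "49 * (complex_of_real Z6)\<^sup>2 = 20 * of_real Z4 ^ 3"
      using int_zeta_pos(1)[of 4] int_zeta_pos(1)[of 6] by (simp add: Z4_def Z6_def)
    then have "complex_of_real (49 * Z6\<^sup>2) = of_real (20 * Z4 ^ 3)" by simp
    then have "49 * Z6\<^sup>2 = 20 * Z4 ^ 3" by (simp only: of_real_eq_iff)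
    then have Z6: "27 * (140 * Z6)\<^sup>2 = (60 * Z4) ^ 3" "Z6 > 0"
      using int_zeta_pos(2)[of 6] by (simp_all add: Z6_def power_mult_distrib)
    have Z4: "Z4 > 0" using int_zeta_pos(2)[of 4] by (simp add: Z4_def)
    have "((\<lambda>t. 140 * Re (rect_sum 6 t) * sqrt (p ^ 3) - s * q * sqrt (\<bar>60 * Re (rect_sum 4 t)\<bar> ^ 3))
        \<longlongrightarrow> 140 * Z6 * sqrt (p ^ 3) - s * q * sqrt (\<bar>60 * Z4\<bar> ^ 3)) at_top"
      unfolding Z4_def Z6_def by (intro tendsto_intros rect_sum_at_top) auto
    moreover have "sqrt (\<bar>60 * Z4\<bar> ^ 3) = sqrt 27 * (140 * Z6)"
    proof -
      have "\<bar>60 * Z4\<bar> = 60 * Z4" using Z4 by simp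
      then have "\<bar>60 * Z4\<bar> ^ 3 = 27 * (140 * Z6)\<^sup>2" by (simp only: Z6(1))
      then show ?thesis using Z6(2) by (simp only: real_sqrt_mult real_sqrt_abs)
    qed
    moreover have "s * q * sqrt 27 < sqrt (p ^ 3)"
    proof -
      have "(s * q * sqrt 27)\<^sup>2 < p ^ 3"
        using pq s by (simp add: power_mult_distrib power2_eq_1_iff abs_eq_iff) (auto simp: abs_if split: if_splits)
      then show ?thesis by (rule real_less_rsqrt)
    qed
    then have "140 * Z6 * (sqrt (p ^ 3) - s * q * sqrt 27) > 0" using Z6(2) by simp
    ultimately have "\<forall>\<^sub>F t in at_top. 140 * Re (rect_sum 6 t) * sqrt (p ^ 3)
        - s * q * sqrt (\<bar>60 * Re (rect_sum 4 t)\<bar> ^ 3) > 0"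
      by (intro order_tendstoD(1)[where a = 0]) (auto simp: algebra_simps)
    then show ?thesis
      using eventually_gt_at_top[of 0] by eventually_elim (simp add: E_def g2_sum g3_sum)
  qed
  obtain T where T: "T \<ge> 1" "E 1 T > 0" "E (- 1) T > 0"
    using eventually_happens[OF eventually_conj[OF eventually_ge_at_top[of 1] eventually_conj[OF lim[of 1] lim[of "- 1"]]]]
    by auto
  have inv: "lattice_g2 (rect_lattice (1 / T)) = lattice_g2 (rect_lattice T) * of_real (T ^ 4)"
      "lattice_g3 (rect_lattice (1 / T)) = - (lattice_g3 (rect_lattice T) * of_real (T ^ 6))"
    using scaled_lattice(2,3)[of "rect_lattice T" "\<i> / of_real T"] T(1) is_complex_lattice_rect[of T]
    by (simp_all add: rect_lattice_inverse power_divide eval_nat_numeral)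
  have "g2 (1 / T) = g2 T * T ^ 4" "g3 (1 / T) = - (g3 T * T ^ 6)"
    unfolding g2_def g3_def inv by simp_all
  moreover have "sqrt (\<bar>g2 T * T ^ 4\<bar> ^ 3) = sqrt (\<bar>g2 T\<bar> ^ 3) * T ^ 6"
  proof -
    have eq: "\<bar>g2 T * T ^ 4\<bar> ^ 3 = \<bar>g2 T\<bar> ^ 3 * (T ^ 6)\<^sup>2"
      by (simp add: abs_mult power_mult_distrib power_abs flip: power_mult)
    show ?thesis unfolding eq real_sqrt_mult real_sqrt_abs using T(1) by simp
  qed
  \<comment> \<open>The sign change of \<open>g3\<close> turns the problem for \<open>q\<close> at 1
    / T into the one for \<open>- q\<close> at T; hence positivity was arranged for both
    signs.\<close>
  ultimately have "E 1 (1 / T) = - (T ^ 6 * E (- 1) T)"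
    by (simp add: E_def algebra_simps)
  then have E1: "E 1 (1 / T) \<le> 0" using T by simp
  have "\<exists>t\<ge>1 / T. t \<le> T \<and> E 1 t = 0"
  proof (rule IVT')
    show "1 / T \<le> T" using T(1) by (simp add: divide_le_eq) (metis mult_mono' mult_1 zero_le_one order_trans)
    show "continuous_on {1 / T..T} (E 1)"
      using cont[of "1 / T" 1] T(1) by (auto intro: continuous_on_subset)
  qed (use T E1 in auto)
  then obtain t where t: "t > 0" "E 1 t = 0"
    using T(1) by (meson divide_pos_pos less_le_trans zero_less_one)
  have tE: "g3 t * sqrt (p ^ 3) = q * sqrt (\<bar>g2 t\<bar> ^ 3)" using t(2) by (simp add: E_def)
  have real: "lattice_g2 (rect_lattice t) = of_real (g2 t)" "lattice_g3 (rect_lattice t) = of_real (g3 t)"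
    using real_lattice.invariants_real[OF real_lattice_rect[OF t(1)]] by (simp_all add: g2_def g3_def)
  have "g2 t \<noteq> 0"
  proof
    assume "g2 t = 0"
    then have "g3 t = 0" using tE p by simp
    with \<open>g2 t = 0\<close> show False using rect_lattice_invariants_nonzero[OF t(1)] real by simp
  qed
  then have g2: "g2 t > 0" using rect_lattice_g2_nonneg[OF t(1)] by (simp add: g2_def)
  \<comment> \<open>The fourth root adjusts \<open>g2\<close> to \<open>p\<close>; since
    \<open>E 1 t = 0\<close>, the same factor adjusts \<open>g3\<close> to \<open>q\<close>.\<close>
  define c where "c = root 4 (g2 t / p)"
  have c: "c > 0" using g2 p by (simp add: c_def)
  have c4: "c ^ 4 = g2 t / p" using g2 p by (simp add: c_def)
  have c6: "c ^ 6 = sqrt ((g2 t / p) ^ 3)"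
  proof -
    have eq: "(g2 t / p) ^ 3 = (c ^ 6)\<^sup>2" by (simp flip: c4 power_mult)
    show ?thesis unfolding eq real_sqrt_abs using c by simp
  qed
  have "g3 t / c ^ 6 = g3 t * sqrt (p ^ 3) / sqrt (g2 t ^ 3)"
    unfolding c6 by (simp add: power_divide real_sqrt_divide)
  also have "\<dots> = q" using tE g2 by simp
  finally have 3: "g3 t / c ^ 6 = q" .
  have 2: "g2 t / c ^ 4 = p" using c4 g2 p by simp
  show ?thesis
  proof (rule that)
    have c0: "complex_of_real c \<noteq> 0" using c by simp
    note sc = scaled_lattice[OF is_complex_lattice_rect[OF t(1)] c0]
    show "is_complex_lattice ((*) (of_real c) ` rect_lattice t)" by (rule sc(1))
    show "lattice_g2 ((*) (of_real c) ` rect_lattice t) = of_real p"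
      unfolding sc(2) real using 2 by (metis of_real_divide of_real_power)
    show "lattice_g3 ((*) (of_real c) ` rect_lattice t) = of_real q"
      unfolding sc(3) real using 3 by (metis of_real_divide of_real_power)
  qed
qed

section \<open>The conformal scale function on a real lattice\<close>

text \<open>\<open>M\<close> is the positive zero of \<open>P\<close> and will be the maximal value
  of the scale function; \<open>root\<close> is \<open>P M = 0\<close> with the factor
  \<open>M\<close> removed.\<close>

locale critical_parameters =
  fixes a H M :: real
  assumes a_pos: "a > 0" and H_pos: "H > 0" and M_pos: "M > 0"
    and root: "H + M - a / 3 * M ^ 3 = 0"
begin

definition P :: "real \<Rightarrow> real" where "P y = H * y + y\<^sup>2 - a / 3 * y ^ 4"
text \<open>Half the derivative of \<open>P\<close>, the right-hand side of the second order
  equation.\<close>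

definition q :: "real \<Rightarrow> real" where "q y = H / 2 + y - 2 * a / 3 * y ^ 3"

lemma P_factor: "P y = y * (M - y) * (a / 3 * (M\<^sup>2 + M * y + y\<^sup>2) - 1)"
proof -
  have H: "H = a / 3 * M ^ 3 - M" using root by simp
  have "y * (M - y) * (a / 3 * (M\<^sup>2 + M * y + y\<^sup>2) - 1) = (a / 3 * M ^ 3 - M) * y + y\<^sup>2 - a / 3 * y ^ 4"
    by (simp add: field_simps eval_nat_numeral)
  then show ?thesis unfolding P_def using H by simp
qed

text \<open>The relation \<open>root\<close> reads M (a M^2 / 3 - 1) = H > 0, so the factor is
  positive at y = 0, and it increases with y. Hence on y >= 0 the sign of \<open>P\<close> is that
  of y (M - y).\<close>

lemma P_factor_pos:
  assumes "y \<ge> 0"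
  shows "a / 3 * (M\<^sup>2 + M * y + y\<^sup>2) - 1 > 0"
proof -
  have "M * (a / 3 * M\<^sup>2 - 1) = H" using root by (simp add: algebra_simps eval_nat_numeral)
  then have "M * (a / 3 * M\<^sup>2 - 1) > 0" using H_pos by simp
  then have "a / 3 * M\<^sup>2 - 1 > 0" using M_pos by (simp add: zero_less_mult_iff)
  moreover have "a / 3 * M\<^sup>2 \<le> a / 3 * (M\<^sup>2 + M * y + y\<^sup>2)"
    using a_pos M_pos assms by (intro mult_left_mono) auto
  ultimately show ?thesis by linarith
qed

lemma P_nonneg_imp_le: "y \<ge> 0 \<Longrightarrow> P y \<ge> 0 \<Longrightarrow> y \<le> M"
  using P_factor_pos[of y] M_pos unfolding P_factor
  by (smt (verit) mult_neg_pos mult_pos_neg zero_le_mult_iff)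

lemma P_eq_0_imp: "y \<ge> 0 \<Longrightarrow> P y = 0 \<Longrightarrow> y = 0 \<or> y = M"
  using P_factor_pos[of y] unfolding P_factor by auto

lemma P_0: "P 0 = 0" by (simp add: P_def)

lemma q_lipschitz:
  assumes "0 \<le> x" "x \<le> M" "0 \<le> y" "y \<le> M"
  shows "\<bar>q x - q y\<bar> \<le> (1 + 2 * a * M\<^sup>2) * \<bar>x - y\<bar>"
proof -
  have eq: "q x - q y = (1 - 2 * a / 3 * (x\<^sup>2 + x * y + y\<^sup>2)) * (x - y)"
    by (simp add: q_def field_simps eval_nat_numeral)
  have "x\<^sup>2 \<le> M\<^sup>2" "y\<^sup>2 \<le> M\<^sup>2" "x * y \<le> M\<^sup>2"
    using assms by (auto intro!: power_mono mult_mono simp: power2_eq_square)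
  then have "2 * a / 3 * (x\<^sup>2 + x * y + y\<^sup>2) \<le> 2 * a / 3 * (3 * M\<^sup>2)"
    using a_pos by (intro mult_left_mono) auto
  moreover have "0 \<le> 2 * a / 3 * (x\<^sup>2 + x * y + y\<^sup>2)" using a_pos assms by simp
  ultimately have "\<bar>1 - 2 * a / 3 * (x\<^sup>2 + x * y + y\<^sup>2)\<bar> \<le> 1 + 2 * a * M\<^sup>2" by simp
  then show ?thesis unfolding eq abs_mult by (rule mult_right_mono) simp
qed

text \<open>Zeros of \<open>S\<close> are isolated: between two of them near \<open>x0\<close> there
  would be an interior maximum with value strictly between 0 and \<open>M\<close>, where
  \<open>P\<close> has no zero. So \<open>S\<close> is positive around \<open>x0\<close> apart from
  \<open>x0\<close> itself, and L'Hopital's rule finds the derivative of S' there. The abstract form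
  serves both the given scale function and the elliptic model.\<close>

lemma second_order_at_zeros:
  fixes S :: "real \<Rightarrow> real"
  assumes J: "open J"
    and nonneg: "\<And>x. x \<in> J \<Longrightarrow> S x \<ge> 0"
    and diff: "\<And>x. x \<in> J \<Longrightarrow> (S has_real_derivative deriv S x) (at x)"
    and first: "\<And>x. x \<in> J \<Longrightarrow> (deriv S x)\<^sup>2 = P (S x)"
    and second: "\<And>x. x \<in> J \<Longrightarrow> S x > 0 \<Longrightarrow> (deriv S has_real_derivative q (S x)) (at x)"
    and zeros: "\<And>x y. x < y \<Longrightarrow> {x..y} \<subseteq> J \<Longrightarrow> \<exists>z\<in>{x..y}. S z > 0"
    and x0: "x0 \<in> J"
  shows "(deriv S has_real_derivative q (S x0)) (at x0)"
proof (cases "S x0 > 0")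
  case True
  then show ?thesis using second x0 by blast
next
  case False
  then have S0: "S x0 = 0" using nonneg[OF x0] by simp
  have cont: "isCont S x" if "x \<in> J" for x using diff[OF that] by (rule DERIV_isCont)
  have "(S \<longlongrightarrow> 0) (at x0)" using cont[OF x0] by (simp add: isCont_def S0)
  have "\<forall>\<^sub>F x in nhds x0. S x < M \<and> x \<in> J"
  proof (intro eventually_conj)
    have "(S \<longlongrightarrow> S x0) (nhds x0)" using cont[OF x0] by (simp add: continuous_at tendsto_nhds_iff isCont_def)
    then show "\<forall>\<^sub>F x in nhds x0. S x < M" using S0 M_pos by (intro order_tendstoD(2)) auto
    show "\<forall>\<^sub>F x in nhds x0. x \<in> J" using J x0 by (rule eventually_nhds_in_open)
  qed
  then obtain d where d: "d > 0" "\<And>x. dist x x0 < d \<Longrightarrow> S x < M \<and> x \<in> J"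
    by (auto simp: eventually_nhds_metric)
  have seg: False if xy: "x < y" "S x = 0" "S y = 0" "dist x x0 < d" "dist y x0 < d" for x y
  proof -
    have sub: "dist z x0 < d" if "z \<in> {x..y}" for z
      using that xy by (auto simp: dist_real_def)
    have "continuous_on {x..y} S"
      using sub d(2) cont by (intro continuous_at_imp_continuous_on) blast
    then obtain m where m: "m \<in> {x..y}" "\<And>z. z \<in> {x..y} \<Longrightarrow> S z \<le> S m"
      using continuous_attains_sup[of "{x..y}" S] xy(1) by auto
    obtain z where "z \<in> {x..y}" "S z > 0" using zeros[OF xy(1)] sub d(2) by blast
    then have Sm: "S m > 0" using m(2)[of z] by simp
    then have "x < m" "m < y" using m(1) xy by (auto simp: less_le)
    have mJ: "m \<in> J" "S m < M" using d(2) sub m(1) by blast+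
    have "deriv S m = 0"
    proof (rule DERIV_local_max[OF diff[OF mJ(1)], of "min (m - x) (y - m)"])
      show "\<forall>z. \<bar>m - z\<bar> < min (m - x) (y - m) \<longrightarrow> S z \<le> S m"
        using m(2) by (auto simp: abs_if split: if_splits)
    qed (use \<open>x < m\<close> \<open>m < y\<close> in auto)
    then have "P (S m) = 0" using first[OF mJ(1)] by simp
    then show False using P_eq_0_imp[of "S m"] Sm mJ(2) by simp
  qed
  have pos: "S x > 0" if "dist x x0 < d" "x \<noteq> x0" for x
  proof (rule ccontr)
    assume "\<not> S x > 0"
    then have "S x = 0" using nonneg[of x] d(2)[OF that(1)] by simp
    then show False
      using seg[of x x0] seg[of x0 x] S0 that d(1) by (cases "x < x0") auto
  qed
  have ev: "\<forall>\<^sub>F x in at x0. dist x x0 < d \<and> x \<noteq> x0"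
    using d(1) by (auto simp: eventually_at intro!: exI[of _ d])
  have v0: "deriv S x0 = 0" using first[OF x0] by (simp add: S0 P_0)
  have "((\<lambda>x. P (S x)) \<longlongrightarrow> P 0) (at x0)"
    unfolding P_def using \<open>(S \<longlongrightarrow> 0) (at x0)\<close> by (intro tendsto_intros)
  then have "((\<lambda>x. (deriv S x)\<^sup>2) \<longlongrightarrow> 0) (at x0)"
    unfolding P_0 by (rule Lim_transform_eventually)
      (use ev in eventually_elim, use d(2) first in auto)
  then have "((\<lambda>x. sqrt ((deriv S x)\<^sup>2)) \<longlongrightarrow> sqrt 0) (at x0)" by (rule tendsto_real_sqrt)
  then have v_lim: "(deriv S \<longlongrightarrow> 0) (at x0)"
    by (simp add: tendsto_rabs_zero_iff)
  have q_lim: "((\<lambda>x. q (S x)) \<longlongrightarrow> q 0) (at x0)"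
    unfolding q_def using \<open>(S \<longlongrightarrow> 0) (at x0)\<close> by (intro tendsto_intros)
  have "((\<lambda>x. deriv S x / (x - x0)) \<longlongrightarrow> q 0) (at x0)"
  proof (rule lhopital[where f' = "\<lambda>x. q (S x)" and g' = "\<lambda>x. 1"])
    show "((\<lambda>x. x - x0) \<longlongrightarrow> 0) (at x0)" by (auto intro!: tendsto_eq_intros)
    show "\<forall>\<^sub>F x in at x0. x - x0 \<noteq> 0" using ev by eventually_elim simp
    show "\<forall>\<^sub>F x in at x0. (deriv S has_real_derivative q (S x)) (at x)"
      using ev by eventually_elim (use second pos d(2) in blast)
    show "\<forall>\<^sub>F x in at x0. ((\<lambda>x. x - x0) has_real_derivative 1) (at x)"
      by (intro always_eventually allI) (auto intro!: derivative_eq_intros)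
  qed (use v_lim q_lim in auto)
  then show ?thesis by (simp add: has_field_derivative_iff v0 S0)
qed

text \<open>The cubic \<open>q\<close> is Lipschitz only on bounded sets, so both solutions are
  required to stay in [0, M].\<close>

lemma eq_of_second_order:
  assumes J: "is_interval J" and x: "x \<in> J" and x0: "x0 \<in> J"
    and S: "\<And>x. x \<in> J \<Longrightarrow> (S has_real_derivative S' x) (at x)"
      "\<And>x. x \<in> J \<Longrightarrow> (S' has_real_derivative q (S x)) (at x)"
      "\<And>x. x \<in> J \<Longrightarrow> 0 \<le> S x \<and> S x \<le> M"
    and F: "\<And>x. x \<in> J \<Longrightarrow> (F has_real_derivative F' x) (at x)"
      "\<And>x. x \<in> J \<Longrightarrow> (F' has_real_derivative q (F x)) (at x)"
      "\<And>x. x \<in> J \<Longrightarrow> 0 \<le> F x \<and> F x \<le> M"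
    and init: "S x0 = F x0" "S' x0 = F' x0"
  shows "S x = F x"
proof -
  have sub: "y \<in> J" if "y \<in> {min x x0..max x x0}" for y
    using J x x0 that unfolding is_interval_1 by (metis atLeastAtMost_iff max_def min_def)
  have "S x - F x = 0"
  proof (rule second_order_ode_zero[of "min x x0" "max x x0" "\<lambda>x. S x - F x" "\<lambda>x. S' x - F' x"
        "\<lambda>x. q (S x) - q (F x)" "1 + 2 * a * M\<^sup>2" x0 x])
    fix y assume "y \<in> {min x x0..max x x0}"
    then have y: "y \<in> J" by (rule sub)
    show "((\<lambda>x. S x - F x) has_real_derivative S' y - F' y) (at y)"
      using S(1)[OF y] F(1)[OF y] by (rule DERIV_diff)
    show "((\<lambda>x. S' x - F' x) has_real_derivative q (S y) - q (F y)) (at y)"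
      using S(2)[OF y] F(2)[OF y] by (rule DERIV_diff)
    show "\<bar>q (S y) - q (F y)\<bar> \<le> (1 + 2 * a * M\<^sup>2) * \<bar>S y - F y\<bar>"
      using S(3)[OF y] F(3)[OF y] by (intro q_lipschitz) auto
  qed (use init in auto)
  then show ?thesis by simp
qed

end

section \<open>The real periods of a real lattice\<close>

context real_lattice
begin

text \<open>Some basis vector w is not purely imaginary, since otherwise w2 / w1 would be real; then
  w + cnj w is a nonzero real lattice point. Local finiteness gives a least positive one, and
  division with remainder shows that it generates the others.\<close>

lemma real_period:
  obtains \<rho> where "\<rho> > 0" "\<And>x. of_real x \<in> L \<longleftrightarrow> (\<exists>k::int. x = of_int k * \<rho>)"
proof -
  obtain w1 w2 where w: "w1 \<noteq> 0" "Im (w2 / w1) \<noteq> 0"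
    and L: "L = {of_int m * w1 + of_int n * w2 | m n. True}"
    by (rule basis)
  have "of_int 1 * w1 + of_int 0 * w2 \<in> L" "of_int 0 * w1 + of_int 1 * w2 \<in> L"
    unfolding L by blast+
  then have mem: "w1 \<in> L" "w2 \<in> L" by simp_all
  have "Re w1 \<noteq> 0 \<or> Re w2 \<noteq> 0"
  proof (rule ccontr)
    assume "\<not> (Re w1 \<noteq> 0 \<or> Re w2 \<noteq> 0)"
    then have "Im (w2 / w1) = 0" by (simp add: Im_divide)
    then show False using w(2) by simp
  qed
  then obtain w where w: "w \<in> L" "Re w \<noteq> 0" using mem by blast
  define r where "r = 2 * \<bar>Re w\<bar>"
  have "w + cnj w = of_real (2 * Re w)" by (simp add: complex_eq_iff)
  then have "of_real (2 * Re w) \<in> L" using w(1) add_mem cnj_mem by metis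
  then have "of_real r \<in> L" using uminus_mem[of "of_real (2 * Re w)"]
    by (cases "Re w \<ge> 0") (simp_all add: r_def)
  define A where "A = {x \<in> {0<..r}. complex_of_real x \<in> L}"
  have "inj_on complex_of_real A" by (simp add: inj_on_def)
  moreover have "complex_of_real ` A \<subseteq> L \<inter> cball 0 r" by (auto simp: A_def)
  then have "finite (complex_of_real ` A)" using finite_Int_cball finite_subset by blast
  ultimately have fin: "finite A" by (simp add: finite_image_iff)
  have rA: "r \<in> A" using \<open>of_real r \<in> L\<close> w(2) by (simp add: A_def r_def)
  define \<rho> where "\<rho> = Min A"
  have "\<rho> \<in> A" unfolding \<rho>_def using fin rA by (intro Min_in) auto
  then have \<rho>: "\<rho> > 0" "of_real \<rho> \<in> L" by (auto simp: A_def)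
  have min: "\<rho> \<le> x" if "x > 0" "of_real x \<in> L" for x
  proof (cases "x \<le> r")
    case True
    then have "x \<in> A" using that by (simp add: A_def)
    then show ?thesis unfolding \<rho>_def using fin by simp
  next
    case False
    have "\<rho> \<le> r" unfolding \<rho>_def using fin rA by simp
    then show ?thesis using False by simp
  qed
  have mult: "of_real (of_int k * \<rho>) \<in> L" for k :: int
  proof (induction k rule: int_induct[where k = 0])
    case base
    show ?case using zero_mem by simp
  next
    case (step1 i)
    have "complex_of_real (of_int (i + 1) * \<rho>) = of_real (of_int i * \<rho>) + of_real \<rho>"
      by (simp add: distrib_right)
    then show ?case using add_mem[OF step1(2) \<rho>(2)] by (simp only:)
  next
    case (step2 i)
    have "complex_of_real (of_int (i - 1) * \<rho>) = of_real (of_int i * \<rho>) - of_real \<rho>"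
      by (simp add: left_diff_distrib)
    then show ?case using diff_mem[OF step2(2) \<rho>(2)] by (simp only:)
  qed
  have "of_real x \<in> L \<longleftrightarrow> (\<exists>k::int. x = of_int k * \<rho>)" for x
  proof
    assume x: "of_real x \<in> L"
    define k where "k = \<lfloor>x / \<rho>\<rfloor>"
    have "of_real (x - of_int k * \<rho>) \<in> L" using diff_mem[OF x mult[of k]] by simp
    moreover have "0 \<le> x - of_int k * \<rho>" "x - of_int k * \<rho> < \<rho>"
      using \<rho>(1) floor_divide_lower[of \<rho> x] floor_divide_upper[of \<rho> x] by (simp_all add: k_def algebra_simps)
    ultimately have "x - of_int k * \<rho> = 0" using min[of "x - of_int k * \<rho>"] by (cases "x - of_int k * \<rho> = 0") auto
    then show "\<exists>k::int. x = of_int k * \<rho>" by (intro exI[of _ k]) simp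
  qed (use mult in auto)
  then show ?thesis using that \<rho>(1) by blast
qed

lemma real_period_representative:
  assumes "\<rho> > 0" "\<And>x. of_real x \<in> L \<longleftrightarrow> (\<exists>k::int. x = of_int k * \<rho>)"
  obtains p where "of_real p \<in> L" "0 \<le> x + p" "x + p < \<rho>"
proof
  show "of_real (- (of_int \<lfloor>x / \<rho>\<rfloor> * \<rho>)) \<in> L"
    unfolding assms(2) by (intro exI[of _ "- \<lfloor>x / \<rho>\<rfloor>"]) simp
  show "0 \<le> x + - (of_int \<lfloor>x / \<rho>\<rfloor> * \<rho>)" "x + - (of_int \<lfloor>x / \<rho>\<rfloor> * \<rho>) < \<rho>"
    using assms(1) floor_divide_lower[of \<rho> x] floor_divide_upper[of \<rho> x] by (simp_all add: algebra_simps)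
qed

end

section \<open>The periodic model solution on the real axis\<close>

locale critical_lattice = critical_parameters + real_lattice +
  assumes g2_eq: "Re (lattice_g2 L) = 1 / 12" and g3_eq: "Re (lattice_g3 L) = (a * H\<^sup>2 - 2 / 9) / 48"
begin

text \<open>In this variable the Weierstrass equation becomes 3 X'^2 = X^3 + 3 X^2 - 9 a H^2, and
  the linear term disappears.\<close>

definition X :: "real \<Rightarrow> real" where "X x = 12 * Re (wp (of_real x)) - 1"
definition X' :: "real \<Rightarrow> real" where "X' x = 12 * Re (deriv wp (of_real x))"
definition F :: "real \<Rightarrow> real" where "F x = (if of_real x \<in> L then 0 else 3 * H / X x)"

lemma X_has_derivative: "of_real x \<notin> L \<Longrightarrow> (X has_real_derivative X' x) (at x)"
  unfolding X_def X'_def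
  using DERIV_diff[OF DERIV_cmult[OF real_wp_has_derivative, of x 12] DERIV_const[of 1]] by simp

lemma X'_has_derivative:
  assumes "of_real x \<notin> L"
  shows "(X' has_real_derivative ((X x)\<^sup>2 + 2 * X x) / 2) (at x)"
proof -
  have eq: "12 * (6 * (Re (wp (of_real x)))\<^sup>2 - Re (lattice_g2 L) / 2) = ((X x)\<^sup>2 + 2 * X x) / 2"
    by (simp add: X_def g2_eq field_simps power2_eq_square)
  show ?thesis
    unfolding X'_def eq[symmetric] by (rule DERIV_cmult[OF real_wp_second_derivative[OF assms]])
qed

lemma X'_square:
  assumes "of_real x \<notin> L"
  shows "3 * (X' x)\<^sup>2 = X x ^ 3 + 3 * (X x)\<^sup>2 - 9 * a * H\<^sup>2"
  using real_wp_first_order[OF assms]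
  by (simp add: X_def X'_def g2_eq g3_eq power_mult_distrib) (simp add: field_simps eval_nat_numeral)

text \<open>Says that 3 H / M, the value of \<open>X\<close> belonging to F = M, is a zero of the
  cubic for X'^2.\<close>

lemma a_eq: "9 * a * H\<^sup>2 = (3 * H / M) ^ 3 + 3 * (3 * H / M)\<^sup>2"
proof -
  have "a * M ^ 3 = 3 * H + 3 * M" using root by simp
  then have "a = (3 * H + 3 * M) / M ^ 3" using M_pos by (simp add: field_simps)
  then show ?thesis using M_pos by (subst \<open>a = _\<close>) (simp add: field_simps eval_nat_numeral)
qed

lemma tendsto_wp_regular_real: "((\<lambda>x. wp_regular (of_real x)) \<longlongrightarrow> 0) (at (0::real))"
proof -
  have "isCont wp_regular (complex_of_real 0)"
    using wp_regular_has_field_derivative[of 0] DERIV_isCont by fastforce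
  then have "isCont (\<lambda>x. wp_regular (complex_of_real x)) 0"
    by (intro isCont_o2[of 0 complex_of_real wp_regular] continuous_intros)
  then show ?thesis by (simp add: isCont_def wp_regular_0)
qed

lemma X_at_0: "filterlim X at_top (at 0)"
proof -
  have "((\<lambda>x. 12 * Re (wp_regular (of_real x)) - 1) \<longlongrightarrow> 12 * Re 0 - 1) (at (0::real))"
    by (intro tendsto_intros tendsto_wp_regular_real)
  moreover have "filterlim (\<lambda>x::real. 12 / x\<^sup>2) at_top (at 0)"
  proof -
    have "filterlim (\<lambda>x::real. inverse (x\<^sup>2)) at_top (at 0)"
      by (rule filterlim_inverse_at_top) (auto simp: eventually_at_filter intro!: tendsto_eq_intros)
    then have "filterlim (\<lambda>x::real. 12 * inverse (x\<^sup>2)) at_top (at 0)"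
      by (intro filterlim_tendsto_pos_mult_at_top[OF tendsto_const]) auto
    then show ?thesis by (simp add: divide_inverse)
  qed
  ultimately have "filterlim (\<lambda>x. (12 * Re (wp_regular (of_real x)) - 1) + 12 / x\<^sup>2) at_top (at (0::real))"
    by (rule filterlim_tendsto_add_at_top)
  moreover have "X = (\<lambda>x. (12 * Re (wp_regular (of_real x)) - 1) + 12 / x\<^sup>2)"
    by (rule ext) (simp add: X_def wp_eq flip: of_real_power)
  ultimately show ?thesis by simp
qed

lemma X_periodic: "of_real p \<in> L \<Longrightarrow> of_real x \<notin> L \<Longrightarrow> X (x + p) = X x"
  by (simp add: X_def wp_add)

text \<open>The cubic must be nonnegative along \<open>X\<close>, which for positive values means X
  >= m but may also permit negative ones. Those are excluded by continuity: \<open>X\<close> comes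
  down from + infinity at the pole, so it would pass through 0, where the cubic is negative.\<close>

lemma X_ge:
  assumes "of_real x \<notin> L"
  shows "X x \<ge> 3 * H / M"
proof (rule ccontr)
  assume less: "\<not> X x \<ge> 3 * H / M"
  obtain \<rho> where \<rho>: "\<rho> > 0" "\<And>x. of_real x \<in> L \<longleftrightarrow> (\<exists>k::int. x = of_int k * \<rho>)"
    using real_period by blast
  define m where "m = 3 * H / M"
  have m: "m > 0" using H_pos M_pos by (simp add: m_def)
  have cubic: "X y ^ 3 + 3 * (X y)\<^sup>2 \<ge> m ^ 3 + 3 * m\<^sup>2" if "of_real y \<notin> L" for y
    using X'_square[OF that] a_eq zero_le_power2[of "X' y"] unfolding m_def by linarith
  have neg: "X x < 0"
  proof (rule ccontr)
    assume "\<not> X x < 0"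
    then have "X x ^ 3 < m ^ 3" "(X x)\<^sup>2 < m\<^sup>2"
      using less by (auto intro!: power_strict_mono simp: m_def)
    then show False using cubic[OF assms] by simp
  qed
  obtain p where p: "of_real p \<in> L" "0 \<le> x + p" "x + p < \<rho>"
    using real_period_representative[OF \<rho>] by blast
  define y where "y = x + p"
  have Xy: "X y = X x" unfolding y_def by (rule X_periodic[OF p(1) assms])
  have y_notin: "of_real y \<notin> L" using assms p(1) by (simp add: y_def add_mem_iff)
  have "0 \<le> y" "y < \<rho>" using p by (simp_all add: y_def)
  moreover have "y \<noteq> 0" using y_notin zero_mem by auto
  ultimately have y: "0 < y" "y < \<rho>" by auto
  have notin: "of_real z \<notin> L" if "0 < z" "z < \<rho>" for z
  proof
    assume "of_real z \<in> L"
    then obtain k :: int where k: "z = of_int k * \<rho>" using \<rho>(2) by blast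
    then have "0 < k" "of_int k * \<rho> < 1 * \<rho>" using that \<rho>(1) by (simp_all add: zero_less_mult_iff)
    then have "0 < k" "real_of_int k < 1" using \<rho>(1) by (simp_all only: mult_less_cancel_right)
    then show False by simp
  qed
  have "filterlim X at_top (at_right 0)"
    using X_at_0 by (rule filterlim_mono) (auto simp: at_le)
  then have "\<forall>\<^sub>F z in at_right 0. X z > 0" by (simp add: filterlim_at_top_dense)
  moreover have "\<forall>\<^sub>F z in at_right 0. z \<in> {0<..<y}" using y(1) by (rule eventually_at_right_real)
  ultimately have "\<forall>\<^sub>F z in at_right 0. X z > 0 \<and> z \<in> {0<..<y}" by (rule eventually_conj)
  then obtain z where z: "X z > 0" "z \<in> {0<..<y}"
    using eventually_happens'[OF trivial_limit_at_right_real] by blast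
  have "\<exists>w\<ge>z. w \<le> y \<and> X w = 0"
  proof (rule IVT2')
    show "continuous_on {z..y} X"
    proof (intro DERIV_continuous_on)
      fix w assume "w \<in> {z..y}"
      then have w: "0 < w" "w < \<rho>" using z(2) y(2) by auto
      show "(X has_real_derivative X' w) (at w within {z..y})"
        by (rule has_field_derivative_at_within[OF X_has_derivative[OF notin[OF w]]])
    qed
  qed (use z neg Xy in auto)
  then obtain w where w: "z \<le> w" "w \<le> y" "X w = 0" by blast
  have "m ^ 3 + 3 * m\<^sup>2 \<le> 0" using cubic[OF notin[of w]] w z y by simp
  moreover have "m ^ 3 + 3 * m\<^sup>2 > 0" using m by (intro add_pos_pos) auto
  ultimately show False by simp
qed

lemma X_pos: "of_real x \<notin> L \<Longrightarrow> X x > 0"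
  using X_ge[of x] H_pos M_pos by (smt (verit) divide_pos_pos)

lemma F_pos_iff: "F x > 0 \<longleftrightarrow> of_real x \<notin> L"
  using X_pos[of x] H_pos by (simp add: F_def)

lemma F_nonneg: "F x \<ge> 0"
  using X_pos[of x] H_pos by (simp add: F_def less_imp_le)

lemma F_le: "F x \<le> M"
proof (cases "of_real x \<in> L")
  case False
  have "3 * H \<le> M * X x" using X_ge[OF False] M_pos by (simp add: divide_le_eq mult.commute)
  then show ?thesis using X_pos[OF False] False by (simp add: F_def divide_le_eq mult.commute)
qed (use M_pos in \<open>simp add: F_def\<close>)

lemma F_periodic: "of_real p \<in> L \<Longrightarrow> F (x + p) = F x"
  by (simp add: F_def X_periodic add_mem_iff)

lemma F_minus: "F (- x) = F x"
  by (simp add: F_def X_def wp_minus uminus_mem_iff)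

lemma open_real_notin: "open {x. complex_of_real x \<notin> L}"
proof -
  have "{x. complex_of_real x \<notin> L} = complex_of_real -` (- L)" by auto
  then show ?thesis using open_Compl by (auto intro!: open_vimage continuous_intros)
qed

lemma F_has_derivative_pos:
  assumes "of_real x \<notin> L"
  shows "(F has_real_derivative - 3 * H * X' x / (X x)\<^sup>2) (at x)"
proof (rule has_field_derivative_transform_within_open[OF _ open_real_notin])
  show "((\<lambda>x. 3 * H / X x) has_real_derivative - 3 * H * X' x / (X x)\<^sup>2) (at x)"
    using X_pos[OF assms]
    by (auto intro!: derivative_eq_intros X_has_derivative assms simp: power2_eq_square)
qed (use assms in \<open>auto simp: F_def\<close>)

text \<open>At 0 the pole of order two makes F h / h equal to 3 H h / (12 + h^2 (...)), which tends
  to 0. The other lattice points follow by periodicity.\<close>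

lemma F_has_derivative_lattice:
  assumes "of_real x \<in> L"
  shows "(F has_real_derivative 0) (at x)"
proof -
  have F0: "F 0 = 0" using zero_mem by (simp add: F_def)
  have "((\<lambda>h. F h / h) \<longlongrightarrow> 0) (at 0)"
  proof -
    have "((\<lambda>h. 3 * H * h / (12 + h\<^sup>2 * (12 * Re (wp_regular (of_real h)) - 1)))
        \<longlongrightarrow> 3 * H * 0 / (12 + 0\<^sup>2 * (12 * Re 0 - 1))) (at (0::real))"
      by (intro tendsto_intros tendsto_wp_regular_real) auto
    moreover have "\<forall>\<^sub>F h in at 0. 3 * H * h / (12 + h\<^sup>2 * (12 * Re (wp_regular (of_real h)) - 1)) = F h / h"
    proof -
      have "\<forall>\<^sub>F h in at 0. complex_of_real h \<in> - (L - {0}) \<and> h \<noteq> 0"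
      proof (rule eventually_conj)
        have "\<forall>\<^sub>F z in nhds (complex_of_real 0). z \<in> - (L - {0})"
          using open_Compl_nonzero by (intro eventually_nhds_in_open) auto
        then have "\<forall>\<^sub>F h in nhds 0. complex_of_real h \<in> - (L - {0})"
          by (rule eventually_compose_filterlim) (intro tendsto_intros filterlim_ident)
        then show "\<forall>\<^sub>F h in at 0. complex_of_real h \<in> - (L - {0})"
          unfolding eventually_at_filter by (rule eventually_mono) auto
      qed (simp add: eventually_at_filter)
      then show ?thesis
      proof eventually_elim
        case (elim h)
        have "X h = (12 + h\<^sup>2 * (12 * Re (wp_regular (of_real h)) - 1)) / h\<^sup>2"
          using elim by (simp add: X_def wp_eq field_simps flip: of_real_power)
        then show ?case using elim by (auto simp: F_def power2_eq_square)
      qed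
    qed
    ultimately show ?thesis by (simp add: tendsto_cong)
  qed
  then have "(F has_real_derivative 0) (at 0)"
    by (simp add: has_field_derivative_iff F0)
  then have "((\<lambda>y. F (y - x)) has_real_derivative 0) (at x)"
    using DERIV_shift[of F 0 x "- x"] by simp
  moreover have "F (y - x) = F y" for y
    using F_periodic[of "- x" y] uminus_mem[OF assms] by simp
  ultimately show ?thesis by simp
qed

lemma F_has_derivative: "(F has_real_derivative deriv F x) (at x)"
proof -
  have "F differentiable at x"
    using F_has_derivative_pos[of x] F_has_derivative_lattice[of x] real_differentiable_def by blast
  then show ?thesis by (simp add: DERIV_deriv_iff_real_differentiable)
qed

lemma F_first_order: "(deriv F x)\<^sup>2 = P (F x)"
proof (cases "of_real x \<in> L")
  case True
  then show ?thesis using DERIV_imp_deriv[OF F_has_derivative_lattice[OF True]] by (simp add: F_def P_0)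
next
  case False
  have X: "X x \<noteq> 0" using X_pos[OF False] by simp
  have "(deriv F x)\<^sup>2 = 3 * H\<^sup>2 * (3 * (X' x)\<^sup>2) / X x ^ 4"
    unfolding DERIV_imp_deriv[OF F_has_derivative_pos[OF False]]
    by (simp add: power_divide power_mult_distrib flip: power_mult)
  also have "\<dots> = P (3 * H / X x)"
    unfolding X'_square[OF False] using X by (simp add: P_def field_simps eval_nat_numeral)
  finally show ?thesis using False by (simp add: F_def)
qed

lemma F_second_order: "(deriv F has_real_derivative q (F x)) (at x)"
proof (rule second_order_at_zeros[OF open_UNIV])
  obtain \<rho> where \<rho>: "\<rho> > 0" "\<And>x. of_real x \<in> L \<longleftrightarrow> (\<exists>k::int. x = of_int k * \<rho>)"
    using real_period by blast
  show "\<exists>z\<in>{x..y}. F z > 0" if "x < y" for x y :: real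
  proof -
    have "countable (complex_of_real -` L \<inter> {x..y})"
      by (rule countable_image_inj_on[of complex_of_real])
        (auto simp: inj_on_def intro: countable_subset[OF _ countable])
    moreover have "uncountable {x..y}" using that by (simp add: uncountable_closed_interval)
    ultimately have "\<not> {x..y} \<subseteq> complex_of_real -` L" using countable_subset by (metis inf.absorb2)
    then show ?thesis using F_pos_iff by blast
  qed
  show "(deriv F has_real_derivative q (F x)) (at x)" if "F x > 0" for x
  proof -
    have notin: "of_real x \<notin> L" using that F_pos_iff by blast
    have X: "X x \<noteq> 0" using X_pos[OF notin] by simp
    have "((\<lambda>x. - 3 * H * X' x / (X x)\<^sup>2) has_real_derivative
        - 3 * H * (((X x)\<^sup>2 + 2 * X x) / 2) / (X x)\<^sup>2 + 2 * H * (3 * (X' x)\<^sup>2) / X x ^ 3) (at x)"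
      using X by (auto intro!: derivative_eq_intros X_has_derivative X'_has_derivative notin)
        (simp add: field_simps eval_nat_numeral)
    also have "- 3 * H * (((X x)\<^sup>2 + 2 * X x) / 2) / (X x)\<^sup>2 + 2 * H * (3 * (X' x)\<^sup>2) / X x ^ 3 = q (F x)"
      unfolding X'_square[OF notin] using X notin by (simp add: q_def F_def field_simps eval_nat_numeral)
    finally have "((\<lambda>x. - 3 * H * X' x / (X x)\<^sup>2) has_real_derivative q (F x)) (at x)" .
    then show ?thesis
      by (rule has_field_derivative_transform_within_open[OF _ open_real_notin])
        (use notin DERIV_imp_deriv[OF F_has_derivative_pos] in auto)
  qed
qed (use F_nonneg F_has_derivative F_first_order in auto)

lemma continuous_on_F: "continuous_on A F"
  using F_has_derivative by (intro DERIV_continuous_on) (auto intro: has_field_derivative_at_within)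

text \<open>The location of the maximum is irrelevant: at a global maximum the derivative vanishes,
  so the value is a zero of \<open>P\<close>, and it is positive because \<open>F\<close> is
  positive at half a period.\<close>

lemma F_attains_max: obtains x where "F x = M"
proof -
  obtain \<rho> where \<rho>: "\<rho> > 0" "\<And>x. of_real x \<in> L \<longleftrightarrow> (\<exists>k::int. x = of_int k * \<rho>)"
    using real_period by blast
  obtain m where m: "m \<in> {0..\<rho>}" "\<And>z. z \<in> {0..\<rho>} \<Longrightarrow> F z \<le> F m"
    using continuous_attains_sup[of "{0..\<rho>}" F] \<rho>(1) continuous_on_F by auto
  have max: "F z \<le> F m" for z
  proof -
    obtain p where "of_real p \<in> L" "0 \<le> z + p" "z + p < \<rho>"
      using real_period_representative[OF \<rho>] by blast
    then show ?thesis using F_periodic[of p z] m(2)[of "z + p"] by simp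
  qed
  have "deriv F m = 0"
    by (rule DERIV_local_max[OF F_has_derivative, of 1]) (use max in auto)
  then have "P (F m) = 0" using F_first_order[of m] by simp
  moreover have "F m > 0"
  proof -
    have "of_real (\<rho> / 2) \<notin> L"
    proof
      assume "of_real (\<rho> / 2) \<in> L"
      then obtain k :: int where "\<rho> / 2 = of_int k * \<rho>" using \<rho>(2) by blast
      then have "real_of_int (2 * k) = of_int 1" using \<rho>(1) by simp
      then have "2 * k = 1" by (simp only: of_int_eq_iff)
      then show False by presburger
    qed
    then show ?thesis using F_pos_iff max less_le_trans by blast
  qed
  ultimately have "F m = M" using P_eq_0_imp[of "F m"] by simp
  then show ?thesis by (rule that)
qed

text \<open>Any initial data compatible with the first order equation occur on the orbit of
  \<open>F\<close>. The value is found by the intermediate value theorem between 0 and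
  \<open>M\<close>, and evenness of \<open>F\<close> supplies the required sign of the
  slope.\<close>

lemma F_initial_value:
  assumes v: "0 \<le> v" "v \<le> M" and w: "w\<^sup>2 = P v"
  obtains x where "F x = v" "deriv F x = w"
proof -
  obtain xm where xm: "F xm = M" by (rule F_attains_max)
  have F0: "F 0 = 0" using zero_mem by (simp add: F_def)
  have "F \<bar>xm\<bar> = M" using xm F_minus by (cases "xm \<ge> 0") auto
  then have "\<exists>x\<ge>0. x \<le> \<bar>xm\<bar> \<and> F x = v"
    using v F0 by (intro IVT' continuous_on_F) auto
  then obtain x where x: "F x = v" by blast
  then have "(deriv F x)\<^sup>2 = w\<^sup>2" using F_first_order w by simp
  then consider "deriv F x = w" | "deriv F x = - w" by (auto simp: power2_eq_iff)
  then show ?thesis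
  proof cases
    case 1
    then show ?thesis using that x by blast
  next
    case 2
    have "((\<lambda>x. F (- x)) has_real_derivative - deriv F x) (at (- x))"
      using DERIV_mirror[of F "deriv F x" "- x"] F_has_derivative[of x] by simp
    then have "deriv F (- x) = w" using DERIV_imp_deriv 2 by (simp add: F_minus)
    then show ?thesis using that[of "- x"] x F_minus by simp
  qed
qed

end

section \<open>Conformal time and the scale function\<close>

lemma smooth_on_real_derivatives:
  fixes f :: "real \<Rightarrow> real"
  assumes "smooth_on f U" "open U"
  shows "\<And>x. x \<in> U \<Longrightarrow> (f has_real_derivative deriv f x) (at x)"
    and "\<And>x. x \<in> U \<Longrightarrow> (deriv f has_real_derivative deriv (deriv f) x) (at x)"
    and "continuous_on U (deriv (deriv f))"
proof -
  have fr: "frechet_derivative g (at x) 1 = deriv g x" if "g differentiable (at x)" for g :: "real \<Rightarrow> real" and x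
  proof -
    have "(g has_real_derivative deriv g x) (at x)"
      using that by (simp add: DERIV_deriv_iff_real_differentiable)
    then have "(*) (deriv g x) = frechet_derivative g (at x)"
      unfolding has_field_derivative_def by (rule frechet_derivative_at)
    then show ?thesis by (metis mult.right_neutral)
  qed
  have h: "higher_differentiable_on (Suc (Suc 0)) f U"
    using assms(1) by (simp add: smooth_on_def)
  then have f: "f differentiable (at x)" if "x \<in> U" for x using that by simp
  then show d: "(f has_real_derivative deriv f x) (at x)" if "x \<in> U" for x
    using that by (simp add: DERIV_deriv_iff_real_differentiable)
  let ?g = "\<lambda>x. frechet_derivative f (at x) 1"
  have g: "?g differentiable (at x)" if "x \<in> U" for x using h that by simp
  have eq: "?g x = deriv f x" if "x \<in> U" for x using fr[OF f[OF that]] .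
  have dg: "(deriv f has_real_derivative deriv ?g x) (at x)" if "x \<in> U" for x
  proof (rule has_field_derivative_transform_within_open[OF _ assms(2) that])
    show "(?g has_real_derivative deriv ?g x) (at x)"
      using g[OF that] by (simp add: DERIV_deriv_iff_real_differentiable)
  qed (use eq in auto)
  have ddg: "deriv (deriv f) x = deriv ?g x" if "x \<in> U" for x
    using DERIV_imp_deriv[OF dg[OF that]] .
  show "(deriv f has_real_derivative deriv (deriv f) x) (at x)" if "x \<in> U" for x
    using dg[OF that] ddg[OF that] by simp
  have "continuous_on U (\<lambda>x. frechet_derivative ?g (at x) 1)" using h by simp
  then show "continuous_on U (deriv (deriv f))"
    by (rule continuous_on_eq) (use fr[OF g] ddg in auto)
qed

section \<open>Passage between cosmological time and conformal time\<close>

locale RW_spacetime =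
  fixes I :: "real set" and s :: "real \<Rightarrow> real" and b \<Lambda> :: real
  assumes RW: "closed_RW_spacetime I s b \<Lambda>"
begin

definition J :: "real set" where "J = conformal_domain I s b"
definition S :: "real \<Rightarrow> real" where "S = conformal_scale I s b"
definition \<tau> :: "real \<Rightarrow> real" where "\<tau> = conformal_time s b"
definition \<sigma> :: "real \<Rightarrow> real" where "\<sigma> = inverse_conformal_time I s b"
definition U :: "real set" where "U = {t \<in> I. 0 < s t}"

lemma RW_facts:
  shows open_I: "open I" and interval_I: "is_interval I" and b_mem: "b \<in> I"
    and s_nonneg: "\<And>t. t \<in> I \<Longrightarrow> 0 \<le> s t"
    and smooth: "smooth_on s U"
    and null: "{t \<in> I. s t = 0} \<in> null_sets lebesgue"
    and integrable: "\<And>t. t \<in> I \<Longrightarrow> interval_lebesgue_integrable lborel (ereal b) (ereal t) (\<lambda>u. 1 / s u)"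
    and cont_\<tau>: "continuous_on I \<tau>" and mono_\<tau>: "strict_mono_on I \<tau>"
    and open_J: "open J" and interval_J: "is_interval J"
    and \<sigma>_diff: "\<And>x. x \<in> J \<Longrightarrow> \<sigma> differentiable (at x)"
    and S_diff: "\<And>x. x \<in> J \<Longrightarrow> S differentiable (at x)"
    and energy_nonneg: "\<And>t. t \<in> U \<Longrightarrow> 0 \<le> energy_density \<Lambda> s t"
  using RW unfolding closed_RW_spacetime_def J_def S_def \<tau>_def \<sigma>_def U_def by auto

lemma J_eq: "J = \<tau> ` I"
  by (simp add: J_def \<tau>_def conformal_domain_def)

lemma inj_\<tau>: "inj_on \<tau> I"
  using mono_\<tau> by (rule strict_mono_on_imp_inj_on)

lemma \<sigma>_\<tau>: "t \<in> I \<Longrightarrow> \<sigma> (\<tau> t) = t"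
  unfolding \<sigma>_def inverse_conformal_time_def using inj_\<tau> by (simp add: \<tau>_def the_inv_into_f_f)

lemma \<sigma>_mem: "x \<in> J \<Longrightarrow> \<sigma> x \<in> I" and \<tau>_\<sigma>: "x \<in> J \<Longrightarrow> \<tau> (\<sigma> x) = x"
  using \<sigma>_\<tau> by (auto simp: J_eq)

lemma \<tau>_mem: "t \<in> I \<Longrightarrow> \<tau> t \<in> J"
  by (simp add: J_eq)

lemma S_eq: "S x = s (\<sigma> x)"
  by (simp add: S_def conformal_scale_def \<sigma>_def)

lemma s_eq: "t \<in> I \<Longrightarrow> s t = S (\<tau> t)"
  by (simp add: S_eq \<sigma>_\<tau>)

lemma S_nonneg: "x \<in> J \<Longrightarrow> 0 \<le> S x"
  by (simp add: S_eq s_nonneg \<sigma>_mem)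

lemma S_has_derivative: "x \<in> J \<Longrightarrow> (S has_real_derivative deriv S x) (at x)"
  using S_diff by (simp add: DERIV_deriv_iff_real_differentiable)

lemma cont_S: "continuous_on J S"
  using S_has_derivative by (intro DERIV_continuous_on) (auto intro: has_field_derivative_at_within)

lemma cont_s: "continuous_on I s"
proof -
  have "continuous_on I (S \<circ> \<tau>)"
    using cont_S cont_\<tau> by (intro continuous_on_compose) (auto simp: J_eq)
  then show ?thesis by (rule continuous_on_eq) (simp add: s_eq)
qed

lemma open_U: "open U"
proof -
  have "U = I \<inter> s -` {0<..}" by (auto simp: U_def)
  then show ?thesis using continuous_open_preimage[OF cont_s open_I] by simp
qed

lemmas s_derivatives = smooth_on_real_derivatives[OF smooth open_U]

text \<open>Integrability is known only on intervals that start at \<open>b\<close>. The segment is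
  enclosed between l < b < r, and the two open intervals are glued at the single point
  \<open>b\<close>.\<close>

lemma interval_integrable_subinterval:
  assumes "x \<in> I" "y \<in> I" "x \<le> y"
  shows "interval_lebesgue_integrable lborel (ereal x) (ereal y) (\<lambda>u. 1 / s u)"
proof -
  obtain d where d: "d > 0" "cball x d \<subseteq> I" using open_I assms(1) open_contains_cball by metis
  obtain e where e: "e > 0" "cball y e \<subseteq> I" using open_I assms(2) open_contains_cball by metis
  obtain f where f: "f > 0" "cball b f \<subseteq> I" using open_I b_mem open_contains_cball by metis
  define l where "l = min (x - d) (b - f)"
  define r where "r = max (y + e) (b + f)"
  have "x - d \<in> I" "b - f \<in> I" "y + e \<in> I" "b + f \<in> I"
    using d e f by (auto simp: subset_eq dist_real_def)
  then have lr: "l \<in> I" "r \<in> I" by (auto simp: l_def r_def min_def max_def)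
  have lbr: "l < b" "b < r" "l \<le> x" "y \<le> r" using d e f by (auto simp: l_def r_def)
  have 1: "set_integrable lborel {b<..<r} (\<lambda>u. 1 / s u)"
    using integrable[OF lr(2)] lbr by (simp add: interval_lebesgue_integrable_def)
  have 2: "set_integrable lborel {l<..<b} (\<lambda>u. 1 / s u)"
    using integrable[OF lr(1)] lbr by (simp add: interval_lebesgue_integrable_def)
  have 3: "set_integrable lborel {b} (\<lambda>u. 1 / s u)"
  proof -
    have "integrable lborel (\<lambda>u. indicator {b} u *\<^sub>R (1 / s b))"
      by (intro integrable_scaleR_left integrable_real_indicator) auto
    moreover have "(\<lambda>u. indicator {b} u *\<^sub>R (1 / s b)) = (\<lambda>u. indicator {b} u *\<^sub>R (1 / s u))"
      by (auto simp: indicator_def)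
    ultimately show ?thesis unfolding set_integrable_def by (simp only:)
  qed
  have "set_integrable lborel ({l<..<b} \<union> {b} \<union> {b<..<r}) (\<lambda>u. 1 / s u)"
    by (rule set_integrable_Un[OF set_integrable_Un[OF 2 3] 1]) auto
  moreover have "{x<..<y} \<in> sets lborel" by simp
  moreover have "{x<..<y} \<subseteq> {l<..<b} \<union> {b} \<union> {b<..<r}" using lbr by auto
  ultimately have "set_integrable lborel {x<..<y} (\<lambda>u. 1 / s u)"
    by (rule set_integrable_subset)
  then show ?thesis using assms(3) by (simp add: interval_lebesgue_integrable_def)
qed

lemma \<tau>_has_derivative:
  assumes t: "t \<in> U"
  shows "(\<tau> has_real_derivative 1 / s t) (at t)"
proof -
  obtain d where d: "d > 0" "cball t d \<subseteq> U" using open_U t open_contains_cball by metis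
  define A B where "A = t - d" and "B = t + d"
  have AB: "A < t" "t < B" using d by (auto simp: A_def B_def)
  have sub: "{A..B} \<subseteq> U" using d by (auto simp: A_def B_def subset_eq dist_real_def)
  then have subI: "{A..B} \<subseteq> I" by (auto simp: U_def)
  have "continuous_on {A..B} (\<lambda>u. 1 / s u)"
    using sub cont_s subI by (intro continuous_intros) (auto simp: U_def intro: continuous_on_subset)
  then have "((\<lambda>x. LBINT u=A..x. 1 / s u) has_vector_derivative 1 / s t) (at t within {A..B})"
    using AB by (intro interval_integral_FTC2) auto
  then have "((\<lambda>x. LBINT u=A..x. 1 / s u) has_real_derivative 1 / s t) (at t)"
    using AB by (simp add: has_real_derivative_iff_has_vector_derivative at_within_Icc_at)
  then have 1: "((\<lambda>x. \<tau> A + (LBINT u=A..x. 1 / s u)) has_real_derivative 1 / s t) (at t)"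
    by (auto intro!: derivative_eq_intros)
  show ?thesis
  proof (rule has_field_derivative_transform_within_open[OF 1, of "{A<..<B}"])
    fix x assume x: "x \<in> {A<..<B}"
    have A: "A \<in> I" "x \<in> I" using subI x AB by auto
    have m: "min b (min A x) \<in> I" "max b (max A x) \<in> I" using A b_mem by (auto simp: min_def max_def)
    have "interval_lebesgue_integrable lborel (min (ereal b) (min (ereal A) (ereal x)))
        (max (ereal b) (max (ereal A) (ereal x))) (\<lambda>u. 1 / s u)"
      using interval_integrable_subinterval[OF m] by (simp add: ereal_min ereal_max)
    from interval_integral_sum[OF this]
    show "\<tau> A + (LBINT u=A..x. 1 / s u) = \<tau> x"
      by (simp add: \<tau>_def conformal_time_def)
  qed (use AB in auto)
qed

lemma \<tau>_U: "\<tau> ` U = {x \<in> J. S x > 0}"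
  using s_eq by (auto simp: U_def J_eq image_iff)

lemma open_\<tau>_U: "open {x \<in> J. S x > 0}"
proof -
  have "{x \<in> J. S x > 0} = J \<inter> S -` {0<..}" by auto
  then show ?thesis using continuous_open_preimage[OF cont_S open_J, of "{0<..}"] by simp
qed

lemma \<sigma>_has_derivative:
  assumes x: "x \<in> J" "S x > 0"
  shows "(\<sigma> has_real_derivative S x) (at x)"
proof -
  let ?t = "\<sigma> x"
  have t: "?t \<in> U" using x \<sigma>_mem by (simp add: U_def S_eq)
  have d: "(\<sigma> has_real_derivative deriv \<sigma> x) (at x)"
    using \<sigma>_diff[OF x(1)] by (simp add: DERIV_deriv_iff_real_differentiable)
  have "(\<tau> \<circ> \<sigma> has_real_derivative 1 / s ?t * deriv \<sigma> x) (at x)"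
    by (rule DERIV_chain[OF \<tau>_has_derivative[OF t] d])
  moreover have "(\<tau> \<circ> \<sigma> has_real_derivative 1) (at x)"
    by (rule has_field_derivative_transform_within_open[OF DERIV_ident open_J x(1)]) (simp add: \<tau>_\<sigma>)
  ultimately have "1 / s ?t * deriv \<sigma> x = 1" by (rule DERIV_unique)
  then have "deriv \<sigma> x = S x" using x(2) by (simp add: S_eq field_simps)
  then show ?thesis using d by simp
qed

lemma deriv_S_eq:
  assumes x: "x \<in> J" "S x > 0"
  shows "deriv S x = deriv s (\<sigma> x) * S x"
proof -
  have t: "\<sigma> x \<in> U" using x \<sigma>_mem by (simp add: U_def S_eq)
  have "((\<lambda>x. s (\<sigma> x)) has_real_derivative deriv s (\<sigma> x) * S x) (at x)"
    by (rule DERIV_chain2[OF s_derivatives(1)[OF t] \<sigma>_has_derivative[OF x]])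
  then have "(S has_real_derivative deriv s (\<sigma> x) * S x) (at x)"
    by (simp add: S_eq[abs_def])
  then show ?thesis by (rule DERIV_imp_deriv)
qed

text \<open>By monotonicity of the conformal time, an interval of zeros of \<open>S\<close> would
  come from a nondegenerate interval of zeros of \<open>s\<close>, which is not a null set.\<close>

lemma no_zero_interval:
  assumes xy: "x < y" "{x..y} \<subseteq> J"
  shows "\<exists>z\<in>{x..y}. S z > 0"
proof (rule ccontr)
  assume none: "\<not> ?thesis"
  have mem: "x \<in> J" "y \<in> J" using xy by auto
  have lt: "\<sigma> x < \<sigma> y"
    using strict_mono_on_less[OF mono_\<tau>, of "\<sigma> x" "\<sigma> y"] \<sigma>_mem \<tau>_\<sigma> mem xy(1) by simp
  have "{\<sigma> x..\<sigma> y} \<subseteq> {t \<in> I. s t = 0}"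
  proof
    fix t assume t: "t \<in> {\<sigma> x..\<sigma> y}"
    then have tI: "t \<in> I" using interval_I \<sigma>_mem mem by (auto simp: is_interval_1)
    have "\<tau> (\<sigma> x) \<le> \<tau> t" "\<tau> t \<le> \<tau> (\<sigma> y)"
      using t tI \<sigma>_mem mem strict_mono_on_leD[OF mono_\<tau>] by auto
    then have "\<tau> t \<in> {x..y}" using \<tau>_\<sigma> mem by simp
    then have "\<not> S (\<tau> t) > 0" using none by blast
    then show "t \<in> {t \<in> I. s t = 0}" using tI s_nonneg[OF tI] s_eq[OF tI] by simp
  qed
  then have "negligible {\<sigma> x..\<sigma> y}"
    using null negligible_subset by (metis negligible_iff_null_sets)
  then show False using lt by (simp add: negligible_interval(1)[of "\<sigma> x" "\<sigma> y", unfolded cbox_interval] box_real)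
qed

end

section \<open>The critical equation of first and second order\<close>

locale critical_RW_spacetime = RW_spacetime + critical_parameters +
  assumes nonconst: "\<not> s constant_on I"
    and internal: "internal_parameters I s a H"
begin

lemma first_integral:
  assumes "t \<in> U"
  shows "(deriv s t)\<^sup>2 = H / s t + 1 - a / 3 * (s t)\<^sup>2"
proof -
  have "s t * ((deriv s t)\<^sup>2 + a / 3 * (s t)\<^sup>2 - 1) = H"
    using internal assms unfolding internal_parameters_def U_def by blast
  then show ?thesis using assms by (simp add: U_def field_simps)
qed

lemma s_eq_M:
  assumes "t \<in> U" "deriv s t = 0"
  shows "s t = M"
proof -
  have st: "s t > 0" using assms by (simp add: U_def)
  have "P (s t) = (s t)\<^sup>2 * (H / s t + 1 - a / 3 * (s t)\<^sup>2)"
    using st by (simp add: P_def field_simps eval_nat_numeral)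
  then have "P (s t) = 0" using first_integral[OF assms(1)] assms(2) by simp
  then show ?thesis using P_eq_0_imp[of "s t"] st by simp
qed

text \<open>Differentiating the first integral gives the claim only where the derivative of
  \<open>s\<close> is nonzero. On the exceptional set \<open>A\<close> the first derivative
  vanishes, so there s = M, the second derivative is 0 and \<open>D\<close> has the constant nonzero
  value - R M. Continuity of the second derivative makes \<open>A\<close> open, and the constant
  values make it closed in \<open>I\<close>; \<open>A = I\<close> would make \<open>s\<close>
  constant, so \<open>A\<close> is empty.\<close>

lemma second_derivative_s:
  assumes "t \<in> U"
  shows "deriv (deriv s) t = - H / (2 * (s t)\<^sup>2) - a / 3 * s t"
proof -
  \<comment> \<open>Half the derivative of H / y + 1 - a y^2 / 3, the right-hand side of the first
    integral.\<close>
  define R where "R y = - H / (2 * y\<^sup>2) - a / 3 * y" for y :: real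
  define D where "D t = deriv (deriv s) t - R (s t)" for t
  have "H / (2 * M\<^sup>2) > 0" "a / 3 * M > 0" using H_pos M_pos a_pos by simp_all
  then have RM: "R M < 0" by (simp add: R_def)
  have cont_D: "continuous_on U D"
    unfolding D_def R_def using s_derivatives(3) cont_s
    by (intro continuous_intros) (auto simp: U_def intro: continuous_on_subset)
  define A where "A = {t \<in> U. D t \<noteq> 0}"
  have "A = U \<inter> D -` (- {0})" by (auto simp: A_def)
  then have open_A: "open A"
    using continuous_open_preimage[OF cont_D open_U, of "- {0}"] by (simp only: open_Compl closed_singleton)
  have s0: "deriv s t = 0" if "t \<in> A" for t
  proof (rule ccontr)
    assume ne: "deriv s t \<noteq> 0"
    have t: "t \<in> U" using that by (simp add: A_def)
    have st: "s t > 0" using t by (simp add: U_def)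
    have "((\<lambda>t. (deriv s t)\<^sup>2) has_real_derivative 2 * deriv s t * deriv (deriv s) t) (at t)"
      using s_derivatives(2)[OF t] by (auto intro!: derivative_eq_intros)
    moreover have "((\<lambda>t. (deriv s t)\<^sup>2) has_real_derivative 2 * R (s t) * deriv s t) (at t)"
    proof (rule has_field_derivative_transform_within_open[OF _ open_U t])
      show "((\<lambda>t. H / s t + 1 - a / 3 * (s t)\<^sup>2) has_real_derivative 2 * R (s t) * deriv s t) (at t)"
        using st by (auto intro!: derivative_eq_intros s_derivatives(1)[OF t])
          (simp add: R_def field_simps eval_nat_numeral)
    qed (simp add: first_integral)
    ultimately have "2 * deriv s t * deriv (deriv s) t = 2 * R (s t) * deriv s t" by (rule DERIV_unique)
    then have "deriv (deriv s) t = R (s t)" using ne by simp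
    then show False using that by (simp add: A_def D_def)
  qed
  have DA: "D t = - R M" "s t = M" if "t \<in> A" for t
  proof -
    have t: "t \<in> U" using that by (simp add: A_def)
    show "s t = M" using s_eq_M[OF t s0[OF that]] .
    have "(deriv s has_real_derivative 0) (at t)"
      by (rule has_field_derivative_transform_within_open[OF DERIV_const open_A that]) (simp add: s0)
    then have "deriv (deriv s) t = 0" by (rule DERIV_imp_deriv)
    then show "D t = - R M" using \<open>s t = M\<close> by (simp add: D_def)
  qed
  have "A = {}"
  proof (rule ccontr)
    assume ne: "A \<noteq> {}"
    have "closedin (top_of_set I) A"
    proof -
      have "x \<in> A" if x: "x \<in> I" "x islimpt A" for x
      proof -
        obtain f where f: "\<And>n. f n \<in> A - {x}" "f \<longlonglongrightarrow> x"
          using x(2) unfolding islimpt_sequential by blast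
        have fA: "f n \<in> A" "f n \<in> U" "f n \<in> I" for n using f(1)[of n] by (auto simp: A_def U_def)
        have "(\<lambda>n. s (f n)) \<longlonglongrightarrow> s x"
          using cont_s f(2) x(1) fA(3) by (auto simp: continuous_on_sequentially o_def)
        moreover have "(\<lambda>n. s (f n)) \<longlonglongrightarrow> M" using DA(2)[OF fA(1)] by simp
        ultimately have sx: "s x = M" by (rule LIMSEQ_unique)
        then have xU: "x \<in> U" using x(1) M_pos by (simp add: U_def)
        have "(\<lambda>n. D (f n)) \<longlonglongrightarrow> D x"
          using cont_D f(2) xU fA(2) by (auto simp: continuous_on_sequentially o_def)
        moreover have "(\<lambda>n. D (f n)) \<longlonglongrightarrow> - R M" using DA(1)[OF fA(1)] by simp
        ultimately have "D x = - R M" by (rule LIMSEQ_unique)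
        then show ?thesis using xU RM by (simp add: A_def)
      qed
      moreover have "A \<subseteq> I" by (auto simp: A_def U_def)
      ultimately show ?thesis by (auto simp: closedin_limpt)
    qed
    moreover have "openin (top_of_set I) A"
      using open_A by (intro open_subset) (auto simp: A_def U_def)
    moreover have "connected I" using interval_I is_interval_connected by blast
    ultimately have "A = I" using ne connected_clopen by metis
    then have "s constant_on I" using DA(2) by (auto simp: constant_on_def)
    then show False using nonconst by simp
  qed
  then have "D t = 0" using assms by (auto simp: A_def)
  then show ?thesis by (simp add: D_def R_def)
qed

text \<open>Where \<open>S\<close> is positive this is the first integral with dt = S d\<tau>. That
  integral says nothing at the zeros of \<open>S\<close>, but there \<open>S\<close> has its
  minimum, so its derivative vanishes.\<close>

lemma S_first_order:
  assumes x: "x \<in> J"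
  shows "(deriv S x)\<^sup>2 = P (S x)"
proof (cases "S x > 0")
  case True
  have t: "\<sigma> x \<in> U" using x True \<sigma>_mem by (simp add: U_def S_eq)
  have "(deriv S x)\<^sup>2 = (S x)\<^sup>2 * (H / S x + 1 - a / 3 * (S x)\<^sup>2)"
    unfolding deriv_S_eq[OF x True] power_mult_distrib first_integral[OF t] by (simp add: S_eq)
  also have "\<dots> = P (S x)"
    using True by (simp add: P_def field_simps eval_nat_numeral)
  finally show ?thesis .
next
  case False
  then have S0: "S x = 0" using S_nonneg[OF x] by simp
  obtain d where d: "d > 0" "ball x d \<subseteq> J" using open_J x open_contains_ball by metis
  have "deriv S x = 0"
    by (rule DERIV_local_min[OF S_has_derivative[OF x] d(1)])
      (use d(2) S_nonneg S0 in \<open>auto simp: subset_eq dist_real_def\<close>)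
  then show ?thesis by (simp add: S0 P_0)
qed

lemma S_le: "x \<in> J \<Longrightarrow> S x \<le> M"
  using S_first_order[of x] S_nonneg[of x] by (metis P_nonneg_imp_le zero_le_power2)

lemma S_second_order:
  assumes x: "x \<in> J"
  shows "(deriv S has_real_derivative q (S x)) (at x)"
proof (rule second_order_at_zeros[OF open_J S_nonneg S_has_derivative S_first_order _ no_zero_interval x])
  fix x assume x: "x \<in> J" "S x > 0"
  have t: "\<sigma> x \<in> U" using x \<sigma>_mem by (simp add: U_def S_eq)
  have "((\<lambda>x. deriv s (\<sigma> x) * S x) has_real_derivative
      deriv (deriv s) (\<sigma> x) * S x * S x + deriv S x * deriv s (\<sigma> x)) (at x)"
    by (rule DERIV_mult'[OF DERIV_chain2[OF s_derivatives(2)[OF t] \<sigma>_has_derivative[OF x]] S_has_derivative[OF x(1)], THEN DERIV_cong])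
      (simp add: algebra_simps)
  also have "deriv (deriv s) (\<sigma> x) * S x * S x + deriv S x * deriv s (\<sigma> x)
      = deriv (deriv s) (\<sigma> x) * (S x)\<^sup>2 + (deriv s (\<sigma> x))\<^sup>2 * S x"
    unfolding deriv_S_eq[OF x] by (simp add: power2_eq_square algebra_simps)
  also have "\<dots> = q (S x)"
    unfolding second_derivative_s[OF t] first_integral[OF t] using x(2)
    by (simp add: q_def field_simps eval_nat_numeral flip: S_eq)
  finally have "((\<lambda>x. deriv s (\<sigma> x) * S x) has_real_derivative q (S x)) (at x)" .
  then show "(deriv S has_real_derivative q (S x)) (at x)"
    by (rule has_field_derivative_transform_within_open[OF _ open_\<tau>_U]) (use x deriv_S_eq in auto)
qed

lemma energy_density_eq:
  assumes "t \<in> U"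
  shows "energy_density \<Lambda> s t = (3 * H / s t ^ 3 + 6 / (s t)\<^sup>2 - a - \<Lambda>) / (8 * pi)"
  using assms unfolding energy_density_def first_integral[OF assms]
  by (simp add: U_def field_simps eval_nat_numeral)

lemma pressure_eq:
  assumes "t \<in> U"
  shows "pressure \<Lambda> s t = (a + \<Lambda> - 2 / (s t)\<^sup>2) / (8 * pi)"
  using assms unfolding pressure_def first_integral[OF assms] second_derivative_s[OF assms]
  by (simp add: U_def field_simps eval_nat_numeral)

end

section \<open>Energy conditions and the geometry of the slices\<close>

locale critical_RW_on_lattice = critical_RW_spacetime + critical_lattice +
  assumes maximal: "maximal_conformal_domain J S a H"
begin

lemma S_eq_F:
  obtains c where "J = UNIV" and "\<And>x. S x = F (x - c)"
proof -
  define x0 where "x0 = \<tau> b"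
  have x0: "x0 \<in> J" using \<tau>_mem[OF b_mem] by (simp add: x0_def)
  obtain y where y: "F y = S x0" "deriv F y = deriv S x0"
    using F_initial_value[OF S_nonneg[OF x0] S_le[OF x0] S_first_order[OF x0]] by blast
  define c where "c = x0 - y"
  define G where "G x = F (x - c)" for x
  have dG: "(G has_real_derivative deriv F (x - c)) (at x)" for x
    unfolding G_def using F_has_derivative[of "x - c"] DERIV_shift[of F "deriv F (x - c)" x "- c"] by simp
  have ddG: "((\<lambda>x. deriv F (x - c)) has_real_derivative q (G x)) (at x)" for x
    unfolding G_def using F_second_order[of "x - c"] DERIV_shift[of "deriv F" "q (F (x - c))" x "- c"] by simp
  have G_bounds: "0 \<le> G x" "G x \<le> M" for x by (simp_all add: G_def F_nonneg F_le)
  have SG: "S x = G x" if "x \<in> J" for x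
  proof (rule eq_of_second_order[OF interval_J that x0, where S' = "deriv S" and F' = "\<lambda>x. deriv F (x - c)"])
    show "S x0 = G x0" "deriv S x0 = deriv F (x0 - c)" using y by (simp_all add: G_def c_def)
  qed (use S_has_derivative S_second_order S_nonneg S_le dG ddG G_bounds in auto)
  \<comment> \<open>The translate \<open>G\<close> is a nonnegative differentiable solution on the
    whole line that extends \<open>S\<close>, hence an admissible competitor in the maximality
    condition.\<close>
  have "UNIV = J"
  proof (rule maximal[unfolded maximal_conformal_domain_def, rule_format])
    have "(deriv G x)\<^sup>2 + a / 3 * G x ^ 4 - (G x)\<^sup>2 - H * G x = 0" for x
      unfolding DERIV_imp_deriv[OF dG] F_first_order by (simp add: P_def G_def)
    then have "conformal_critical_on UNIV G a H" by (simp add: conformal_critical_on_def)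
    moreover have "G differentiable (at x)" for x using dG real_differentiable_def by blast
    ultimately show "open UNIV \<and> is_interval UNIV \<and> J \<subseteq> UNIV \<and> (\<forall>x\<in>J. G x = S x) \<and>
        (\<forall>x\<in>UNIV. 0 \<le> G x \<and> G differentiable (at x)) \<and> conformal_critical_on UNIV G a H"
      using SG F_nonneg by (simp add: G_def)
  qed
  then show ?thesis using that[of c] SG by (auto simp: G_def)
qed

lemma s_attains_M: obtains t where "t \<in> U" "s t = M"
proof -
  obtain c where c: "J = UNIV" "\<And>x. S x = F (x - c)" using S_eq_F by metis
  obtain y where "F y = M" by (rule F_attains_max)
  then have "S (y + c) = M" using c(2) by simp
  then have "s (\<sigma> (y + c)) = M" "\<sigma> (y + c) \<in> I" using c(1) \<sigma>_mem by (simp_all add: S_eq)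
  then show ?thesis using that M_pos by (simp add: U_def)
qed

lemma s_inverse_bounds:
  assumes "t \<in> U"
  shows "1 / M ^ 3 \<le> 1 / s t ^ 3" "1 / M\<^sup>2 \<le> 1 / (s t)\<^sup>2"
proof -
  have "0 < s t" "s t \<le> M"
    using assms S_le[OF \<tau>_mem] by (auto simp: U_def s_eq)
  then show "1 / M ^ 3 \<le> 1 / s t ^ 3" "1 / M\<^sup>2 \<le> 1 / (s t)\<^sup>2"
    by (auto intro!: frac_le power_mono)
qed

lemma Lambda_le: "\<Lambda> \<le> 3 * H / M ^ 3 + 6 / M\<^sup>2 - a"
proof -
  obtain t where t: "t \<in> U" "s t = M" by (rule s_attains_M)
  have "0 \<le> (3 * H / M ^ 3 + 6 / M\<^sup>2 - a - \<Lambda>) / (8 * pi)"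
    using energy_nonneg[OF t(1)] unfolding energy_density_eq[OF t(1)] t(2) .
  then show ?thesis using pi_gt_zero by (auto simp: zero_le_divide_iff)
qed

lemma weak: "weak_energy_condition I s \<Lambda>"
proof -
  have "- energy_density \<Lambda> s t \<le> pressure \<Lambda> s t" if t: "t \<in> U" for t
  proof -
    have st: "s t > 0" using t by (simp add: U_def)
    have "energy_density \<Lambda> s t + pressure \<Lambda> s t = (3 * H / s t ^ 3 + 4 / (s t)\<^sup>2) / (8 * pi)"
      unfolding energy_density_eq[OF t] pressure_eq[OF t] by (simp add: field_simps)
    also have "\<dots> \<ge> 0" using st H_pos by simp
    finally show ?thesis by simp
  qed
  then show ?thesis by (simp add: weak_energy_condition_def U_def)
qed

lemma pressure_le_iff:
  assumes t: "t \<in> U"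
  shows "pressure \<Lambda> s t \<le> energy_density \<Lambda> s t \<longleftrightarrow> \<Lambda> \<le> 3 / 2 * H * (1 / s t ^ 3) + 4 * (1 / (s t)\<^sup>2) - a"
  unfolding energy_density_eq[OF t] pressure_eq[OF t] by (auto simp: divide_le_cancel)

lemma strong_le_iff:
  assumes t: "t \<in> U"
  shows "- energy_density \<Lambda> s t / 3 \<le> pressure \<Lambda> s t \<longleftrightarrow> - (3 / 2 * H * (1 / s t ^ 3)) - a \<le> \<Lambda>"
proof -
  have "pressure \<Lambda> s t + energy_density \<Lambda> s t / 3 = (3 / 2 * H * (1 / s t ^ 3) + a + \<Lambda>) / (12 * pi)"
    unfolding energy_density_eq[OF t] pressure_eq[OF t] by (simp add: field_simps)
  moreover have "(3 / 2 * H * (1 / s t ^ 3) + a + \<Lambda>) / (12 * pi) \<ge> 0 \<longleftrightarrow> - (3 / 2 * H * (1 / s t ^ 3)) - a \<le> \<Lambda>"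
    by (subst pos_le_divide_eq) auto
  ultimately show ?thesis by linarith
qed

text \<open>With nonnegative coefficients the right-hand side decreases in \<open>s\<close>, so the
  sharpest inequality is the one at the maximal value \<open>M\<close>, which is attained.\<close>

lemma all_le_iff:
  assumes "0 \<le> A" "0 \<le> B"
  shows "(\<forall>t\<in>U. C \<le> A * (1 / s t ^ 3) + B * (1 / (s t)\<^sup>2)) \<longleftrightarrow> C \<le> A * (1 / M ^ 3) + B * (1 / M\<^sup>2)"
proof
  obtain t where t: "t \<in> U" "s t = M" by (rule s_attains_M)
  assume "\<forall>t\<in>U. C \<le> A * (1 / s t ^ 3) + B * (1 / (s t)\<^sup>2)"
  then show "C \<le> A * (1 / M ^ 3) + B * (1 / M\<^sup>2)" using t by metis
next
  assume "C \<le> A * (1 / M ^ 3) + B * (1 / M\<^sup>2)"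
  then show "\<forall>t\<in>U. C \<le> A * (1 / s t ^ 3) + B * (1 / (s t)\<^sup>2)"
    using assms s_inverse_bounds by (meson add_mono mult_left_mono order_trans)
qed

lemma pressure_le_iff_all:
  "(\<forall>t\<in>U. pressure \<Lambda> s t \<le> energy_density \<Lambda> s t) \<longleftrightarrow> \<Lambda> \<le> 3 / 2 * H * (1 / M ^ 3) + 4 * (1 / M\<^sup>2) - a"
  using all_le_iff[of "3 / 2 * H" 4 "\<Lambda> + a"] H_pos by (simp add: pressure_le_iff le_diff_eq)

lemma strong_le_iff_all:
  "(\<forall>t\<in>U. - energy_density \<Lambda> s t / 3 \<le> pressure \<Lambda> s t) \<longleftrightarrow> - (3 / 2 * H * (1 / M ^ 3)) - a \<le> \<Lambda>"
proof -
  have "(\<forall>t\<in>U. - energy_density \<Lambda> s t / 3 \<le> pressure \<Lambda> s t) \<longleftrightarrow>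
      (\<forall>t\<in>U. - a - \<Lambda> \<le> 3 / 2 * H * (1 / s t ^ 3) + 0 * (1 / (s t)\<^sup>2))"
    by (intro ball_cong refl) (auto simp only: strong_le_iff)
  also have "\<dots> \<longleftrightarrow> - a - \<Lambda> \<le> 3 / 2 * H * (1 / M ^ 3) + 0 * (1 / M\<^sup>2)"
    using H_pos by (intro all_le_iff) auto
  finally show ?thesis by auto
qed

lemma dominant_iff:
  "dominant_energy_condition I s \<Lambda> \<longleftrightarrow> \<Lambda> \<le> 3 / 2 * H * (1 / M ^ 3) + 4 * (1 / M\<^sup>2) - a"
  using weak unfolding pressure_le_iff_all[symmetric]
  by (auto simp: dominant_energy_condition_def weak_energy_condition_def U_def)

lemma strong_iff:
  "strong_energy_condition I s \<Lambda> \<longleftrightarrow>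
    - (3 / 2 * H * (1 / M ^ 3)) - a \<le> \<Lambda> \<and> \<Lambda> \<le> 3 / 2 * H * (1 / M ^ 3) + 4 * (1 / M\<^sup>2) - a"
  unfolding pressure_le_iff_all[symmetric] strong_le_iff_all[symmetric]
  by (auto simp: strong_energy_condition_def U_def)

end

section \<open>Level hypersurfaces of conformal time and the conformal quadratic form\<close>

lemma smooth_on_const: "smooth_on (\<lambda>x. c) U"
proof -
  have "higher_differentiable_on n (\<lambda>x. c) U" for n and c :: 'b
    by (induction n arbitrary: c) simp_all
  then show ?thesis by (simp add: smooth_on_def)
qed

lemma has_derivative_fst_diff:
  "((\<lambda>y :: 'a::real_normed_vector \<times> 'b::real_normed_vector. fst y - k) has_derivative fst) (at x)"
  by (auto intro!: derivative_eq_intros)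

lemmas frechet_derivative_fst_diff = frechet_derivative_at[OF has_derivative_fst_diff, symmetric]

lemma smooth_on_fst_diff:
  "smooth_on (\<lambda>y :: 'a::real_normed_vector \<times> 'b::real_normed_vector. fst y - k) U"
  unfolding smooth_on_def
proof
  fix n
  show "higher_differentiable_on n (\<lambda>y :: 'a \<times> 'b. fst y - k) U"
  proof (cases n)
    case (Suc m)
    have "(\<lambda>y :: 'a \<times> 'b. fst y - k) differentiable (at x)" for x
      unfolding differentiable_def using has_derivative_fst_diff by blast
    moreover have "higher_differentiable_on m (\<lambda>x :: 'a \<times> 'b. c) U" for c :: 'a
      using smooth_on_const[of c U] by (simp add: smooth_on_def)
    ultimately show ?thesis using Suc by (simp add: frechet_derivative_fst_diff)
  qed (auto intro!: continuous_intros)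
qed

lemma fst_tangent_vector_slice:
  assumes "X \<in> tangent_vectors {x \<in> M. fst x = k} x"
  shows "fst X = 0"
proof -
  obtain \<gamma> where \<gamma>: "\<gamma> 0 = x" "\<forall>\<^sub>F r in at 0. \<gamma> r \<in> {x \<in> M. fst x = k}"
    "(\<gamma> has_vector_derivative X) (at (0::real))"
    using assms unfolding tangent_vectors_def by blast
  have d: "((\<lambda>r. fst (\<gamma> r)) has_real_derivative fst X) (at 0)"
    unfolding has_real_derivative_iff_has_vector_derivative
    using bounded_linear.has_vector_derivative[OF bounded_linear_fst \<gamma>(3)] .
  \<comment> \<open>The filter \<open>at 0\<close> omits r = 0, so the value of the curve at 0 is
    recovered by continuity before the derivative of a constant is taken.\<close>
  then have "((\<lambda>r. fst (\<gamma> r)) \<longlongrightarrow> fst (\<gamma> 0)) (at 0)"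
    using DERIV_isCont isCont_def by blast
  moreover have "((\<lambda>r. fst (\<gamma> r)) \<longlongrightarrow> k) (at 0)"
    by (rule tendsto_eventually) (use \<gamma>(2) in eventually_elim, simp)
  ultimately have "fst (\<gamma> 0) = k" by (rule tendsto_unique[OF trivial_limit_at])
  then have "\<forall>\<^sub>F r in nhds 0. fst (\<gamma> r) = k"
    using \<gamma>(2) by (auto simp: eventually_at_filter elim: eventually_mono)
  then have "((\<lambda>r. k) has_real_derivative fst X) (at 0)"
    using d DERIV_cong_ev[of 0 0 "\<lambda>r. fst (\<gamma> r)" "\<lambda>r. k" "fst X" "fst X"] by simp
  then show ?thesis using DERIV_const DERIV_unique by blast
qed

text \<open>The unit normal is the constant field \<open>(1, 0)\<close>. Its covariant derivative
  vanishes, so the slices are even totally geodesic and the umbilicity factor is 0.\<close>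

lemma slice_totally_umbilical:
  "totally_umbilical_spacelike_hypersurface (conformal_model UNIV) {x \<in> conformal_model UNIV. fst x = k}"
  (is "totally_umbilical_spacelike_hypersurface _ ?\<Sigma>")
proof -
  have "(k, axis 1 1) \<in> ?\<Sigma>" by (simp add: conformal_model_def)
  then have ne: "?\<Sigma> \<noteq> {}" by blast
  have emb: "embedded_hypersurface (conformal_model UNIV) ?\<Sigma>"
    unfolding embedded_hypersurface_def
  proof (intro conjI ballI, goal_cases)
    case (3 x)
    show ?case
    proof (rule exI[of _ UNIV], rule exI[of _ "\<lambda>y. fst y - k"], intro conjI ballI)
      fix y :: event
      show "\<exists>X\<in>tangent_space y. frechet_derivative (\<lambda>y :: event. fst y - k) (at y) X \<noteq> 0"
        unfolding frechet_derivative_fst_diff by (rule bexI[of _ "(1, 0)"]) (simp_all add: tangent_space_def)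
    qed (auto intro: smooth_on_fst_diff)
  qed (use ne in auto)
  have pos: "0 < background_metric X X" if "X \<in> tangent_vectors ?\<Sigma> x" "X \<noteq> 0" for X x
  proof -
    have "fst X = 0" using fst_tangent_vector_slice[OF that(1)] .
    moreover have "snd X \<noteq> 0" using that(2) calculation by (auto simp: prod_eq_iff)
    ultimately show ?thesis by (simp add: background_metric_def)
  qed
  show ?thesis
    unfolding totally_umbilical_spacelike_hypersurface_def spacelike_hypersurface_def
  proof (intro conjI ballI emb impI, goal_cases)
    case (2 x)
    show ?case
    proof (intro exI[of _ UNIV] exI[of _ "\<lambda>y :: event. (1, 0) :: event"] conjI ballI)
      fix y :: event
      show "\<exists>k. \<forall>X\<in>tangent_vectors ?\<Sigma> y. \<forall>Y\<in>tangent_vectors ?\<Sigma> y.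
          - background_metric (covariant_derivative (\<lambda>y :: event. (1, 0) :: event) y X) Y = k * background_metric X Y"
        by (intro exI[of _ 0]) (simp add: covariant_derivative_def tangent_projection_def background_metric_def)
    qed (auto simp: tangent_space_def background_metric_def smooth_on_const fst_tangent_vector_slice)
  qed (rule pos)
qed

lemma conformal_form_nondegenerate:
  assumes "S (fst x) \<noteq> 0"
  shows "nondegenerate_on (tangent_space x) (conformal_form S x)"
    and "lorentz_type_on (tangent_space x) (conformal_form S x)"
proof -
  have pos: "(S (fst x))\<^sup>2 > 0" using assms by simp
  show "nondegenerate_on (tangent_space x) (conformal_form S x)"
    unfolding nondegenerate_on_def
  proof (intro ballI impI)
    fix X assume X: "X \<in> tangent_space x" and 0: "\<forall>Y\<in>tangent_space x. conformal_form S x X Y = 0"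
    \<comment> \<open>Pairing with the time-reflected vector turns the Lorentz product into the
      Euclidean square of \<open>X\<close>.\<close>
    have "(- fst X, snd X) \<in> tangent_space x" using X by (simp add: tangent_space_def)
    then have "conformal_form S x X (- fst X, snd X) = 0" using 0 by blast
    then have "fst X * fst X + snd X \<bullet> snd X = 0" using assms by (simp add: conformal_form_def background_metric_def)
    moreover have "fst X * fst X \<ge> 0" "snd X \<bullet> snd X \<ge> 0" by simp_all
    ultimately have "fst X * fst X = 0" "snd X \<bullet> snd X = 0" by linarith+
    then show "X = 0" by (simp add: prod_eq_iff)
  qed
  show "lorentz_type_on (tangent_space x) (conformal_form S x)"
    unfolding lorentz_type_on_def
  proof (intro bexI[of _ "(1, 0)"] conjI ballI impI)
    show "conformal_form S x (1, 0) (1, 0) < 0"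
      using pos by (simp add: conformal_form_def background_metric_def)
    fix X assume "conformal_form S x (1, 0) X = 0 \<and> X \<noteq> 0"
    then have X: "fst X = 0" "snd X \<noteq> 0"
      using assms by (auto simp: conformal_form_def background_metric_def prod_eq_iff)
    then show "0 < conformal_form S x X X"
      using pos by (simp add: conformal_form_def background_metric_def)
  qed (simp add: tangent_space_def)
qed

section \<open>The lattice of the angular parameter and the bounds in terms of e1\<close>

lemma real_lattice_of_real_invariants:
  assumes L: "is_complex_lattice L" and g2: "lattice_g2 L \<in> \<real>" and g3: "lattice_g3 L \<in> \<real>"
  shows "real_lattice L"
proof -
  interpret complex_lattice L by (rule complex_lattice.intro[OF L])
  obtain w1 w2 where w: "w1 \<noteq> 0" "Im (w2 / w1) \<noteq> 0"
    and L_eq: "L = {of_int m * w1 + of_int n * w2 | m n. True}"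
    using L unfolding is_complex_lattice_def by blast
  have "cnj ` L = {of_int m * cnj w1 + of_int n * cnj w2 | m n. True}"
    unfolding L_eq by force
  moreover have "Im (cnj w2 / cnj w1) \<noteq> 0" using w(2) by (simp flip: complex_cnj_divide)
  ultimately have cL: "is_complex_lattice (cnj ` L)"
    unfolding is_complex_lattice_def using w(1) by (intro exI[of _ "cnj w1"] exI[of _ "cnj w2"]) simp
  \<comment> \<open>The conjugate lattice has conjugate invariants; when these are real, uniqueness
    identifies it with \<open>L\<close>.\<close>
  have "lattice_g2 (cnj ` L) = cnj (lattice_g2 L)" "lattice_g3 (cnj ` L) = cnj (lattice_g3 L)"
    by (simp_all add: lattice_g2_def lattice_g3_def infsum_cnj_image)
  then have "cnj ` L = L"
    using g2 g3 cL L by (intro lattice_determined_by_invariants) (simp_all add: Reals_cnj_iff)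
  then show ?thesis by unfold_locales blast
qed

lemma theta_lattice_invariants:
  assumes "\<theta> \<in> {- pi / 3<..<0}"
  shows "is_complex_lattice (theta_lattice \<theta>)"
    and "lattice_g2 (theta_lattice \<theta>) = of_real (1 / 12)"
    and "lattice_g3 (theta_lattice \<theta>) = of_real (- cos (3 * \<theta>) / 216)"
proof -
  \<comment> \<open>As 27 / 216^2 = 1 / 12^3, positivity of the discriminant means that the square
    of cos (3 \<theta>) is less than 1, which holds because 3 \<theta> lies strictly between - \<pi>
    and 0.\<close>
  have "sin (- (3 * \<theta>)) > 0" using assms by (intro sin_gt_zero) auto
  then have "(sin (3 * \<theta>))\<^sup>2 > 0" by simp
  then have "(cos (3 * \<theta>))\<^sup>2 < 1" using sin_cos_squared_add[of "3 * \<theta>"] by linarith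
  then have "27 * (- cos (3 * \<theta>) / 216)\<^sup>2 < (1 / 12 :: real) ^ 3"
    by (simp add: power_divide)
  then obtain L where L: "is_complex_lattice L" "lattice_g2 L = of_real (1 / 12)"
      "lattice_g3 L = of_real (- cos (3 * \<theta>) / 216)"
    by (rule lattice_with_real_invariants_exists[rotated]) auto
  have "\<exists>!L. is_complex_lattice L \<and> lattice_g2 L = of_real (1 / 12) \<and>
      lattice_g3 L = of_real (- cos (3 * \<theta>) / 216)"
  proof (rule ex1I[of _ L])
    fix L' assume L': "is_complex_lattice L' \<and> lattice_g2 L' = of_real (1 / 12) \<and>
      lattice_g3 L' = of_real (- cos (3 * \<theta>) / 216)"
    show "L' = L" by (rule lattice_determined_by_invariants) (use L L' in \<open>simp_all only:\<close>)
  qed (use L in simp)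
  from theI'[OF this]
  show "is_complex_lattice (theta_lattice \<theta>)"
    and "lattice_g2 (theta_lattice \<theta>) = of_real (1 / 12)"
    and "lattice_g3 (theta_lattice \<theta>) = of_real (- cos (3 * \<theta>) / 216)"
    unfolding theta_lattice_def lattice_of_invariants_def by blast+
qed

lemma theta_half_period_eq:
  assumes \<rho>: "\<rho> > 0" "\<And>x. of_real x \<in> theta_lattice \<theta> \<longleftrightarrow> (\<exists>k::int. x = of_int k * \<rho>)"
  shows "theta_half_period \<theta> = \<rho> / 2"
  unfolding theta_half_period_def
proof (rule cInf_eq_minimum)
  have "of_real \<rho> \<in> theta_lattice \<theta>" unfolding \<rho>(2) by (intro exI[of _ 1]) simp
  then show "\<rho> / 2 \<in> {w. 0 < w \<and> complex_of_real (2 * w) \<in> theta_lattice \<theta>}" using \<rho>(1) by simp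
  fix w assume w: "w \<in> {w. 0 < w \<and> complex_of_real (2 * w) \<in> theta_lattice \<theta>}"
  then obtain k :: int where k: "2 * w = of_int k * \<rho>" unfolding \<rho>(2)[symmetric] mem_Collect_eq using \<rho>(2) by blast
  then have "of_int k * \<rho> > 0" using w by (metis mem_Collect_eq mult_pos_pos zero_less_numeral)
  then have "k > 0" using \<rho>(1) by (simp add: zero_less_mult_iff)
  then have "1 * \<rho> \<le> of_int k * \<rho>" using \<rho>(1) by (intro mult_right_mono) auto
  then show "\<rho> / 2 \<le> w" using k by simp
qed

text \<open>With \<open>x = 12 e\<^sub>1 - 1\<close>, the Weierstrass cubic at \<open>e\<^sub>1\<close> is \<open>(x\<^sup>3 + 3 x\<^sup>2 - 9 a H\<^sup>2) / 432\<close>.\<close>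

lemma angular_parameter_facts:
  assumes ang: "angular_parameter a H \<theta>"
  defines "x \<equiv> cos \<theta> - sqrt 3 * sin \<theta> - 1"
  shows "x > 0" and "9 * a * H\<^sup>2 = x ^ 3 + 3 * x\<^sup>2" and "class_g3 a H = - cos (3 * \<theta>) / 216"
proof -
  have \<theta>: "- pi / 3 < \<theta>" "\<theta> < 0" using ang by (auto simp: angular_parameter_def)
  \<comment> \<open>x + 1 = 2 cos (\<theta> + \<pi> / 3), with an angle strictly between 0 and \<pi>
    / 3.\<close>
  have "cos (pi / 3) < cos (\<theta> + pi / 3)"
    using \<theta> by (intro cos_monotone_0_pi) auto
  also have "cos (\<theta> + pi / 3) = (cos \<theta> - sqrt 3 * sin \<theta>) / 2"
    unfolding cos_add cos_60 sin_60 by (simp add: field_simps)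
  finally show "x > 0" by (simp add: x_def cos_60)
  define e where "e = (cos \<theta> - sqrt 3 * sin \<theta>) / 12"
  have e: "1 / (4 * sqrt 3) * (1 / sqrt 3 * cos \<theta> - sin \<theta>) = e"
  proof -
    have "1 / (4 * sqrt 3) * (1 / sqrt 3 * cos \<theta> - sin \<theta>) = cos \<theta> / (4 * (sqrt 3 * sqrt 3)) - sin \<theta> * (sqrt 3 / (4 * (sqrt 3 * sqrt 3)))"
      by (simp add: field_simps del: real_sqrt_mult_self)
    then show ?thesis by (simp add: e_def field_simps)
  qed
  have "1 / (4 * sqrt 3) * (1 / sqrt 3 * cos \<theta> - sin \<theta>) \<in> {x::real. 4 * x ^ 3 - class_g2 * x - class_g3 a H = 0}"
    using ang unfolding angular_parameter_def Let_def by blast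
  then have g3: "class_g3 a H = 4 * e ^ 3 - e / 12"
    unfolding e by (simp add: class_g2_def)
  have ex: "e = (x + 1) / 12" by (simp add: e_def x_def)
  have "432 * class_g3 a H = x ^ 3 + 3 * x\<^sup>2 - 2"
    unfolding g3 ex by (simp add: field_simps eval_nat_numeral)
  then show "9 * a * H\<^sup>2 = x ^ 3 + 3 * x\<^sup>2" by (simp add: class_g3_def)
  define y where "y = sqrt 3 * sin \<theta>"
  have y2: "y\<^sup>2 = 3 - 3 * (cos \<theta>)\<^sup>2" by (simp add: y_def power_mult_distrib sin_squared_eq)
  have "432 * class_g3 a H = (cos \<theta> - y) ^ 3 - 3 * (cos \<theta> - y)"
    unfolding g3 e_def y_def by (simp add: field_simps eval_nat_numeral)
  also have "\<dots> = cos \<theta> ^ 3 - 3 * (cos \<theta>)\<^sup>2 * y + 3 * cos \<theta> * y\<^sup>2 - y * y\<^sup>2 - 3 * cos \<theta> + 3 * y"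
    by (simp add: algebra_simps eval_nat_numeral)
  also have "\<dots> = - 2 * (4 * cos \<theta> ^ 3 - 3 * cos \<theta>)"
    unfolding y2 by (simp add: algebra_simps eval_nat_numeral)
  also have "\<dots> = - 2 * cos (3 * \<theta>)"
    by (simp add: cos_treble_cos)
  finally show "class_g3 a H = - cos (3 * \<theta>) / 216" by simp
qed

text \<open>At s = M = 3 H / x the density and pressure conditions become polynomial in x, and the
  trigonometric bounds are brought to the same form. All functions of \<theta> are polynomials in c
  = cos \<theta> and y = sqrt 3 sin \<theta>, and the identities hold modulo y^2 = 3 - 3
  c^2.\<close>

lemma bounds_in_terms_of_root:
  fixes \<theta> H :: real
  assumes "H > 0"
  defines "x \<equiv> cos \<theta> - sqrt 3 * sin \<theta> - 1"
  shows "f1_hat \<theta> H = x\<^sup>2 / (3 * H\<^sup>2)"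
    and "f2_hat \<theta> H = x\<^sup>2 * (2 - x) / (18 * H\<^sup>2)"
    and "f3_hat \<theta> H = - x\<^sup>2 * (2 + x) / (6 * H\<^sup>2)"
proof -
  define c y where "c = cos \<theta>" and "y = sqrt 3 * sin \<theta>"
  have x: "x = c - y - 1" by (simp add: x_def c_def y_def)
  have y2: "y\<^sup>2 = 3 - 3 * c\<^sup>2" by (simp add: y_def c_def power_mult_distrib sin_squared_eq)
  have x2: "x\<^sup>2 = 2 * (1 - c) * (2 + c + y)"
  proof -
    have "x\<^sup>2 = c\<^sup>2 + y\<^sup>2 + 1 - 2 * c * y - 2 * c + 2 * y"
      unfolding x by (simp add: algebra_simps power2_eq_square)
    then show ?thesis unfolding y2 by (simp add: algebra_simps power2_eq_square)
  qed
  have "(1 - cos \<theta> + sqrt 3 * sin \<theta>)\<^sup>2 = (- x)\<^sup>2" by (simp add: x_def algebra_simps)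
  then show "f1_hat \<theta> H = x\<^sup>2 / (3 * H\<^sup>2)" by (simp add: f1_hat_def)
  have half: "(sin (\<theta> / 2))\<^sup>2 = (1 - c) / 2"
    using cos_double_sin[of "\<theta> / 2"] by (simp add: c_def)
  have c2: "cos (2 * \<theta>) = 2 * c\<^sup>2 - 1" by (simp add: c_def cos_double_cos)
  have "x\<^sup>2 * (2 - x) = 2 * (1 - c) * ((2 + c + y) * (3 - c + y))"
    unfolding x2 unfolding x by (simp add: algebra_simps)
  also have "(2 + c + y) * (3 - c + y) = 6 + c - c\<^sup>2 + 5 * y + y\<^sup>2"
    by (simp add: algebra_simps power2_eq_square)
  finally have "x\<^sup>2 * (2 - x) = 2 * (1 - c) * (9 + c - 4 * c\<^sup>2 + 5 * y)"
    unfolding y2 by simp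
  moreover have "f2_hat \<theta> H = 2 / (9 * H\<^sup>2) * ((1 - c) / 2) * (9 + c - 4 * c\<^sup>2 + 5 * y)"
    unfolding f2_hat_def half c2 by (simp add: c_def y_def)
  ultimately show "f2_hat \<theta> H = x\<^sup>2 * (2 - x) / (18 * H\<^sup>2)"
    using assms(1) by (simp add: field_simps)
  have s2: "sqrt 3 * sin (2 * \<theta>) = 2 * c * y" by (simp add: sin_double c_def y_def)
  have c3: "cos (3 * \<theta>) = 4 * c ^ 3 - 3 * c" by (simp add: c_def cos_treble_cos)
  have "x\<^sup>2 * (2 + x) = 2 * (1 - c) * ((2 + c + y) * (1 + c - y))"
    unfolding x2 unfolding x by (simp add: algebra_simps)
  also have "(2 + c + y) * (1 + c - y) = 2 + 3 * c + c\<^sup>2 - y - y\<^sup>2"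
    by (simp add: algebra_simps power2_eq_square)
  finally have "x\<^sup>2 * (2 + x) = 2 * (1 - c) * (4 * c\<^sup>2 + 3 * c - 1 - y)"
    unfolding y2 by simp
  moreover have "f3_hat \<theta> H = 1 / (6 * H\<^sup>2) *
      (1 - 2 * c - (2 * c\<^sup>2 - 1) + 2 * (4 * c ^ 3 - 3 * c) + 2 * y - 2 * c * y)"
    unfolding f3_hat_def c2 c3 s2 by (simp add: c_def y_def)
  ultimately show "f3_hat \<theta> H = - x\<^sup>2 * (2 + x) / (6 * H\<^sup>2)"
    using assms(1) by (simp add: field_simps eval_nat_numeral)
qed

theorem theorem4:
  fixes I :: "real set" and s :: "real \<Rightarrow> real" and b \<Lambda> a H \<theta> :: real
    and J :: "real set" and S :: "real \<Rightarrow> real"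
  assumes "m_critical_closed_RW_spacetime I s b \<Lambda> a H"
    and "class_I a H"
    and "angular_parameter a H \<theta>"
    and "0 < H"
    and "J = conformal_domain I s b"
    and "S = conformal_scale I s b"
  shows "\<Lambda> \<le> f1_hat \<theta> H \<and>
    conformal_model J = (UNIV \<times> sphere 0 1) \<and>
    cyclic_model J S \<and>
    (\<exists>c. let slice = (\<lambda>h::int. {x \<in> conformal_model J.
                fst x - c = 2 * of_int h * theta_half_period \<theta>}) in
       (\<forall>x\<in>conformal_model J. \<forall>X\<in>tangent_space x. \<forall>Y\<in>tangent_space x.
          conformal_form S x X Y =
            theta_conformal_factor H \<theta> (fst x - c) * background_metric X Y) \<and>
       (\<forall>h. totally_umbilical_spacelike_hypersurface (conformal_model J) (slice h) \<and>
          (\<forall>x\<in>slice h. \<forall>X\<in>tangent_space x. \<forall>Y\<in>tangent_space x. conformal_form S x X Y = 0)) \<and>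
       (\<forall>x\<in>conformal_model J - (\<Union>h. slice h).
          nondegenerate_on (tangent_space x) (conformal_form S x) \<and>
          lorentz_type_on (tangent_space x) (conformal_form S x))) \<and>
    weak_energy_condition I s \<Lambda> \<and>
    (dominant_energy_condition I s \<Lambda> \<longleftrightarrow> \<Lambda> \<le> f2_hat \<theta> H) \<and>
    (strong_energy_condition I s \<Lambda> \<longleftrightarrow> f3_hat \<theta> H \<le> \<Lambda> \<and> \<Lambda> \<le> f2_hat \<theta> H)"
proof -
  define x where "x = cos \<theta> - sqrt 3 * sin \<theta> - 1"
  \<comment> \<open>The value of 3 H / (12 wp - 1) where wp takes its least real value e1.\<close>
  define M where "M = 3 * H / x"
  note ang = angular_parameter_facts[OF assms(3), folded x_def]
  have H: "H > 0" by fact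
  have aH: "a = (x ^ 3 + 3 * x\<^sup>2) / (9 * H\<^sup>2)" using ang(2) H by (simp add: field_simps)
  have a: "a > 0" unfolding aH using ang(1) H by (intro divide_pos_pos add_pos_pos) auto
  have M: "M > 0" using ang(1) H by (simp add: M_def)
  have root: "H + M - a / 3 * M ^ 3 = 0"
    unfolding aH M_def using ang(1) H by (simp add: field_simps eval_nat_numeral)
  have \<theta>: "\<theta> \<in> {- pi / 3<..<0}" using assms(3) by (simp add: angular_parameter_def)
  note inv = theta_lattice_invariants[OF \<theta>]
  define L where "L = theta_lattice \<theta>"
  interpret real_lattice L
    unfolding L_def by (rule real_lattice_of_real_invariants[OF inv(1)]) (simp_all only: inv Reals_of_real)
  interpret C: critical_RW_on_lattice I s b \<Lambda> a H M L
  proof unfold_locales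
    show RW: "closed_RW_spacetime I s b \<Lambda>" and "\<not> s constant_on I" "internal_parameters I s a H"
      using assms(1) by (auto simp: m_critical_closed_RW_spacetime_def)
    show "Re (lattice_g2 L) = 1 / 12" by (simp add: L_def inv)
    show "Re (lattice_g3 L) = (a * H\<^sup>2 - 2 / 9) / 48"
      using ang(3) by (simp add: L_def inv class_g3_def)
    show "maximal_conformal_domain (RW_spacetime.J I s b) (RW_spacetime.S I s b) a H"
      using assms(1) RW_spacetime.J_def[OF RW_spacetime.intro[OF RW]] RW_spacetime.S_def[OF RW_spacetime.intro[OF RW]]
      by (simp add: m_critical_closed_RW_spacetime_def)
  qed (use a H M root in auto)
  have CJ: "C.J = J" and CS: "C.S = S" by (simp_all add: C.J_def C.S_def assms(5,6))
  \<comment> \<open>The shift \<open>c\<close> reflects the arbitrary origin of conformal time: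
    \<open>S\<close> has its zeros at \<open>c\<close> plus the real periods, not necessarily at
    those periods themselves.\<close>
  obtain c where J: "J = UNIV" and S: "S y = C.F (y - c)" for y
    using C.S_eq_F unfolding CJ CS by metis
  obtain \<rho> where \<rho>: "\<rho> > 0" "\<And>x. of_real x \<in> L \<longleftrightarrow> (\<exists>k::int. x = of_int k * \<rho>)"
    using real_period by blast
  have half: "theta_half_period \<theta> = \<rho> / 2"
    using \<rho> unfolding L_def by (rule theta_half_period_eq)
  have model: "conformal_model J = UNIV \<times> sphere 0 1"
    by (simp add: conformal_model_def J)
  have "of_real \<rho> \<in> L" unfolding \<rho>(2) by (intro exI[of _ 1]) simp
  then have "S (y + \<rho>) = S y" for y
    using C.F_periodic[of \<rho> "y - c"] by (simp add: S algebra_simps)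
  then have cyclic: "cyclic_model J S"
    unfolding cyclic_model_def using J \<rho>(1) by blast
  have F2: "(C.F y)\<^sup>2 = theta_conformal_factor H \<theta> y" for y
    by (simp add: C.F_def C.X_def theta_conformal_factor_def theta_wp_def power_divide power_mult_distrib flip: L_def)
  define slice where "slice = (\<lambda>h::int. {x \<in> conformal_model J. fst x - c = 2 * of_int h * theta_half_period \<theta>})"
  have form: "conformal_form S x X Y = theta_conformal_factor H \<theta> (fst x - c) * background_metric X Y" for x X Y
    by (simp add: conformal_form_def S F2)
  have S0: "S (fst x) = 0 \<longleftrightarrow> x \<in> (\<Union>h. slice h)" if "x \<in> conformal_model J" for x
  proof -
    have "S (fst x) = 0 \<longleftrightarrow> of_real (fst x - c) \<in> L"
      unfolding S using C.F_pos_iff[of "fst x - c"] C.F_nonneg[of "fst x - c"] by linarith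
    also have "\<dots> \<longleftrightarrow> x \<in> (\<Union>h. slice h)"
      unfolding \<rho>(2) using that by (auto simp: slice_def half)
    finally show ?thesis .
  qed
  have slice_eq: "slice h = {x \<in> conformal_model UNIV. fst x = c + 2 * of_int h * theta_half_period \<theta>}" for h
    by (auto simp: slice_def J)
  have M2: "1 / M\<^sup>2 = x\<^sup>2 / (9 * H\<^sup>2)" and M3: "H * (1 / M ^ 3) = x ^ 3 / (27 * H\<^sup>2)"
    using H by (simp_all add: M_def power_divide power_mult_distrib eval_nat_numeral)
  note f = bounds_in_terms_of_root[OF H, of \<theta>, folded x_def]
  have f1: "3 * H / M ^ 3 + 6 / M\<^sup>2 - a = f1_hat \<theta> H"
  proof -
    have "3 * H / M ^ 3 + 6 / M\<^sup>2 - a = 3 * (H * (1 / M ^ 3)) + 6 * (1 / M\<^sup>2) - a" by simp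
    then show ?thesis unfolding M2 M3 aH f using H by (simp add: field_simps)
  qed
  have f2: "3 / 2 * H * (1 / M ^ 3) + 4 * (1 / M\<^sup>2) - a = f2_hat \<theta> H"
    unfolding mult.assoc[of "3 / 2"] M2 M3 aH f using H by (simp add: field_simps eval_nat_numeral)
  have f3: "- (3 / 2 * H * (1 / M ^ 3)) - a = f3_hat \<theta> H"
    unfolding mult.assoc[of "3 / 2"] M3 aH f using H by (simp add: field_simps eval_nat_numeral)
  show ?thesis
    unfolding f1[symmetric] f2[symmetric] f3[symmetric]
  proof (intro conjI C.Lambda_le model cyclic C.weak C.dominant_iff C.strong_iff,
      rule exI[of _ c], unfold Let_def slice_def[symmetric], intro conjI allI ballI)
    fix h
    show "totally_umbilical_spacelike_hypersurface (conformal_model J) (slice h)"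
      unfolding slice_eq J by (rule slice_totally_umbilical)
  next
    fix h x X Y assume "x \<in> slice h"
    then have "S (fst x) = 0" using S0[of x] by (auto simp: slice_def)
    then show "conformal_form S x X Y = 0" by (simp add: conformal_form_def)
  next
    fix x assume "x \<in> conformal_model J - (\<Union>h. slice h)"
    then have "S (fst x) \<noteq> 0" using S0[of x] by blast
    then show "nondegenerate_on (tangent_space x) (conformal_form S x)"
      and "lorentz_type_on (tangent_space x) (conformal_form S x)"
      by (rule conformal_form_nondegenerate)+
  qed (rule form)
qed

end
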